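(* Let $\lambda>0$, $q>p-1$, and let $u_0\in\mathcal H\cap L^\infty(\Omega)$ be nonnegative. Let $u$ be the solution of $(\mathcal P_\lambda)$ provided by Theorem 1.4. Then: (i) if $q>1$, then $T_{\max}<+\infty$; (ii) if $q=1$, then $\|u(t)\|_{L^2(\Omega_0)}\to+\infty$ as $t\to+\infty$; (iii) if $q<1$, then $\sup_{t\in(0,+\infty)}\|u(t)\|_{L^\infty(\Omega_0)}=+\infty$.
   Context: Standing setting: $\Omega\subset\mathbb R^d$, $d\ge2$, bounded regular domain; $s\in(0,1)$, $p\in(1,\infty)$; $(-\Delta)^s_p u(x)=2\,\mathrm{P.V.}\int\frac{|u(x)-u(y)|^{p-2}(u(x)-u(y))}{|x-y|^{d+sp}}dy$; for open $\omega$, $W^{s,p}_0(\omega)$ = functions in $L^p(\mathbb R^d)$ vanishing off $\omega$ with finite seminorm $\|u\|^p_{W^{s,p}_0(\omega)}=\int_{\mathbb R^{2d}}\frac{|u(x)-u(y)|^p}{|x-y|^{d+sp}}$. Parameters $r>p-1$; $b\in L^\infty(\Omega)$, $b\ge0$, $b\not\equiv0$, $b^{-1}(\{0\})=\overline{\Omega_0}$ with $\Omega_0\subset\Omega$ a $C^{1,1}$ open set, $|\Omega_0|>0$. $(\mathcal P_\lambda)$: $\partial_tu+(-\Delta)^s_pu=\lambda u^q-bu^r$ in $(0,T)\times\Omega$, $u=0$ off $\Omega$, $u\ge0$, $u(0)=u_0$; weak solutions are nonnegative $u\in L^\infty(Q_T)\cap L^\infty(0,T;W^{s,p}_0(\Omega))$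 with $\partial_tu\in L^2(Q_T)$ satisfying the weak formulation. "The solution provided by Theorem 1.4" is the weak solution obtained as limit of the implicit scheme $\frac{u_n-u_{n-1}}{\Delta t}+(-\Delta)^s_pu_n+bu_n^r=\lambda\min(R,u_{n-1})^q$ (large $R$), global if $q\le1$ and unique if $q\ge1$; for $q\ge1$, $T_{\max}$ is the supremum of existence times. For $v\in W^{s,p}_0(\Omega_0)$, $E_{\Omega_0}(v)=\frac1p\|v\|^p_{W^{s,p}_0(\Omega_0)}-\frac{\lambda}{q+1}\|v\|^{q+1}_{L^{q+1}(\Omega_0)}$, and $\mathcal H=\{w\in W^{s,p}_0(\Omega):\ \exists v_0\in W^{s,p}_0(\Omega_0)\text{ with }0\le v_0\le w\text{ and }E_{\Omega_0}(v_0)<0\}$. *)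

theory Defs
  imports "HOL-Analysis.Analysis" "HOL-Probability.Essential_Supremum"
begin

definition C11_open :: "'a::euclidean_space set \<Rightarrow> bool" where
  "C11_open S \<longleftrightarrow> open S \<and>
     (\<forall>x\<in>frontier S. \<exists>r>0. \<exists>e::'a. \<exists>g::'a \<Rightarrow> real. \<exists>g'::'a \<Rightarrow> 'a. \<exists>L.
        norm e = 1 \<and>
        (\<forall>z. (g has_derivative (\<lambda>h. g' z \<bullet> h)) (at z)) \<and>
        (\<forall>z w. norm (g' z - g' w) \<le> L * norm (z - w)) \<and>
        S \<inter> ball x r = {y \<in> ball x r. y \<bullet> e < g (y - (y \<bullet> e) *\<^sub>R e)})"

definition regular_domain :: "'a::euclidean_space set \<Rightarrow> bool" where
  "regular_domain \<Omega> \<longleftrightarrow> bounded \<Omega> \<and> connected \<Omega> \<and> \<Omega> \<noteq> {} \<and> C11_open \<Omega>"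

definition gagliardo :: "real \<Rightarrow> real \<Rightarrow> ('a::euclidean_space \<Rightarrow> real) \<Rightarrow> ennreal" where
  "gagliardo s p v =
     (\<integral>\<^sup>+ z. ennreal (\<bar>v (fst z) - v (snd z)\<bar> powr p /
              norm (fst z - snd z) powr (real DIM('a) + s * p)) \<partial>(lborel \<Otimes>\<^sub>M lborel))"

definition W0 :: "real \<Rightarrow> real \<Rightarrow> 'a::euclidean_space set \<Rightarrow> ('a \<Rightarrow> real) set" where
  "W0 s p \<omega> = {v. v \<in> borel_measurable lborel \<and> integrable lborel (\<lambda>x. \<bar>v x\<bar> powr p) \<and>
                   (AE x in lborel. x \<notin> \<omega> \<longrightarrow> v x = 0) \<and> gagliardo s p v < \<infinity>}"

definition Linf :: "('a::euclidean_space \<Rightarrow> real) \<Rightarrow> bool" where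
  "Linf v \<longleftrightarrow> v \<in> borel_measurable lborel \<and> (\<exists>M. AE x in lborel. \<bar>v x\<bar> \<le> M)"

text \<open>The form <(-Delta)^s_p u, phi> = int int J(u(x)-u(y))(phi(x)-phi(y))/|x-y|^{d+sp}
  (the factor 2 in the definition of the operator is absorbed by symmetrisation).\<close>
definition frac_form :: "real \<Rightarrow> real \<Rightarrow> ('a::euclidean_space \<Rightarrow> real) \<Rightarrow> ('a \<Rightarrow> real) \<Rightarrow> real" where
  "frac_form s p u \<phi> =
     (\<integral> z. (\<bar>u (fst z) - u (snd z)\<bar> powr (p - 2) * (u (fst z) - u (snd z))) *
            (\<phi> (fst z) - \<phi> (snd z)) / norm (fst z - snd z) powr (real DIM('a) + s * p)
        \<partial>(lborel \<Otimes>\<^sub>M lborel))"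

definition energy :: "real \<Rightarrow> real \<Rightarrow> real \<Rightarrow> real \<Rightarrow> 'a::euclidean_space set \<Rightarrow> ('a \<Rightarrow> real) \<Rightarrow> real" where
  "energy s p lam q \<Omega>0 v =
     1 / p * enn2real (gagliardo s p v)
     - lam / (q + 1) * (\<integral> x. indicator \<Omega>0 x * \<bar>v x\<bar> powr (q + 1) \<partial>lborel)"

definition Hset :: "real \<Rightarrow> real \<Rightarrow> real \<Rightarrow> real \<Rightarrow> 'a::euclidean_space set \<Rightarrow> 'a set \<Rightarrow> ('a \<Rightarrow> real) set" where
  "Hset s p lam q \<Omega> \<Omega>0 = {w \<in> W0 s p \<Omega>. \<exists>v0 \<in> W0 s p \<Omega>0.
        (AE x in lborel. 0 \<le> v0 x \<and> v0 x \<le> w x) \<and> energy s p lam q \<Omega>0 v0 < 0}"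

text \<open>u t x is the value at time t and point x; w is the time derivative, an L^2(Q_T)
  function with u(t) = u_0 + int_0^t w (which encodes d_t u in L^2(Q_T) and u(0) = u_0).\<close>
definition weak_solution ::
  "real \<Rightarrow> real \<Rightarrow> 'a::euclidean_space set \<Rightarrow> ('a \<Rightarrow> real) \<Rightarrow> real \<Rightarrow> real \<Rightarrow> real \<Rightarrow>
   ('a \<Rightarrow> real) \<Rightarrow> real \<Rightarrow> (real \<Rightarrow> 'a \<Rightarrow> real) \<Rightarrow> bool" where
  "weak_solution s p \<Omega> b lam q r u0 T u \<longleftrightarrow>
     T > 0 \<and>
     (\<lambda>z. u (fst z) (snd z)) \<in> borel_measurable (lborel \<Otimes>\<^sub>M lborel) \<and>
     (\<forall>t\<in>{0..T}. u t \<in> borel_measurable lborel) \<and>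
     (\<forall>t\<in>{0..T}. AE x in lborel. 0 \<le> u t x) \<and>
     (\<forall>t\<in>{0..T}. AE x in lborel. x \<notin> \<Omega> \<longrightarrow> u t x = 0) \<and>
     (\<exists>M. \<forall>t\<in>{0..T}. AE x in lborel. \<bar>u t x\<bar> \<le> M) \<and>
     (\<exists>K. AE t in lborel. t \<in> {0<..<T} \<longrightarrow> u t \<in> W0 s p \<Omega> \<and> gagliardo s p (u t) \<le> K) \<and>
     (\<exists>w :: real \<Rightarrow> 'a \<Rightarrow> real.
        (\<lambda>z. w (fst z) (snd z)) \<in> borel_measurable (lborel \<Otimes>\<^sub>M lborel) \<and>
        (\<integral>\<^sup>+ t. \<integral>\<^sup>+ x. indicator {0<..<T} t * ennreal ((w t x)\<^sup>2) \<partial>lborel \<partial>lborel) < \<infinity> \<and>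
        (\<forall>t\<in>{0..T}. AE x in lborel.
           u t x = u0 x + (\<integral> \<tau>. indicator {0..t} \<tau> * w \<tau> x \<partial>lborel)) \<and>
        (AE t in lborel. t \<in> {0<..<T} \<longrightarrow>
           (\<forall>\<phi> \<in> W0 s p \<Omega>. Linf \<phi> \<longrightarrow>
              (\<integral> x. w t x * \<phi> x \<partial>lborel) + frac_form s p (u t) \<phi>
              = (\<integral> x. (lam * u t x powr q - b x * u t x powr r) * \<phi> x \<partial>lborel))))"

definition scheme_step ::
  "real \<Rightarrow> real \<Rightarrow> 'a::euclidean_space set \<Rightarrow> ('a \<Rightarrow> real) \<Rightarrow> real \<Rightarrow> real \<Rightarrow> real \<Rightarrow>
   real \<Rightarrow> real \<Rightarrow> ('a \<Rightarrow> real) \<Rightarrow> ('a \<Rightarrow> real) \<Rightarrow> bool" where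
  "scheme_step s p \<Omega> b lam q r R dt uprev un \<longleftrightarrow>
     un \<in> W0 s p \<Omega> \<and> Linf un \<and> (AE x in lborel. 0 \<le> un x) \<and>
     (\<forall>\<phi> \<in> W0 s p \<Omega>. Linf \<phi> \<longrightarrow>
        (\<integral> x. (un x - uprev x) / dt * \<phi> x \<partial>lborel) + frac_form s p un \<phi>
        + (\<integral> x. b x * un x powr r * \<phi> x \<partial>lborel)
        = (\<integral> x. lam * min R (uprev x) powr q * \<phi> x \<partial>lborel))"

definition scheme_run ::
  "real \<Rightarrow> real \<Rightarrow> 'a::euclidean_space set \<Rightarrow> ('a \<Rightarrow> real) \<Rightarrow> real \<Rightarrow> real \<Rightarrow> real \<Rightarrow>
   ('a \<Rightarrow> real) \<Rightarrow> real \<Rightarrow> real \<Rightarrow> nat \<Rightarrow> (nat \<Rightarrow> 'a \<Rightarrow> real) \<Rightarrow> bool" where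
  "scheme_run s p \<Omega> b lam q r u0 R T N U \<longleftrightarrow>
     N > 0 \<and> U 0 = u0 \<and>
     (\<forall>n\<in>{1..N}. scheme_step s p \<Omega> b lam q r R (T / real N) (U (n - 1)) (U n))"

definition scheme_interp :: "real \<Rightarrow> nat \<Rightarrow> (nat \<Rightarrow> 'a \<Rightarrow> real) \<Rightarrow> real \<Rightarrow> 'a \<Rightarrow> real" where
  "scheme_interp T N U t = U (nat \<lceil>t * real N / T\<rceil>)"

definition thm14_solution ::
  "real \<Rightarrow> real \<Rightarrow> 'a::euclidean_space set \<Rightarrow> ('a \<Rightarrow> real) \<Rightarrow> real \<Rightarrow> real \<Rightarrow> real \<Rightarrow>
   ('a \<Rightarrow> real) \<Rightarrow> real \<Rightarrow> (real \<Rightarrow> 'a \<Rightarrow> real) \<Rightarrow> bool" where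
  "thm14_solution s p \<Omega> b lam q r u0 T u \<longleftrightarrow>
     weak_solution s p \<Omega> b lam q r u0 T u \<and>
     (\<exists>R>0. \<exists>Ns :: nat \<Rightarrow> nat. \<exists>Us :: nat \<Rightarrow> nat \<Rightarrow> 'a \<Rightarrow> real.
        strict_mono Ns \<and>
        (\<forall>k. scheme_run s p \<Omega> b lam q r u0 R T (Ns k) (Us k)) \<and>
        (\<lambda>k. \<integral>\<^sup>+ t. \<integral>\<^sup>+ x. indicator {0<..<T} t *
               ennreal ((scheme_interp T (Ns k) (Us k) t x - u t x)\<^sup>2) \<partial>lborel \<partial>lborel)
          \<longlonglongrightarrow> 0)"

definition thm14_global ::
  "real \<Rightarrow> real \<Rightarrow> 'a::euclidean_space set \<Rightarrow> ('a \<Rightarrow> real) \<Rightarrow> real \<Rightarrow> real \<Rightarrow> real \<Rightarrow>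
   ('a \<Rightarrow> real) \<Rightarrow> (real \<Rightarrow> 'a \<Rightarrow> real) \<Rightarrow> bool" where
  "thm14_global s p \<Omega> b lam q r u0 u \<longleftrightarrow>
     (\<forall>T>0. thm14_solution s p \<Omega> b lam q r u0 T u)"

definition Tmax ::
  "real \<Rightarrow> real \<Rightarrow> 'a::euclidean_space set \<Rightarrow> ('a \<Rightarrow> real) \<Rightarrow> real \<Rightarrow> real \<Rightarrow> real \<Rightarrow>
   ('a \<Rightarrow> real) \<Rightarrow> ereal" where
  "Tmax s p \<Omega> b lam q r u0 =
     Sup {ereal T | T. T > 0 \<and> (\<exists>u. thm14_solution s p \<Omega> b lam q r u0 T u)}"

end

theory Submission
  imports Defs
begin

text \<open>Truncate the power nonlinearity to \<open>max 0 (y - \<epsilon>) powr q\<close> with \<open>\<epsilon>\<close> so small that the energy of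
  \<open>v0\<close> stays negative, and minimise this energy over \<open>0 \<le> v \<le> v0\<close>. A minimiser \<open>v\<close> is a stationary
  subsolution supported in \<open>\<Omega>0\<close>, where the absorption vanishes; the truncation has a one-sided Lipschitz
  bound even for \<open>q < 1\<close>, so Gronwall's lemma gives \<open>v \<le> u t\<close> for every weak solution \<open>u\<close>.
  Testing the equation with \<open>v powr p * slope u powr (1 - p)\<close>, Picone's inequality bounds the
  nonlocal term by the seminorm of \<open>v\<close>, while \<open>u \<ge> v\<close> and the negative energy make the source
  term strictly larger. Hence the integral of \<open>v powr p * primitive (u t)\<close> grows at least linearly in
  \<open>t\<close>, where \<open>primitive\<close> is at most linear, and bounded when \<open>q > 1\<close>.\<close>

section \<open>Pointwise inequalities for the p-Laplacian\<close>

text \<open>The datum only supplies a competitor of negative energy, which need not be a subsolution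
  and so cannot be kept below \<open>u\<close> at later times; minimising below it repairs this. The
  minimiser enters only through comparison of energies: no equation and no regularity of it is
  derived. The truncation answers the failure of \<open>y powr q\<close> to be Lipschitz at 0 when
  \<open>q < 1\<close>, where the usual Gronwall argument breaks down. Since the truncated reaction
  lies below the true one, a stationary subsolution for it is also one for the true equation. The
  classical Picone test function \<open>v powr p * u powr (1 - p)\<close> is unbounded where
  \<open>u\<close> vanishes. The function \<open>slope\<close> keeps the denominator away from 0
  without losing Picone's inequality or the monotonicity of the source term. The driving gap is
  strict: negative energy puts the \<open>p\<close>-th power of the seminorm of \<open>v\<close>
  below \<open>p / (q + 1)\<close> times the integral of \<open>lam * v powr (q + 1)\<close>, and
  \<open>p < q + 1\<close>. It survives the change of test function because the parameter of
  \<open>slope\<close> is chosen after \<open>v\<close>.\<close>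

definition jp :: "real \<Rightarrow> real \<Rightarrow> real" where
  "jp p x = \<bar>x\<bar> powr (p - 2) * x"

lemma jp_nonneg: "0 \<le> x \<Longrightarrow> jp p x = x powr (p - 1)"
  using powr_mult_base[of x "p - 2"] by (cases "x = 0") (auto simp: jp_def mult.commute)

lemma jp_minus: "jp p (- x) = - jp p x"
  by (simp add: jp_def)

lemma abs_jp: "\<bar>jp p x\<bar> = \<bar>x\<bar> powr (p - 1)"
proof -
  have "\<bar>jp p x\<bar> = jp p \<bar>x\<bar>" by (simp add: jp_def abs_mult)
  then show ?thesis by (simp add: jp_nonneg)
qed

lemma jp_mult_self: "jp p x * x = \<bar>x\<bar> powr p"
proof -
  have "jp p x * x = \<bar>x\<bar> * jp p \<bar>x\<bar>" by (simp add: jp_def)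
  also have "\<dots> = \<bar>x\<bar> powr p"
    using powr_mult_base[of "\<bar>x\<bar>" "p - 1"] by (simp add: jp_nonneg)
  finally show ?thesis .
qed

lemma jp_mono:
  assumes "1 < p" "x \<le> y"
  shows "jp p x \<le> jp p y"
proof -
  consider "0 \<le> x" | "x < 0" "0 \<le> y" | "y < 0" using assms by linarith
  then show ?thesis
  proof cases
    case 1 then show ?thesis using assms by (simp add: jp_nonneg powr_mono2)
  next
    case 2 then have "jp p x \<le> 0" "0 \<le> jp p y"
      by (simp_all add: jp_nonneg) (simp add: jp_def mult_nonneg_nonpos)
    then show ?thesis by linarith
  next
    case 3
    have "jp p (- y) \<le> jp p (- x)" using 3 assms by (simp add: jp_nonneg powr_mono2 del: minus_le_iff)
    then show ?thesis by (simp add: jp_minus)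
  qed
qed

text \<open>Since \<open>p * jp p\<close> is the derivative of the convex function
  \<open>\<bar>x\<bar> powr p\<close>, this is its tangent inequality at \<open>b\<close>. Deriving
  it from Young's inequality with exponents \<open>p\<close> and \<open>p / (p - 1)\<close> avoids
  differentiating at 0.\<close>

lemma abs_powr_gradient:
  fixes a b p :: real
  assumes p: "1 < p"
  shows "\<bar>b\<bar> powr p + p * (jp p b * (a - b)) \<le> \<bar>a\<bar> powr p"
proof -
  have p1: "1 / p + 1 / (p / (p - 1)) = 1" using p by (simp add: field_simps)
  have "\<bar>a\<bar> * \<bar>b\<bar> powr (p - 1) \<le> \<bar>a\<bar> powr p / p + (\<bar>b\<bar> powr (p - 1)) powr (p / (p - 1)) / (p / (p - 1))"
    by (rule Youngs_inequality) (use p p1 in \<open>auto simp: field_simps\<close>)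
  also have "(\<bar>b\<bar> powr (p - 1)) powr (p / (p - 1)) = \<bar>b\<bar> powr p"
    using p by (simp add: powr_powr)
  finally have "p * (\<bar>a\<bar> * \<bar>b\<bar> powr (p - 1)) \<le> \<bar>a\<bar> powr p + (p - 1) * \<bar>b\<bar> powr p"
    using p by (simp add: field_simps)
  moreover have "jp p b * a \<le> \<bar>a\<bar> * \<bar>b\<bar> powr (p - 1)"
    by (metis abs_ge_self abs_jp abs_mult mult.commute)
  then have "p * (jp p b * a) \<le> p * (\<bar>a\<bar> * \<bar>b\<bar> powr (p - 1))"
    using p by (simp add: mult_left_mono)
  moreover have "p * (jp p b * (a - b)) = p * (jp p b * a) - p * \<bar>b\<bar> powr p"
    by (simp add: jp_mult_self[of p b, symmetric] right_diff_distrib)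
  moreover have "(p - 1) * \<bar>b\<bar> powr p = p * \<bar>b\<bar> powr p - \<bar>b\<bar> powr p"
    by (simp add: left_diff_distrib)
  ultimately show ?thesis by linarith
qed

text \<open>For a convex function, spreading a pair apart at fixed sum raises the sum of the values.
  After ordering the inner pair, the tangents at its two points suffice, because \<open>jp p\<close>
  is monotone.\<close>

lemma abs_powr_four_points:
  fixes a b c d p :: real
  assumes p: "1 < p" and "a \<le> b" "a \<le> c" "b + c = a + d"
  shows "\<bar>b\<bar> powr p + \<bar>c\<bar> powr p \<le> \<bar>a\<bar> powr p + \<bar>d\<bar> powr p"
proof -
  have *: "\<bar>b\<bar> powr p + \<bar>c\<bar> powr p \<le> \<bar>a\<bar> powr p + \<bar>d\<bar> powr p"
    if "a \<le> b" "b \<le> c" "b + c = a + d" for b c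
  proof -
    have 1: "jp p b * (b - a) \<le> jp p c * (b - a)"
      using that jp_mono[OF p] by (intro mult_right_mono) auto
    have d: "d - c = b - a" using that by linarith
    have "p * (jp p b * (a - b)) + p * (jp p c * (d - c)) = p * (jp p c * (b - a) - jp p b * (b - a))"
      unfolding d by (simp add: algebra_simps)
    also have "\<dots> \<ge> 0" using 1 p by simp
    finally show ?thesis
      using abs_powr_gradient[OF p, of b a] abs_powr_gradient[OF p, of c d] by linarith
  qed
  show ?thesis
  proof (cases "b \<le> c")
    case True then show ?thesis using * assms by blast
  next
    case False then show ?thesis using *[of c b] assms by linarith
  qed
qed

text \<open>If \<open>a - c\<close> and \<open>b - d\<close> have the same sign, the differences are
  merely permuted. Otherwise the mixed differences lie between the original ones and have the same
  sum.\<close>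

lemma abs_powr_submodular:
  fixes a b c d p :: real
  assumes p: "1 < p"
  shows "\<bar>min a c - min b d\<bar> powr p + \<bar>max a c - max b d\<bar> powr p \<le> \<bar>a - b\<bar> powr p + \<bar>c - d\<bar> powr p"
proof (cases "a \<le> c"; cases "b \<le> d")
  assume "a \<le> c" "\<not> b \<le> d"
  then show ?thesis
    using abs_powr_four_points[OF p, of "a - b" "a - d" "c - b" "c - d"] by simp
next
  assume "\<not> a \<le> c" "b \<le> d"
  then show ?thesis
    using abs_powr_four_points[OF p, of "c - d" "c - b" "a - d" "a - b"] by simp
qed auto

text \<open>The pointwise form of testing the operator at \<open>u\<close> with the positive part of
  \<open>v - u\<close>, where \<open>a\<close>, \<open>b\<close> are values of \<open>v\<close> and
  \<open>c\<close>, \<open>d\<close> values of \<open>u\<close>. One has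
  \<open>a - b = m + f\<close>, and the tangent inequality at \<open>m\<close> would do with
  \<open>jp p m\<close>. Replacing \<open>m\<close> by \<open>c - d\<close> goes the right way:
  either \<open>f = 0\<close>, or \<open>m = c - d\<close>, or \<open>m - (c - d)\<close> has the
  sign of \<open>f\<close>.\<close>

lemma abs_powr_min_gradient:
  fixes a b c d p :: real
  assumes p: "1 < p"
  shows "p * (jp p (c - d) * (max 0 (a - c) - max 0 (b - d))) + \<bar>min a c - min b d\<bar> powr p
           \<le> \<bar>a - b\<bar> powr p"
proof -
  define m where "m = min a c - min b d"
  define f where "f = max 0 (a - c) - max 0 (b - d)"
  have f: "f = (a - b) - m" by (auto simp: f_def m_def min_def max_def)
  have "jp p (c - d) * f \<le> jp p m * f"
  proof (cases "a \<le> c"; cases "b \<le> d")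
    assume "a \<le> c" "\<not> b \<le> d"
    then have "jp p m \<le> jp p (c - d)" "f \<le> 0"
      using jp_mono[OF p, of m "c - d"] by (auto simp: m_def f_def)
    then show ?thesis by (rule mult_right_mono_neg)
  next
    assume "\<not> a \<le> c" "b \<le> d"
    then have "jp p (c - d) \<le> jp p m" "0 \<le> f"
      using jp_mono[OF p, of "c - d" m] by (auto simp: m_def f_def)
    then show ?thesis by (rule mult_right_mono)
  qed (auto simp: m_def f_def)
  then have "p * (jp p (c - d) * f) \<le> p * (jp p m * f)" using p by simp
  then show ?thesis
    using abs_powr_gradient[OF p, of m "a - b"] f unfolding m_def[symmetric] f_def[symmetric] by simp
qed

text \<open>The case of equality in the hypothesis on the denominators is Picone's inequality;
  it expresses convexity of the perspective \<open>(a, A) \<mapsto> a powr p * A powr (1 - p)\<close>.\<close>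
lemma picone_pointwise:
  fixes a b p x y A B :: real
  assumes p: "1 < p" and ab: "0 \<le> a" "0 \<le> b" and AB: "0 < A" "0 < B"
    and AB1: "y \<le> x \<Longrightarrow> x - y \<le> A - B" and AB2: "x \<le> y \<Longrightarrow> y - x \<le> B - A"
  shows "jp p (x - y) * (a powr p * A powr (1 - p) - b powr p * B powr (1 - p)) \<le> \<bar>a - b\<bar> powr p"
proof -
  have *: "jp p t * (a powr p * A powr (1 - p) - b powr p * B powr (1 - p)) \<le> \<bar>a - b\<bar> powr p"
    if ab: "0 \<le> a" "0 \<le> b" and AB: "0 < A" "0 < B" and t: "0 \<le> t" "t \<le> A - B" for a b A B t :: real
  proof (cases "t = 0")
    case True then show ?thesis by (simp add: jp_def)
  next
    case False
    with t have t0: "0 < t" by simp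
    \<comment> \<open>\<open>Y\<close> is the mean of \<open>b / B\<close> and
      \<open>(a - b) / t\<close> with weights \<open>B\<close> and \<open>t\<close>. Jensen's
      inequality follows by adding the tangent inequalities at \<open>Y\<close>, whose linear terms
      cancel.\<close>
    define Y where "Y = a / (B + t)"
    have Y0: "0 \<le> Y" using ab AB t0 by (simp add: Y_def)
    have "B * (Y powr p + p * (jp p Y * (b / B - Y))) \<le> B * (b / B) powr p"
      using abs_powr_gradient[OF p, of Y "b / B"] ab AB Y0 by (intro mult_left_mono) auto
    moreover have "t * (Y powr p + p * (jp p Y * ((a - b) / t - Y))) \<le> t * \<bar>(a - b) / t\<bar> powr p"
      using abs_powr_gradient[OF p, of Y "(a - b) / t"] t0 Y0 by (intro mult_left_mono) auto
    moreover have "B * (Y powr p + p * (jp p Y * (b / B - Y))) + t * (Y powr p + p * (jp p Y * ((a - b) / t - Y)))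
        = (B + t) * Y powr p"
    proof -
      have "B * (b / B - Y) + t * ((a - b) / t - Y) = a - (B + t) * Y"
        using AB t0 by (simp add: field_simps)
      also have "\<dots> = 0" using AB t0 by (simp add: Y_def)
      finally have 0: "B * (b / B - Y) + t * ((a - b) / t - Y) = 0" .
      have "B * (Y powr p + p * (jp p Y * (b / B - Y))) + t * (Y powr p + p * (jp p Y * ((a - b) / t - Y)))
          = (B + t) * Y powr p + p * jp p Y * (B * (b / B - Y) + t * ((a - b) / t - Y))"
        by (simp add: algebra_simps)
      then show ?thesis by (simp add: 0)
    qed
    ultimately have conv: "(B + t) * Y powr p \<le> B * (b / B) powr p + t * \<bar>(a - b) / t\<bar> powr p"
      by linarith
    have sc: "s * (c / s) powr p = c powr p * s powr (1 - p)" if "0 < s" "0 \<le> c" for s c :: real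
      using that by (simp add: powr_divide powr_diff)
    \<comment> \<open>The hypothesis \<open>B + t \<le> A\<close> is an inequality in the useful
      direction, as \<open>1 - p\<close> is negative.\<close>
    have "a powr p * A powr (1 - p) \<le> a powr p * (B + t) powr (1 - p)"
      using AB t t0 p by (intro mult_left_mono powr_mono2') auto
    also have "\<dots> = (B + t) * Y powr p" using sc[of "B + t" a] ab AB t0 by (simp add: Y_def)
    also have "\<dots> \<le> b powr p * B powr (1 - p) + \<bar>a - b\<bar> powr p * t powr (1 - p)"
      using conv sc[of B b] sc[of t "\<bar>a - b\<bar>"] ab AB t0 by simp
    finally have "t powr (p - 1) * (a powr p * A powr (1 - p) - b powr p * B powr (1 - p))
        \<le> t powr (p - 1) * (\<bar>a - b\<bar> powr p * t powr (1 - p))"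
      by (intro mult_left_mono) auto
    also have "\<dots> = \<bar>a - b\<bar> powr p" using t0 by (simp add: powr_add[symmetric])
    finally show ?thesis using t0 by (simp add: jp_nonneg)
  qed
  show ?thesis
  proof (cases "y \<le> x")
    case True then show ?thesis using *[of a b A B "x - y"] assms by simp
  next
    case False
    then have "jp p (y - x) * (b powr p * B powr (1 - p) - a powr p * A powr (1 - p)) \<le> \<bar>b - a\<bar> powr p"
      using *[of b a B A "y - x"] assms by simp
    then show ?thesis
      using jp_minus[of p "x - y"] by (simp add: algebra_simps abs_minus_commute)
  qed
qed

section \<open>The Gagliardo seminorm and the fractional form\<close>

definition gag_density :: "real \<Rightarrow> real \<Rightarrow> ('a::euclidean_space \<Rightarrow> real) \<Rightarrow> 'a \<times> 'a \<Rightarrow> real" where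
  "gag_density s p v z = \<bar>v (fst z) - v (snd z)\<bar> powr p / norm (fst z - snd z) powr (real DIM('a) + s * p)"

lemma gag_density_nonneg: "0 \<le> gag_density s p v z"
  by (simp add: gag_density_def)

lemma gag_density_measurable [measurable]:
  assumes [measurable]: "v \<in> borel_measurable borel"
  shows "gag_density s p v \<in> borel_measurable (lborel \<Otimes>\<^sub>M lborel)"
  unfolding gag_density_def by measurable

lemma gagliardo_density: "gagliardo s p v = (\<integral>\<^sup>+ z. ennreal (gag_density s p v z) \<partial>(lborel \<Otimes>\<^sub>M lborel))"
  by (simp add: gagliardo_def gag_density_def)

lemma gag_density_integrable:
  assumes [measurable]: "v \<in> borel_measurable borel" and "gagliardo s p v < \<infinity>"
  shows "integrable (lborel \<Otimes>\<^sub>M lborel) (gag_density s p v)"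
  using assms(2) by (intro integrableI_nonneg) (auto simp: gagliardo_density gag_density_nonneg)

lemma enn2real_gagliardo:
  assumes [measurable]: "v \<in> borel_measurable borel"
  shows "enn2real (gagliardo s p v) = (\<integral> z. gag_density s p v z \<partial>(lborel \<Otimes>\<^sub>M lborel))"
  unfolding gagliardo_density
  by (rule integral_eq_nn_integral[symmetric]) (auto simp: gag_density_nonneg)

lemma AE_lborel_pair:
  fixes P :: "'a::euclidean_space \<Rightarrow> bool"
  assumes "AE x in lborel. P x"
  shows "AE z in lborel \<Otimes>\<^sub>M (lborel :: 'b::euclidean_space measure). P (fst z)"
    and "AE z in (lborel :: 'b measure) \<Otimes>\<^sub>M lborel. P (snd z)"
proof -
  obtain N where N: "{x \<in> space lborel. \<not> P x} \<subseteq> N" "N \<in> sets lborel" "emeasure lborel N = 0"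
    using assms by (auto elim!: AE_E)
  have "N \<times> (UNIV :: 'b set) \<in> null_sets (lborel \<Otimes>\<^sub>M lborel)"
    using N by (auto intro!: null_setsI simp: lborel.emeasure_pair_measure_Times)
  then show "AE z in lborel \<Otimes>\<^sub>M (lborel :: 'b measure). P (fst z)"
    by (rule AE_I') (use N in auto)
  have "(UNIV :: 'b set) \<times> N \<in> null_sets (lborel \<Otimes>\<^sub>M lborel)"
    using N by (auto intro!: null_setsI simp: lborel.emeasure_pair_measure_Times)
  then show "AE z in (lborel :: 'b measure) \<Otimes>\<^sub>M lborel. P (snd z)"
    by (rule AE_I') (use N in auto)
qed

lemma gagliardo_cong_AE:
  fixes v w :: "'a::euclidean_space \<Rightarrow> real"
  assumes "AE x in lborel. v x = w x"
  shows "gagliardo s p v = gagliardo s p w"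
  unfolding gagliardo_density
proof (rule nn_integral_cong_AE)
  show "AE z in lborel \<Otimes>\<^sub>M lborel. ennreal (gag_density s p v z) = ennreal (gag_density s p w z)"
    using AE_lborel_pair[OF assms, where 'b='a] by eventually_elim (simp add: gag_density_def)
qed

text \<open>The test functions below are all Lipschitz functions of a pair of functions of finite
  seminorm. The factor 2 comes from replacing the sum of the two increments by twice the larger
  one.\<close>

lemma gagliardo_finite_Lipschitz:
  fixes u v \<phi> :: "'a::euclidean_space \<Rightarrow> real"
  assumes [measurable]: "u \<in> borel_measurable borel" "v \<in> borel_measurable borel"
    and fin: "gagliardo s p u < \<infinity>" "gagliardo s p v < \<infinity>" and "0 \<le> p" "0 \<le> C"
    and lip: "\<And>x y. \<bar>\<phi> x - \<phi> y\<bar> \<le> C * (\<bar>u x - u y\<bar> + \<bar>v x - v y\<bar>)"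
  shows "gagliardo s p \<phi> < \<infinity>"
proof -
  have "gagliardo s p \<phi> \<le> (\<integral>\<^sup>+ z. ennreal ((2 * C) powr p) *
      (ennreal (gag_density s p u z) + ennreal (gag_density s p v z)) \<partial>(lborel \<Otimes>\<^sub>M lborel))"
    unfolding gagliardo_density
  proof (rule nn_integral_mono)
    fix z :: "'a \<times> 'a"
    define a where "a = \<bar>u (fst z) - u (snd z)\<bar>"
    define b where "b = \<bar>v (fst z) - v (snd z)\<bar>"
    have ab: "0 \<le> a" "0 \<le> b" by (auto simp: a_def b_def)
    have "\<bar>\<phi> (fst z) - \<phi> (snd z)\<bar> \<le> C * (a + b)" using lip by (simp add: a_def b_def)
    also have "\<dots> \<le> C * (2 * max a b)" using ab \<open>0 \<le> C\<close> by (intro mult_left_mono) auto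
    finally have "\<bar>\<phi> (fst z) - \<phi> (snd z)\<bar> powr p \<le> (2 * C * max a b) powr p"
      using \<open>0 \<le> p\<close> by (intro powr_mono2) (auto simp: mult_ac)
    also have "\<dots> = (2 * C) powr p * (max a b) powr p"
      using ab \<open>0 \<le> C\<close> by (simp add: powr_mult)
    also have "\<dots> \<le> (2 * C) powr p * (a powr p + b powr p)"
      by (intro mult_left_mono) (auto simp: max_def)
    finally have "gag_density s p \<phi> z \<le> (2 * C) powr p * (gag_density s p u z + gag_density s p v z)"
      unfolding gag_density_def a_def[symmetric] b_def[symmetric]
      by (simp add: add_divide_distrib[symmetric] divide_right_mono)
    then show "ennreal (gag_density s p \<phi> z) \<le> ennreal ((2 * C) powr p) *
      (ennreal (gag_density s p u z) + ennreal (gag_density s p v z))"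
      by (simp add: ennreal_mult'[symmetric] ennreal_plus[symmetric] gag_density_nonneg del: ennreal_plus)
  qed
  also have "\<dots> = ennreal ((2 * C) powr p) * (gagliardo s p u + gagliardo s p v)"
    unfolding gagliardo_density by (subst nn_integral_cmult) (auto simp: nn_integral_add)
  also have "\<dots> < \<infinity>" using fin by (auto simp: ennreal_mult_less_top)
  finally show ?thesis .
qed

section \<open>The fractional form and the integrated inequalities\<close>

lemma frac_form_jp:
  fixes u \<phi> :: "'a::euclidean_space \<Rightarrow> real"
  shows "frac_form s p u \<phi> = (\<integral> z. jp p (u (fst z) - u (snd z)) * (\<phi> (fst z) - \<phi> (snd z)) /
    norm (fst z - snd z) powr (real DIM('a) + s * p) \<partial>(lborel \<Otimes>\<^sub>M lborel))"
  by (simp add: frac_form_def jp_def)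

lemma jp_measurable [measurable]: "jp p \<in> borel_measurable borel"
  unfolding jp_def by measurable

text \<open>The product of \<open>a powr (p - 1)\<close> and \<open>b\<close> is at most the
  \<open>p\<close>-th power of the larger factor, so the two Gagliardo densities dominate. Without
  integrability the Bochner integral would take the default value 0 and \<open>frac_form\<close>
  could not be split or compared.\<close>

lemma frac_form_integrable:
  fixes u \<phi> :: "'a::euclidean_space \<Rightarrow> real"
  assumes p: "1 < p" and [measurable]: "u \<in> borel_measurable borel" "\<phi> \<in> borel_measurable borel"
    and fin: "gagliardo s p u < \<infinity>" "gagliardo s p \<phi> < \<infinity>"
  shows "integrable (lborel \<Otimes>\<^sub>M lborel) (\<lambda>z. jp p (u (fst z) - u (snd z)) * (\<phi> (fst z) - \<phi> (snd z)) /
    norm (fst z - snd z) powr (real DIM('a) + s * p))"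
proof (rule Bochner_Integration.integrable_bound)
  show "integrable (lborel \<Otimes>\<^sub>M lborel) (\<lambda>z. gag_density s p u z + gag_density s p \<phi> z)"
    by (intro Bochner_Integration.integrable_add gag_density_integrable fin) measurable
next
  show "AE z in lborel \<Otimes>\<^sub>M lborel. norm (jp p (u (fst z) - u (snd z)) * (\<phi> (fst z) - \<phi> (snd z)) /
    norm (fst z - snd z) powr (real DIM('a) + s * p)) \<le> norm (gag_density s p u z + gag_density s p \<phi> z)"
  proof (rule AE_I2)
    fix z :: "'a \<times> 'a"
    define a where "a = \<bar>u (fst z) - u (snd z)\<bar>"
    define b where "b = \<bar>\<phi> (fst z) - \<phi> (snd z)\<bar>"
    have ab: "0 \<le> a" "0 \<le> b" by (auto simp: a_def b_def)
    have self: "c powr (p - 1) * c = c powr p" if "0 \<le> c" for c :: real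
      using powr_mult_base[of c "p - 1"] that by (simp add: mult.commute)
    have "a powr (p - 1) * b \<le> max a b powr (p - 1) * max a b"
      using ab p by (intro mult_mono powr_mono2) auto
    also have "\<dots> = max a b powr p" using ab self by (simp add: max_def)
    also have "\<dots> \<le> a powr p + b powr p" by (auto simp: max_def)
    finally show "norm (jp p (u (fst z) - u (snd z)) * (\<phi> (fst z) - \<phi> (snd z)) /
        norm (fst z - snd z) powr (real DIM('a) + s * p)) \<le> norm (gag_density s p u z + gag_density s p \<phi> z)"
      by (simp add: gag_density_def abs_mult abs_jp a_def b_def add_divide_distrib[symmetric] divide_right_mono)
  qed
qed measurable

lemma frac_form_cong_AE:
  fixes u v \<phi> \<psi> :: "'a::euclidean_space \<Rightarrow> real"
  assumes [measurable]: "u \<in> borel_measurable borel" "v \<in> borel_measurable borel"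
      "\<phi> \<in> borel_measurable borel" "\<psi> \<in> borel_measurable borel"
    and "AE x in lborel. u x = v x" "AE x in lborel. \<phi> x = \<psi> x"
  shows "frac_form s p u \<phi> = frac_form s p v \<psi>"
  unfolding frac_form_jp
proof (rule integral_cong_AE)
  show "AE z in lborel \<Otimes>\<^sub>M lborel. jp p (u (fst z) - u (snd z)) * (\<phi> (fst z) - \<phi> (snd z)) /
        norm (fst z - snd z) powr (real DIM('a) + s * p) =
      jp p (v (fst z) - v (snd z)) * (\<psi> (fst z) - \<psi> (snd z)) /
        norm (fst z - snd z) powr (real DIM('a) + s * p)"
    using AE_lborel_pair[OF assms(5), where 'b='a] AE_lborel_pair[OF assms(6), where 'b='a]
    by eventually_elim simp
qed measurable

lemma gagliardo_min_finite:
  fixes u v :: "'a::euclidean_space \<Rightarrow> real"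
  assumes "u \<in> borel_measurable borel" "v \<in> borel_measurable borel"
    and "gagliardo s p u < \<infinity>" "gagliardo s p v < \<infinity>" "0 \<le> p"
  shows "gagliardo s p (\<lambda>x. min (v x) (u x)) < \<infinity>" "gagliardo s p (\<lambda>x. max (v x) (u x)) < \<infinity>"
    "gagliardo s p (\<lambda>x. max 0 (v x - u x)) < \<infinity>"
  by (rule gagliardo_finite_Lipschitz[OF assms, of 1]; auto simp: min_def max_def)+

text \<open>Combined with minimality of \<open>v\<close> against the pointwise minimum of
  \<open>v\<close> and \<open>u\<close>, this bounds the form by potential terms alone, which
  replaces an Euler-Lagrange inequality for \<open>v\<close>.\<close>

lemma frac_form_max_diff_le:
  fixes u v :: "'a::euclidean_space \<Rightarrow> real"
  assumes p: "1 < p" and [measurable]: "u \<in> borel_measurable borel" "v \<in> borel_measurable borel"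
    and fin: "gagliardo s p u < \<infinity>" "gagliardo s p v < \<infinity>"
  shows "p * frac_form s p u (\<lambda>x. max 0 (v x - u x)) + enn2real (gagliardo s p (\<lambda>x. min (v x) (u x)))
           \<le> enn2real (gagliardo s p v)"
proof -
  let ?N = "\<lambda>z::'a\<times>'a. norm (fst z - snd z) powr (real DIM('a) + s * p)"
  let ?\<phi> = "\<lambda>x. max 0 (v x - u x)" and ?m = "\<lambda>x. min (v x) (u x)"
  let ?f = "\<lambda>z. jp p (u (fst z) - u (snd z)) * (?\<phi> (fst z) - ?\<phi> (snd z)) / ?N z"
  have fin': "gagliardo s p ?m < \<infinity>" "gagliardo s p ?\<phi> < \<infinity>"
    using gagliardo_min_finite[of u v s p] fin p by auto
  have 1: "integrable (lborel \<Otimes>\<^sub>M lborel) ?f"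
    by (intro frac_form_integrable p fin fin') measurable
  have 2: "integrable (lborel \<Otimes>\<^sub>M lborel) (gag_density s p ?m)"
    by (intro gag_density_integrable fin') measurable
  have 3: "integrable (lborel \<Otimes>\<^sub>M lborel) (gag_density s p v)"
    by (intro gag_density_integrable fin) measurable
  have "p * frac_form s p u ?\<phi> + enn2real (gagliardo s p ?m)
      = (\<integral> z. p * ?f z + gag_density s p ?m z \<partial>(lborel \<Otimes>\<^sub>M lborel))"
    by (subst Bochner_Integration.integral_add[OF integrable_mult_right[OF 1] 2])
      (simp add: frac_form_jp enn2real_gagliardo del: times_divide_eq_right)
  also have "\<dots> \<le> (\<integral> z. gag_density s p v z \<partial>(lborel \<Otimes>\<^sub>M lborel))"
  proof (rule integral_mono)
    show "p * ?f z + gag_density s p ?m z \<le> gag_density s p v z" for z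
    proof -
      have "p * (jp p (u (fst z) - u (snd z)) * (?\<phi> (fst z) - ?\<phi> (snd z)))
          + \<bar>?m (fst z) - ?m (snd z)\<bar> powr p \<le> \<bar>v (fst z) - v (snd z)\<bar> powr p"
        by (rule abs_powr_min_gradient[OF p])
      from divide_right_mono[OF this, of "?N z"] show ?thesis
        by (simp add: gag_density_def add_divide_distrib)
    qed
    show "integrable (lborel \<Otimes>\<^sub>M lborel) (\<lambda>z. p * ?f z + gag_density s p ?m z)"
      by (intro Bochner_Integration.integrable_add integrable_mult_right 1 2)
  qed (fact 3)
  also have "\<dots> = enn2real (gagliardo s p v)" by (simp add: enn2real_gagliardo)
  finally show ?thesis .
qed

lemma frac_form_picone:
  fixes u v :: "'a::euclidean_space \<Rightarrow> real"
  assumes p: "1 < p" and [measurable]: "v \<in> borel_measurable borel"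
    and fin: "gagliardo s p v < \<infinity>"
    and pos: "\<And>x. 0 \<le> u x" "\<And>x. 0 \<le> v x"
    and h: "\<And>a. 0 \<le> a \<Longrightarrow> 0 < h a" "\<And>a b. 0 \<le> a \<Longrightarrow> a \<le> b \<Longrightarrow> b - a \<le> h b - h a"
  shows "frac_form s p u (\<lambda>x. v x powr p * h (u x) powr (1 - p)) \<le> enn2real (gagliardo s p v)"
proof -
  have "frac_form s p u (\<lambda>x. v x powr p * h (u x) powr (1 - p)) \<le>
      (\<integral> z. gag_density s p v z \<partial>(lborel \<Otimes>\<^sub>M lborel))"
    unfolding frac_form_jp
  \<comment> \<open>Only the majorant has to be integrable and nonnegative: a non-integrable
    integrand on the left has integral 0.\<close>
  proof (rule integral_mono')
    show "integrable (lborel \<Otimes>\<^sub>M lborel) (gag_density s p v)"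
      by (intro gag_density_integrable fin) measurable
    fix z :: "'a \<times> 'a"
    show "jp p (u (fst z) - u (snd z)) * (v (fst z) powr p * h (u (fst z)) powr (1 - p)
        - v (snd z) powr p * h (u (snd z)) powr (1 - p)) / norm (fst z - snd z) powr (real DIM('a) + s * p)
        \<le> gag_density s p v z"
      unfolding gag_density_def by (intro divide_right_mono picone_pointwise p pos h) auto
  qed (rule gag_density_nonneg)
  then show ?thesis by (simp add: enn2real_gagliardo)
qed

lemma gagliardo_submodular:
  fixes u v :: "'a::euclidean_space \<Rightarrow> real"
  assumes p: "1 < p" and [measurable]: "u \<in> borel_measurable borel" "v \<in> borel_measurable borel"
    and fin: "gagliardo s p u < \<infinity>" "gagliardo s p v < \<infinity>"
  shows "enn2real (gagliardo s p (\<lambda>x. min (v x) (u x))) + enn2real (gagliardo s p (\<lambda>x. max (v x) (u x)))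
           \<le> enn2real (gagliardo s p v) + enn2real (gagliardo s p u)"
proof -
  let ?m = "\<lambda>x. min (v x) (u x)" and ?M = "\<lambda>x. max (v x) (u x)"
  have fin': "gagliardo s p ?m < \<infinity>" "gagliardo s p ?M < \<infinity>"
    using gagliardo_min_finite[of u v s p] fin p by auto
  have int: "integrable (lborel \<Otimes>\<^sub>M lborel) (gag_density s p ?m)"
    "integrable (lborel \<Otimes>\<^sub>M lborel) (gag_density s p ?M)"
    "integrable (lborel \<Otimes>\<^sub>M lborel) (gag_density s p v)"
    "integrable (lborel \<Otimes>\<^sub>M lborel) (gag_density s p u)"
    by (intro gag_density_integrable fin fin'; measurable)+
  have "(\<integral> z. gag_density s p ?m z + gag_density s p ?M z \<partial>(lborel \<Otimes>\<^sub>M lborel))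
      \<le> (\<integral> z. gag_density s p v z + gag_density s p u z \<partial>(lborel \<Otimes>\<^sub>M lborel))"
  proof (rule integral_mono)
    show "gag_density s p ?m z + gag_density s p ?M z \<le> gag_density s p v z + gag_density s p u z" for z
      unfolding gag_density_def add_divide_distrib[symmetric]
      by (intro divide_right_mono abs_powr_submodular[OF p]) simp
  qed (use int in auto)
  then show ?thesis using int by (simp add: enn2real_gagliardo)
qed

section \<open>Minimisers of the obstacle problem\<close>

definition gag_energy :: "real \<Rightarrow> real \<Rightarrow> (real \<Rightarrow> real) \<Rightarrow> ('a::euclidean_space \<Rightarrow> real) \<Rightarrow> real" where
  "gag_energy s p F v = enn2real (gagliardo s p v) / p - (\<integral> x. F (v x) \<partial>lborel)"

text \<open>The bounds hold at every point rather than almost everywhere, so that pointwise minima,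
  maxima and limits create no exceptional sets.\<close>

definition gag_admissible :: "real \<Rightarrow> real \<Rightarrow> ('a::euclidean_space \<Rightarrow> real) \<Rightarrow> ('a \<Rightarrow> real) set" where
  "gag_admissible s p v0 = {v \<in> borel_measurable borel. (\<forall>x. 0 \<le> v x \<and> v x \<le> v0 x) \<and> gagliardo s p v < \<infinity>}"

lemma gag_density_tendsto:
  assumes "0 < p" "\<And>x. (\<lambda>j. z j x) \<longlonglongrightarrow> v x"
  shows "(\<lambda>j. gag_density s p (z j) y) \<longlonglongrightarrow> gag_density s p v y"
proof -
  have "(\<lambda>j. \<bar>z j (fst y) - z j (snd y)\<bar> powr p) \<longlonglongrightarrow> \<bar>v (fst y) - v (snd y)\<bar> powr p"
    using assms by (intro tendsto_powr2 tendsto_intros) auto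
  \<comment> \<open>On the diagonal the denominator is 0 and both sides are 0 by the convention for
    division.\<close>
  then show ?thesis unfolding gag_density_def by (cases "fst y = snd y") (auto intro!: tendsto_divide)
qed

text \<open>Monotonicity and nonnegativity make \<open>F (v0 x)\<close> one integrable majorant for
  the whole admissible set: it bounds the energy from below and gives dominated convergence.\<close>

locale obstacle =
  fixes s p :: real and F :: "real \<Rightarrow> real" and v0 :: "'a::euclidean_space \<Rightarrow> real"
  assumes p: "1 < p" and v0 [measurable]: "v0 \<in> borel_measurable borel"
    and v0_nonneg: "\<And>x. 0 \<le> v0 x" and v0_gag: "gagliardo s p v0 < \<infinity>"
    and F_mono: "mono F" and F_nonneg: "\<And>y. 0 \<le> F y" and F_cont: "continuous_on UNIV F"
    and F_v0: "integrable lborel (\<lambda>x. F (v0 x))"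
begin

abbreviation K where "K \<equiv> gag_admissible s p v0"
abbreviation E where "E \<equiv> gag_energy s p F"

lemma F_measurable [measurable]: "F \<in> borel_measurable borel"
  using F_cont by (rule borel_measurable_continuous_onI)

lemma F_integrable:
  assumes [measurable]: "v \<in> borel_measurable borel" and "\<And>x. v x \<le> v0 x"
  shows "integrable lborel (\<lambda>x. F (v x))"
  by (rule Bochner_Integration.integrable_bound[OF F_v0])
    (use assms F_nonneg monoD[OF F_mono] in auto)

lemma F_integral_le:
  assumes [measurable]: "v \<in> borel_measurable borel" and "\<And>x. v x \<le> v0 x"
  shows "(\<integral> x. F (v x) \<partial>lborel) \<le> (\<integral> x. F (v0 x) \<partial>lborel)"
  using F_integrable[OF assms] F_v0 assms monoD[OF F_mono] by (intro integral_mono) auto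

lemma E_bdd_below: "bdd_below (E ` K)"
proof (rule bdd_belowI2)
  fix v assume "v \<in> K"
  then have "(\<integral> x. F (v x) \<partial>lborel) \<le> (\<integral> x. F (v0 x) \<partial>lborel)"
    by (intro F_integral_le) (auto simp: gag_admissible_def)
  moreover have "0 \<le> enn2real (gagliardo s p v) / p" using p by simp
  ultimately show "- (\<integral> x. F (v0 x) \<partial>lborel) \<le> E v" unfolding gag_energy_def by linarith
qed

lemma v0_admissible: "v0 \<in> K"
  using v0_gag by (simp add: gag_admissible_def v0_nonneg)

text \<open>Dominated convergence treats the potential and Fatou's lemma the seminorm. Carrying
  convergent bounds \<open>c j\<close> lets the lemma serve both for limits at a fixed energy level
  and for limits along improving levels.\<close>

lemma energy_lsc:
  assumes z: "\<And>j. z j \<in> K" and lim: "\<And>x. (\<lambda>j. z j x) \<longlonglongrightarrow> v x"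
    and le: "\<And>j. E (z j) \<le> c j" and c: "c \<longlonglongrightarrow> C"
  shows "v \<in> K" "E v \<le> C"
proof -
  have z_meas [measurable]: "z j \<in> borel_measurable borel" for j
    using z[of j] by (simp add: gag_admissible_def)
  have z_bd: "0 \<le> z j x" "z j x \<le> v0 x" for j x
    using z[of j] by (auto simp: gag_admissible_def)
  have v_meas [measurable]: "v \<in> borel_measurable borel"
    by (rule borel_measurable_LIMSEQ_metric[OF z_meas lim])
  have v_bd: "0 \<le> v x \<and> v x \<le> v0 x" for x
    using LIMSEQ_le_const[OF lim[of x]] LIMSEQ_le_const2[OF lim[of x]] z_bd by blast
  define I where "I j = (\<integral> x. F (z j x) \<partial>lborel)" for j
  have I: "I \<longlonglongrightarrow> (\<integral> x. F (v x) \<partial>lborel)"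
    unfolding I_def
  proof (rule integral_dominated_convergence[where w="\<lambda>x. F (v0 x)"])
    show "AE x in lborel. (\<lambda>j. F (z j x)) \<longlonglongrightarrow> F (v x)"
      using F_cont lim by (auto intro!: continuous_on_tendsto_compose[of UNIV F])
    show "AE x in lborel. norm (F (z j x)) \<le> F (v0 x)" for j
      using z_bd F_nonneg monoD[OF F_mono] by auto
  qed (use F_v0 in measurable)
  have gz: "gagliardo s p (z j) \<le> ennreal (p * (c j + I j))" for j
  proof -
    have "gagliardo s p (z j) < top" using z[of j] by (simp add: gag_admissible_def)
    then have "gagliardo s p (z j) = ennreal (enn2real (gagliardo s p (z j)))" by simp
    also have "\<dots> \<le> ennreal (p * (c j + I j))"
      using le[of j] p by (intro ennreal_leI) (simp add: gag_energy_def I_def field_simps)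
    finally show ?thesis .
  qed
  have "gagliardo s p v = (\<integral>\<^sup>+ y. liminf (\<lambda>j. ennreal (gag_density s p (z j) y)) \<partial>(lborel \<Otimes>\<^sub>M lborel))"
    unfolding gagliardo_density
    by (rule nn_integral_cong, rule lim_imp_Liminf[symmetric])
      (use p in \<open>auto intro!: tendsto_ennrealI gag_density_tendsto lim\<close>)
  also have "\<dots> \<le> liminf (\<lambda>j. gagliardo s p (z j))"
    unfolding gagliardo_density by (rule nn_integral_liminf) measurable
  also have "\<dots> \<le> liminf (\<lambda>j. ennreal (p * (c j + I j)))"
    using gz by (intro Liminf_mono) auto
  also have "\<dots> = ennreal (p * (C + (\<integral> x. F (v x) \<partial>lborel)))"
    by (intro lim_imp_Liminf tendsto_ennrealI tendsto_intros c I) auto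
  finally have gv: "gagliardo s p v \<le> ennreal (p * (C + (\<integral> x. F (v x) \<partial>lborel)))" .
  show "v \<in> K"
    using gv v_bd by (auto simp: gag_admissible_def intro: le_less_trans)
  \<comment> \<open>\<open>ennreal\<close> sends negative reals to 0, so the limit must be known to
    be nonnegative before the bound can be read back in the reals.\<close>
  have nn: "0 \<le> p * (c j + I j)" for j
  proof -
    have "0 \<le> enn2real (gagliardo s p (z j)) / p" using p by simp
    then have "0 \<le> c j + I j" using le[of j] unfolding gag_energy_def I_def by linarith
    then show ?thesis using p by simp
  qed
  have "0 \<le> p * (C + (\<integral> x. F (v x) \<partial>lborel))"
    by (rule LIMSEQ_le_const[where X="\<lambda>j. p * (c j + I j)"]) (auto intro!: tendsto_intros c I nn)
  then have "enn2real (gagliardo s p v) \<le> p * (C + (\<integral> x. F (v x) \<partial>lborel))"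
    using enn2real_mono[OF gv] by simp
  then show "E v \<le> C" using p by (simp add: gag_energy_def field_simps)
qed

text \<open>The potential is modular, because minimum and maximum only permute the two values at
  each point; hence the submodularity of the seminorm passes to the energy.\<close>

lemma energy_submodular:
  assumes u: "u \<in> K" and v: "v \<in> K"
  shows "(\<lambda>x. min (v x) (u x)) \<in> K" "(\<lambda>x. max (v x) (u x)) \<in> K"
    "E (\<lambda>x. min (v x) (u x)) + E (\<lambda>x. max (v x) (u x)) \<le> E v + E u"
proof -
  have [measurable]: "u \<in> borel_measurable borel" "v \<in> borel_measurable borel"
    and fin: "gagliardo s p u < \<infinity>" "gagliardo s p v < \<infinity>"
    and bd: "0 \<le> u x" "u x \<le> v0 x" "0 \<le> v x" "v x \<le> v0 x" for x
    using u v by (auto simp: gag_admissible_def)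
  have fin': "gagliardo s p (\<lambda>x. min (v x) (u x)) < \<infinity>" "gagliardo s p (\<lambda>x. max (v x) (u x)) < \<infinity>"
    using gagliardo_min_finite[of u v s p] fin p by auto
  show "(\<lambda>x. min (v x) (u x)) \<in> K" "(\<lambda>x. max (v x) (u x)) \<in> K"
    using fin' bd by (auto simp: gag_admissible_def min_le_iff_disj le_max_iff_disj)
  have int: "integrable lborel (\<lambda>x. F (u x))" "integrable lborel (\<lambda>x. F (v x))"
    "integrable lborel (\<lambda>x. F (min (v x) (u x)))" "integrable lborel (\<lambda>x. F (max (v x) (u x)))"
    using bd by (auto intro!: F_integrable simp: min_le_iff_disj)
  have "(\<integral> x. F (min (v x) (u x)) \<partial>lborel) + (\<integral> x. F (max (v x) (u x)) \<partial>lborel)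
      = (\<integral> x. F (min (v x) (u x)) + F (max (v x) (u x)) \<partial>lborel)"
    using int by simp
  also have "\<dots> = (\<integral> x. F (v x) + F (u x) \<partial>lborel)"
    by (rule Bochner_Integration.integral_cong) (auto simp: min_def max_def)
  also have "\<dots> = (\<integral> x. F (v x) \<partial>lborel) + (\<integral> x. F (u x) \<partial>lborel)"
    using int by simp
  finally have "(\<integral> x. F (min (v x) (u x)) \<partial>lborel) + (\<integral> x. F (max (v x) (u x)) \<partial>lborel)
      = (\<integral> x. F (v x) \<partial>lborel) + (\<integral> x. F (u x) \<partial>lborel)" .
  moreover have "enn2real (gagliardo s p (\<lambda>x. min (v x) (u x))) / p + enn2real (gagliardo s p (\<lambda>x. max (v x) (u x))) / p
           \<le> enn2real (gagliardo s p v) / p + enn2real (gagliardo s p u) / p"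
    using gagliardo_submodular[of p u v s] p fin
    by (simp add: add_divide_distrib[symmetric] divide_right_mono)
  ultimately show "E (\<lambda>x. min (v x) (u x)) + E (\<lambda>x. max (v x) (u x)) \<le> E v + E u"
    unfolding gag_energy_def by linarith
qed

text \<open>The energy is not convex, but by submodularity the infimum of the tail of a minimising
  sequence with summable errors is again nearly minimising; these infima increase, so
  monotone limits replace weak compactness.\<close>
lemma energy_minimizer:
  obtains v where "v \<in> K" "\<And>z. z \<in> K \<Longrightarrow> E v \<le> E z"
proof -
  define m where "m = Inf (E ` K)"
  have m: "m \<le> E z" if "z \<in> K" for z
    unfolding m_def using that E_bdd_below by (simp add: cINF_lower)
  have "\<exists>z\<in>K. E z < m + (1/2)^n" for n :: nat
  proof -
    have "Inf (E ` K) < m + (1/2)^n" by (simp add: m_def)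
    then show ?thesis using v0_admissible E_bdd_below by (subst (asm) cINF_less_iff) auto
  qed
  then obtain a where a: "\<And>n. a n \<in> K" "\<And>n. E (a n) < m + (1/2)^n" by metis
  \<comment> \<open>\<open>w n j\<close> is the minimum of \<open>a n\<close>, ...,
    \<open>a (n + j)\<close>.\<close>
  define w where "w n j = rec_nat (a n) (\<lambda>j z x. min (z x) (a (n + Suc j) x)) j" for n j
  have w_0: "w n 0 = a n" and w_Suc: "w n (Suc j) = (\<lambda>x. min (w n j x) (a (n + Suc j) x))" for n j
    by (simp_all add: w_def)
  \<comment> \<open>The maximum formed in each step has energy at least \<open>m\<close>, so by
    submodularity the minimum gains at most the excess \<open>(1/2)^(n + j + 1)\<close> of the new
    function. The stated bound is the resulting geometric sum.\<close>
  have w: "w n j \<in> K \<and> E (w n j) \<le> m + 2 * (1/2)^n - (1/2)^(n + j)" for n j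
  proof (induction j)
    case 0 then show ?case using a[of n] by (simp add: w_0)
  next
    case (Suc j)
    then have wK: "w n j \<in> K" by simp
    note sub = energy_submodular[OF a(1)[of "n + Suc j"] wK]
    have "w n (Suc j) \<in> K" "E (w n (Suc j)) \<le> E (w n j) + E (a (n + Suc j)) - m"
      using sub(1,3) m[OF sub(2)] unfolding w_Suc by auto
    then show ?case using Suc a(2)[of "n + Suc j"] by auto
  qed
  have w_nonneg: "0 \<le> w n j x" and w_le: "w n j x \<le> v0 x" for n j x
    using w[of n j] by (auto simp: gag_admissible_def)
  have w_dec: "decseq (\<lambda>j. w n j x)" for n x
    by (rule decseq_SucI) (simp add: w_Suc)
  define b where "b n x = lim (\<lambda>j. w n j x)" for n x
  have b: "(\<lambda>j. w n j x) \<longlonglongrightarrow> b n x" for n x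
    using decseq_convergent[OF w_dec[of n x], of 0] w_nonneg unfolding b_def by (metis limI)
  have bK: "b n \<in> K" "E (b n) \<le> m + 2 * (1/2)^n" for n
  proof -
    have "E (w n j) \<le> m + 2 * (1/2)^n" for j
      using w[of n j] zero_le_power[of "1/2 :: real" "n + j"] by linarith
    from energy_lsc[OF _ b this tendsto_const] w show "b n \<in> K" "E (b n) \<le> m + 2 * (1/2)^n" by auto
  qed
  \<comment> \<open>The right-hand side is a minimum over the same functions without
    \<open>a n\<close>, hence larger; in the limit the tail infima increase with
    \<open>n\<close>.\<close>
  have w_shift: "w n (Suc j) x \<le> w (Suc n) j x" for n j x
  proof (induction j)
    case (Suc j)
    then show ?case by (subst (2) w_Suc, subst w_Suc) (auto simp: min_le_iff_disj)
  qed (simp add: w_0 w_Suc)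
  have b_inc: "incseq (\<lambda>n. b n x)" for x
    by (rule incseq_SucI, rule LIMSEQ_le[OF LIMSEQ_Suc[OF b] b]) (use w_shift in auto)
  have "convergent (\<lambda>n. b n x)" for x
    using incseq_convergent[OF b_inc[of x], of "v0 x"] bK(1)
    by (simp add: gag_admissible_def convergent_def) blast
  then have v: "(\<lambda>n. b n x) \<longlonglongrightarrow> lim (\<lambda>n. b n x)" for x by (simp add: convergent_LIMSEQ_iff)
  have "(\<lambda>n. m + 2 * (1/2)^n) \<longlonglongrightarrow> m + 2 * 0"
    by (intro tendsto_intros LIMSEQ_power_zero) simp
  from energy_lsc[OF bK(1) v bK(2) this] show ?thesis using that m by fastforce
qed

end

section \<open>A chain rule in time\<close>

text \<open>This replaces absolute continuity in the chain rule for time integrals of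
  square-integrable functions: there \<open>W\<close> is the time integral of the squared derivative.\<close>
lemma constant_if_increments_small:
  fixes G W :: "real \<Rightarrow> real"
  assumes T: "0 \<le> T" and C: "0 \<le> C"
    and inc: "\<And>s t. 0 \<le> s \<Longrightarrow> s \<le> t \<Longrightarrow> t \<le> T \<Longrightarrow> \<bar>G t - G s\<bar> \<le> C * (t - s) * (W t - W s)"
  shows "G T = G 0"
proof -
  have bound: "\<bar>G T - G 0\<bar> \<le> (C * T * (W T - W 0)) / real (Suc n)" for n
  proof -
    \<comment> \<open>On a uniform partition the step length factors out and the increments of
      \<open>W\<close> telescope, which leaves a factor \<open>1 / Suc n\<close>.\<close>
    define \<tau> where "\<tau> i = T * real i / real (Suc n)" for i
    have \<tau>: "0 \<le> \<tau> i" "\<tau> i \<le> \<tau> (Suc i)" for i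
      using T by (auto simp: \<tau>_def divide_right_mono mult_left_mono)
    have \<tau>_le: "\<tau> i \<le> T" if "i \<le> Suc n" for i
    proof -
      have "T * real i \<le> T * real (Suc n)" using that T by (intro mult_left_mono) auto
      then show ?thesis by (simp add: \<tau>_def pos_divide_le_eq del: of_nat_Suc)
    qed
    have step: "\<tau> (Suc i) - \<tau> i = T / real (Suc n)" for i
      by (simp add: \<tau>_def diff_divide_distrib[symmetric] algebra_simps)
    have ends: "\<tau> 0 = 0" "\<tau> (Suc n) = T" by (auto simp: \<tau>_def)
    have "\<bar>G T - G 0\<bar> = \<bar>\<Sum>i<Suc n. G (\<tau> (Suc i)) - G (\<tau> i)\<bar>"
      by (subst sum_lessThan_telescope) (simp only: ends)
    also have "\<dots> \<le> (\<Sum>i<Suc n. \<bar>G (\<tau> (Suc i)) - G (\<tau> i)\<bar>)" by (rule sum_abs)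
    also have "\<dots> \<le> (\<Sum>i<Suc n. C * (T / real (Suc n)) * (W (\<tau> (Suc i)) - W (\<tau> i)))"
    proof (rule sum_mono)
      fix i assume "i \<in> {..<Suc n}"
      then have "\<tau> (Suc i) \<le> T" by (intro \<tau>_le) auto
      from inc[OF \<tau> this] show "\<bar>G (\<tau> (Suc i)) - G (\<tau> i)\<bar>
          \<le> C * (T / real (Suc n)) * (W (\<tau> (Suc i)) - W (\<tau> i))"
        unfolding step .
    qed
    also have "\<dots> = C * (T / real (Suc n)) * (W T - W 0)"
      unfolding sum_distrib_left[symmetric] by (subst sum_lessThan_telescope) (simp only: ends)
    finally show ?thesis by simp
  qed
  have "(\<lambda>n. (C * T * (W T - W 0)) / real (Suc n)) \<longlonglongrightarrow> 0"
    by (rule LIMSEQ_Suc[OF lim_const_over_n])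
  then have "\<bar>G T - G 0\<bar> \<le> 0"
    using bound by (intro LIMSEQ_le_const) auto
  then show ?thesis by simp
qed

lemma square_integral_le:
  fixes w :: "real \<Rightarrow> real"
  assumes "s \<le> t" and [measurable]: "w \<in> borel_measurable borel"
    and w2: "integrable lborel (\<lambda>\<tau>. indicator {s<..t} \<tau> * (w \<tau>)\<^sup>2)"
  shows "integrable lborel (\<lambda>\<tau>. indicator {s<..t} \<tau> * w \<tau>)"
    and "(\<integral> \<tau>. indicator {s<..t} \<tau> * \<bar>w \<tau>\<bar> \<partial>lborel)\<^sup>2 \<le> (t - s) * (\<integral> \<tau>. indicator {s<..t} \<tau> * (w \<tau>)\<^sup>2 \<partial>lborel)"
proof -
  let ?i = "indicator {s<..t} :: real \<Rightarrow> real"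
  have one: "integrable lborel ?i"
    using \<open>s \<le> t\<close> by (intro integrable_real_indicator) auto
  show w1: "integrable lborel (\<lambda>\<tau>. ?i \<tau> * w \<tau>)"
  proof (rule Bochner_Integration.integrable_bound)
    show "integrable lborel (\<lambda>\<tau>. ?i \<tau> + ?i \<tau> * (w \<tau>)\<^sup>2)" using one w2 by auto
    have "\<bar>x\<bar> \<le> 1 + x\<^sup>2" for x :: real
      using sum_squares_bound[of 1 "\<bar>x\<bar>"] by (simp add: power2_eq_square abs_if split: if_splits)
    then show "AE \<tau> in lborel. norm (?i \<tau> * w \<tau>) \<le> norm (?i \<tau> + ?i \<tau> * (w \<tau>)\<^sup>2)"
      by (auto simp: indicator_def)
  qed measurable
  then have w1a: "integrable lborel (\<lambda>\<tau>. ?i \<tau> * \<bar>w \<tau>\<bar>)"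
    using integrable_abs[OF w1] by (simp add: abs_mult)
  define I where "I = (\<integral> \<tau>. ?i \<tau> * \<bar>w \<tau>\<bar> \<partial>lborel)"
  show "I\<^sup>2 \<le> (t - s) * (\<integral> \<tau>. ?i \<tau> * (w \<tau>)\<^sup>2 \<partial>lborel)"
  proof (cases "s = t")
    case True then show ?thesis by (simp add: I_def)
  next
    case False
    with \<open>s \<le> t\<close> have st: "s < t" by simp
    \<comment> \<open>With \<open>c\<close> the mean of \<open>\<bar>w \<tau>\<bar>\<close>,
      nonnegativity of the integrated square of \<open>\<bar>w \<tau>\<bar> - c\<close> is the
      Cauchy-Schwarz inequality.\<close>
    define c where "c = I / (t - s)"
    have "0 \<le> (\<integral> \<tau>. ?i \<tau> * (\<bar>w \<tau>\<bar> - c)\<^sup>2 \<partial>lborel)" by (rule Bochner_Integration.integral_nonneg) auto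
    also have "\<dots> = (\<integral> \<tau>. ?i \<tau> * (w \<tau>)\<^sup>2 - 2 * c * (?i \<tau> * \<bar>w \<tau>\<bar>) + c\<^sup>2 * ?i \<tau> \<partial>lborel)"
      by (rule Bochner_Integration.integral_cong) (auto simp: power2_eq_square algebra_simps)
    also have "\<dots> = (\<integral> \<tau>. ?i \<tau> * (w \<tau>)\<^sup>2 \<partial>lborel) - 2 * c * I + c\<^sup>2 * (t - s)"
      using w2 w1a st by (simp add: I_def)
    also have "c\<^sup>2 * (t - s) = c * I"
      using st by (simp add: c_def power2_eq_square)
    finally have "c * I \<le> (\<integral> \<tau>. ?i \<tau> * (w \<tau>)\<^sup>2 \<partial>lborel)" by (simp add: mult.commute)
    then have "(t - s) * (c * I) \<le> (t - s) * (\<integral> \<tau>. ?i \<tau> * (w \<tau>)\<^sup>2 \<partial>lborel)"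
      using st by (intro mult_left_mono) auto
    moreover have "(t - s) * (c * I) = I\<^sup>2" using st by (simp add: c_def power2_eq_square)
    ultimately show ?thesis by simp
  qed
qed

text \<open>The derivative \<open>H'\<close> is frozen at the left endpoint. Both the Taylor error
  and the freezing error are at most \<open>C\<close> times the square of the integral of
  \<open>\<bar>w\<bar>\<close>, whence the factor 2; Cauchy-Schwarz then yields the product form
  required by \<open>constant_if_increments_small\<close>. The estimates on \<open>H\<close> and
  \<open>H'\<close> are asked only on the range \<open>S\<close> of the path.\<close>

lemma chain_rule_increment:
  fixes w y H H' :: "real \<Rightarrow> real" and S :: "real set"
  assumes st: "s \<le> t" and [measurable]: "w \<in> borel_measurable borel" "y \<in> borel_measurable borel"
      "H' \<in> borel_measurable borel"
    and w2: "integrable lborel (\<lambda>\<tau>. indicator {s<..t} \<tau> * (w \<tau>)\<^sup>2)"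
    and y: "AE \<tau> in lborel. \<tau> \<in> {s<..t} \<longrightarrow> y \<tau> \<in> S \<and> y \<tau> = ys + (\<integral> \<sigma>. indicator {s<..\<tau>} \<sigma> * w \<sigma> \<partial>lborel)"
    and yt: "yt = ys + (\<integral> \<sigma>. indicator {s<..t} \<sigma> * w \<sigma> \<partial>lborel)" and S: "ys \<in> S" "yt \<in> S" and C: "0 \<le> C"
    and H: "\<And>a b. a \<in> S \<Longrightarrow> b \<in> S \<Longrightarrow> \<bar>H b - H a - H' a * (b - a)\<bar> \<le> C * (b - a)\<^sup>2"
    and H': "\<And>a b. a \<in> S \<Longrightarrow> b \<in> S \<Longrightarrow> \<bar>H' b - H' a\<bar> \<le> C * \<bar>b - a\<bar>"
  shows "\<bar>H yt - H ys - (\<integral> \<tau>. indicator {s<..t} \<tau> * (H' (y \<tau>) * w \<tau>) \<partial>lborel)\<bar>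
    \<le> 2 * C * ((t - s) * (\<integral> \<tau>. indicator {s<..t} \<tau> * (w \<tau>)\<^sup>2 \<partial>lborel))"
proof -
  let ?i = "indicator {s<..t} :: real \<Rightarrow> real"
  note w1 = square_integral_le(1)[OF st _ w2, simplified]
  have w1a: "integrable lborel (\<lambda>\<tau>. ?i \<tau> * \<bar>w \<tau>\<bar>)"
    using integrable_abs[OF w1] by (simp add: abs_mult)
  define I where "I = (\<integral> \<tau>. ?i \<tau> * \<bar>w \<tau>\<bar> \<partial>lborel)"
  have I0: "0 \<le> I" unfolding I_def by (rule Bochner_Integration.integral_nonneg) auto
  have I2: "I\<^sup>2 \<le> (t - s) * (\<integral> \<tau>. ?i \<tau> * (w \<tau>)\<^sup>2 \<partial>lborel)"
    unfolding I_def by (rule square_integral_le(2)[OF st _ w2]) measurable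
  have part: "\<bar>\<integral> \<sigma>. indicator {s<..\<tau>} \<sigma> * w \<sigma> \<partial>lborel\<bar> \<le> I" if "\<tau> \<le> t" for \<tau>
  proof -
    have "\<bar>\<integral> \<sigma>. indicator {s<..\<tau>} \<sigma> * w \<sigma> \<partial>lborel\<bar> \<le> (\<integral> \<sigma>. \<bar>indicator {s<..\<tau>} \<sigma> * w \<sigma>\<bar> \<partial>lborel)"
      by (rule integral_abs_bound)
    also have "\<dots> \<le> I"
      unfolding I_def by (rule integral_mono'[OF w1a]) (use that in \<open>auto simp: indicator_def\<close>)
    finally show ?thesis .
  qed
  have d: "\<bar>H' (y \<tau>) - H' ys\<bar> \<le> C * I" if "y \<tau> \<in> S" "\<tau> \<le> t"
    "y \<tau> = ys + (\<integral> \<sigma>. indicator {s<..\<tau>} \<sigma> * w \<sigma> \<partial>lborel)" for \<tau>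
  proof -
    have "\<bar>H' (y \<tau>) - H' ys\<bar> \<le> C * \<bar>y \<tau> - ys\<bar>" by (rule H'[OF S(1) that(1)])
    also have "\<dots> \<le> C * I" using part[OF that(2)] that(3) C by (intro mult_left_mono) auto
    finally show ?thesis .
  qed
  have AEd: "AE \<tau> in lborel. norm (?i \<tau> * ((H' (y \<tau>) - H' ys) * w \<tau>)) \<le> C * I * (?i \<tau> * \<bar>w \<tau>\<bar>)"
    using y
  proof eventually_elim
    case (elim \<tau>)
    show ?case
    proof (cases "\<tau> \<in> {s<..t}")
      case True
      then have "\<bar>H' (y \<tau>) - H' ys\<bar> * \<bar>w \<tau>\<bar> \<le> C * I * \<bar>w \<tau>\<bar>"
        using d elim by (intro mult_right_mono) auto
      then show ?thesis using True by (simp add: abs_mult)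
    qed simp
  qed
  have intd: "integrable lborel (\<lambda>\<tau>. ?i \<tau> * ((H' (y \<tau>) - H' ys) * w \<tau>))"
    by (rule Bochner_Integration.integrable_bound[OF integrable_mult_right[OF w1a, of "C * I"]])
      (use AEd C I0 in auto)
  have "(\<integral> \<tau>. ?i \<tau> * (H' (y \<tau>) * w \<tau>) \<partial>lborel)
      = (\<integral> \<tau>. ?i \<tau> * ((H' (y \<tau>) - H' ys) * w \<tau>) + H' ys * (?i \<tau> * w \<tau>) \<partial>lborel)"
    by (rule Bochner_Integration.integral_cong) (auto simp: algebra_simps)
  also have "\<dots> = (\<integral> \<tau>. ?i \<tau> * ((H' (y \<tau>) - H' ys) * w \<tau>) \<partial>lborel) + H' ys * (yt - ys)"
    by (subst Bochner_Integration.integral_add[OF intd integrable_mult_right[OF w1]]) (simp add: yt)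
  finally have eq: "(\<integral> \<tau>. ?i \<tau> * (H' (y \<tau>) * w \<tau>) \<partial>lborel)
    = (\<integral> \<tau>. ?i \<tau> * ((H' (y \<tau>) - H' ys) * w \<tau>) \<partial>lborel) + H' ys * (yt - ys)" .
  have "norm (\<integral> \<tau>. ?i \<tau> * ((H' (y \<tau>) - H' ys) * w \<tau>) \<partial>lborel) \<le> (\<integral> \<tau>. C * I * (?i \<tau> * \<bar>w \<tau>\<bar>) \<partial>lborel)"
    by (rule order_trans[OF integral_norm_bound integral_mono_AE])
      (intro integrable_norm intd AEd integrable_mult_right w1a)+
  also have "\<dots> = C * I\<^sup>2" by (simp add: I_def power2_eq_square)
  finally have 1: "\<bar>\<integral> \<tau>. ?i \<tau> * ((H' (y \<tau>) - H' ys) * w \<tau>) \<partial>lborel\<bar> \<le> C * I\<^sup>2" by simp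
  have "\<bar>yt - ys\<bar>\<^sup>2 \<le> I\<^sup>2" using part[of t] yt by (intro power_mono) auto
  then have "C * (yt - ys)\<^sup>2 \<le> C * I\<^sup>2" using C by (intro mult_left_mono) auto
  then have 2: "\<bar>H yt - H ys - H' ys * (yt - ys)\<bar> \<le> C * I\<^sup>2" using H[OF S] by linarith
  have "C * I\<^sup>2 \<le> C * ((t - s) * (\<integral> \<tau>. ?i \<tau> * (w \<tau>)\<^sup>2 \<partial>lborel))"
    using I2 C by (rule mult_left_mono)
  with 1 2 eq show ?thesis by linarith
qed

locale time_primitive =
  fixes T :: real and y w :: "real \<Rightarrow> 'a::euclidean_space \<Rightarrow> real" and y0 :: "'a \<Rightarrow> real"
  assumes T_nonneg: "0 \<le> T"
    and y_meas: "(\<lambda>z. y (fst z) (snd z)) \<in> borel_measurable (lborel \<Otimes>\<^sub>M lborel)"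
    and w_meas: "(\<lambda>z. w (fst z) (snd z)) \<in> borel_measurable (lborel \<Otimes>\<^sub>M lborel)"
    and y0_meas: "y0 \<in> borel_measurable borel"
    and w_L2: "(\<integral>\<^sup>+ t. \<integral>\<^sup>+ x. indicator {0<..<T} t * ennreal ((w t x)\<^sup>2) \<partial>lborel \<partial>lborel) < \<infinity>"
    and y_eq: "\<And>t. t \<in> {0..T} \<Longrightarrow> AE x in lborel.
      y t x = y0 x + (\<integral> \<tau>. indicator {0..t} \<tau> * w \<tau> x \<partial>lborel)"
begin

lemma y_meas' [measurable (raw)]:
  assumes "f \<in> measurable M borel" "g \<in> measurable M borel"
  shows "(\<lambda>z. y (f z) (g z)) \<in> borel_measurable M"
proof -
  have "(\<lambda>z. y (fst z) (snd z)) \<in> borel_measurable (borel \<Otimes>\<^sub>M borel)"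
    using y_meas by (simp cong: measurable_cong_sets sets_pair_measure_cong)
  from measurable_compose[OF measurable_Pair[OF assms] this] show ?thesis by simp
qed

lemma w_meas' [measurable (raw)]:
  assumes "f \<in> measurable M borel" "g \<in> measurable M borel"
  shows "(\<lambda>z. w (f z) (g z)) \<in> borel_measurable M"
proof -
  have "(\<lambda>z. w (fst z) (snd z)) \<in> borel_measurable (borel \<Otimes>\<^sub>M borel)"
    using w_meas by (simp cong: measurable_cong_sets sets_pair_measure_cong)
  from measurable_compose[OF measurable_Pair[OF assms] this] show ?thesis by simp
qed

lemmas [measurable] = y0_meas

text \<open>Half-open intervals are used because they concatenate without overlap; the endpoint
  \<open>T\<close> added here is a null set of times.\<close>

lemma w_square_integrable:
  "integrable (lborel \<Otimes>\<^sub>M lborel) (\<lambda>(\<tau>, x). indicator {0<..T} \<tau> * (w \<tau> x)\<^sup>2)"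
proof (rule integrableI_nonneg)
  have "(\<integral>\<^sup>+ z. ennreal (case z of (\<tau>, x) \<Rightarrow> indicator {0<..T} \<tau> * (w \<tau> x)\<^sup>2) \<partial>(lborel \<Otimes>\<^sub>M lborel))
      = (\<integral>\<^sup>+ t. \<integral>\<^sup>+ x. ennreal (indicator {0<..T} t * (w t x)\<^sup>2) \<partial>lborel \<partial>lborel)"
    by (subst lborel.nn_integral_fst[symmetric]) (simp_all add: split_beta')
  also have "\<dots> = (\<integral>\<^sup>+ t. \<integral>\<^sup>+ x. indicator {0<..<T} t * ennreal ((w t x)\<^sup>2) \<partial>lborel \<partial>lborel)"
  proof (rule nn_integral_cong_AE)
    show "AE t in lborel. (\<integral>\<^sup>+ x. ennreal (indicator {0<..T} t * (w t x)\<^sup>2) \<partial>lborel)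
        = (\<integral>\<^sup>+ x. indicator {0<..<T} t * ennreal ((w t x)\<^sup>2) \<partial>lborel)"
      using AE_lborel_singleton[of T]
      by eventually_elim (auto intro!: nn_integral_cong simp: indicator_def)
  qed
  finally show "(\<integral>\<^sup>+ z. ennreal (case z of (\<tau>, x) \<Rightarrow> indicator {0<..T} \<tau> * (w \<tau> x)\<^sup>2) \<partial>(lborel \<Otimes>\<^sub>M lborel)) < \<infinity>"
    using w_L2 by simp
qed (auto simp: split_beta')

lemma AE_w_square_integrable:
  "AE x in lborel. integrable lborel (\<lambda>\<tau>. indicator {0<..T} \<tau> * (w \<tau> x)\<^sup>2)"
  using lborel_pair.AE_integrable_snd[OF w_square_integrable] by simp

lemma restrict_interval:
  fixes f :: "real \<Rightarrow> real"
  assumes f: "integrable lborel (\<lambda>\<tau>. indicator {0<..T} \<tau> * f \<tau>)" and st: "0 \<le> s" "t \<le> T"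
  shows "integrable lborel (\<lambda>\<tau>. indicator {s<..t} \<tau> * f \<tau>)"
proof -
  have "integrable lborel (\<lambda>\<tau>. indicator {s<..t} \<tau> *\<^sub>R (indicator {0<..T} \<tau> * f \<tau>))"
    by (intro integrable_mult_indicator f) simp
  moreover have "(\<lambda>\<tau>. indicator {s<..t} \<tau> *\<^sub>R (indicator {0<..T} \<tau> * f \<tau>)) = (\<lambda>\<tau>. indicator {s<..t} \<tau> * f \<tau>)"
    using st by (auto simp: indicator_def fun_eq_iff)
  ultimately show ?thesis by simp
qed

lemma y_increment:
  assumes w2: "integrable lborel (\<lambda>\<tau>. indicator {0<..T} \<tau> * (w \<tau> x)\<^sup>2)"
    and s: "0 \<le> s" "s \<le> t" "t \<le> T"
    and "y s x = y0 x + (\<integral> \<tau>. indicator {0..s} \<tau> * w \<tau> x \<partial>lborel)"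
    and "y t x = y0 x + (\<integral> \<tau>. indicator {0..t} \<tau> * w \<tau> x \<partial>lborel)"
  shows "y t x = y s x + (\<integral> \<tau>. indicator {s<..t} \<tau> * w \<tau> x \<partial>lborel)"
proof -
  have w1: "integrable lborel (\<lambda>\<tau>. indicator {0<..T} \<tau> * w \<tau> x)"
    by (rule square_integral_le(1)[OF T_nonneg _ w2]) measurable
  have z: "(\<integral> \<tau>. indicator {0..t} \<tau> * w \<tau> x \<partial>lborel) = (\<integral> \<tau>. indicator {0<..t} \<tau> * w \<tau> x \<partial>lborel)" for t
    by (rule integral_cong_AE)
      (use AE_lborel_singleton[of 0] in \<open>auto elim!: eventually_mono simp: indicator_def\<close>)
  have "(\<integral> \<tau>. indicator {0<..s} \<tau> * w \<tau> x \<partial>lborel) + (\<integral> \<tau>. indicator {s<..t} \<tau> * w \<tau> x \<partial>lborel)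
      = (\<integral> \<tau>. indicator {0<..s} \<tau> * w \<tau> x + indicator {s<..t} \<tau> * w \<tau> x \<partial>lborel)"
    using s by (intro Bochner_Integration.integral_add[symmetric] restrict_interval[OF w1]) auto
  also have "\<dots> = (\<integral> \<tau>. indicator {0<..t} \<tau> * w \<tau> x \<partial>lborel)"
    using s by (intro Bochner_Integration.integral_cong) (auto simp: indicator_def)
  finally show ?thesis using assms(5,6) z by simp
qed

text \<open>The null set in \<open>y_eq\<close> may depend on the time. Fubini's theorem turns this
  into a statement on almost every time path.\<close>

lemma AE_y_eq_all:
  "AE x in lborel. AE \<tau> in lborel. \<tau> \<in> {0..T} \<longrightarrow>
      y \<tau> x = y0 x + (\<integral> \<sigma>. indicator {0..\<tau>} \<sigma> * w \<sigma> x \<partial>lborel)"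
proof -
  \<comment> \<open>The indicator of an interval with moving endpoint is written as a conditional,
    whose joint measurability in both times is evident.\<close>
  let ?P = "\<lambda>\<tau> x. \<tau> \<in> {0..T} \<longrightarrow>
      y \<tau> x = y0 x + (\<integral> \<sigma>. (if 0 \<le> \<sigma> \<and> \<sigma> \<le> \<tau> then 1 else 0) * w \<sigma> x \<partial>lborel)"
  have eq: "(\<lambda>\<sigma>. indicator {0..\<tau>} \<sigma> * w \<sigma> x) = (\<lambda>\<sigma>. (if 0 \<le> \<sigma> \<and> \<sigma> \<le> \<tau> then 1 else 0) * w \<sigma> x)" for \<tau> x
    by (auto simp: indicator_def)
  have "(AE \<tau> in lborel. AE x in lborel. ?P \<tau> x) \<longleftrightarrow> (AE x in lborel. AE \<tau> in lborel. ?P \<tau> x)"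
    by (rule lborel_pair.AE_commute) measurable
  moreover have "AE \<tau> in lborel. AE x in lborel. ?P \<tau> x"
  proof (rule AE_I2)
    fix \<tau> show "AE x in lborel. ?P \<tau> x"
      using y_eq[of \<tau>] by (cases "\<tau> \<in> {0..T}") (simp_all add: eq)
  qed
  ultimately show ?thesis by (simp add: eq)
qed

text \<open>The increment estimate is integrated in space with weight \<open>a\<close>. The
  difference \<open>G\<close> of the two sides of the formula then has increments of the form
  treated by \<open>constant_if_increments_small\<close>, with the space-time integral of the
  squared derivative as \<open>W\<close>.\<close>

lemma weighted_chain_rule:
  fixes a :: "'a \<Rightarrow> real" and H H' :: "real \<Rightarrow> real" and S :: "real set"
  assumes [measurable]: "H \<in> borel_measurable borel" "H' \<in> borel_measurable borel" "S \<in> sets borel"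
    and a: "integrable lborel a" "\<And>x. \<bar>a x\<bar> \<le> A"
    and S: "\<And>t. t \<in> {0..T} \<Longrightarrow> AE x in lborel. y t x \<in> S"
    and C: "0 \<le> C"
    and H: "\<And>a b. a \<in> S \<Longrightarrow> b \<in> S \<Longrightarrow> \<bar>H b - H a - H' a * (b - a)\<bar> \<le> C * (b - a)\<^sup>2"
    and H': "\<And>a b. a \<in> S \<Longrightarrow> b \<in> S \<Longrightarrow> \<bar>H' b - H' a\<bar> \<le> C * \<bar>b - a\<bar>"
    and B: "\<And>a. a \<in> S \<Longrightarrow> \<bar>H a\<bar> \<le> B" "\<And>a. a \<in> S \<Longrightarrow> \<bar>H' a\<bar> \<le> B"
  shows "integrable lborel (\<lambda>\<tau>. indicator {0<..T} \<tau> * (\<integral> x. a x * (H' (y \<tau> x) * w \<tau> x) \<partial>lborel))" (is ?int)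
    and "(\<integral> x. a x * H (y T x) \<partial>lborel) - (\<integral> x. a x * H (y 0 x) \<partial>lborel)
      = (\<integral> \<tau>. indicator {0<..T} \<tau> * (\<integral> x. a x * (H' (y \<tau> x) * w \<tau> x) \<partial>lborel) \<partial>lborel)" (is ?eq)
proof -
  have a_meas [measurable]: "a \<in> borel_measurable borel"
    using borel_measurable_integrable[OF a(1)] by simp
  have A0: "0 \<le> A" using a(2) abs_ge_zero order_trans by blast
  have a2: "integrable lborel (\<lambda>x. (a x)\<^sup>2)"
  proof (rule Bochner_Integration.integrable_bound[OF integrable_mult_right[OF a(1), of A]])
    show "AE x in lborel. norm ((a x)\<^sup>2) \<le> norm (A * a x)"
    proof (rule AE_I2)
      fix x
      have "\<bar>a x\<bar> * \<bar>a x\<bar> \<le> A * \<bar>a x\<bar>" using a(2) by (intro mult_right_mono) auto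
      then show "norm ((a x)\<^sup>2) \<le> norm (A * a x)" using A0 by (simp add: power2_eq_square abs_mult)
    qed
  qed measurable
  have S': "AE \<tau> in lborel. AE x in lborel. \<tau> \<in> {0..T} \<longrightarrow> y \<tau> x \<in> S"
  proof (rule AE_I2)
    fix \<tau> show "AE x in lborel. \<tau> \<in> {0..T} \<longrightarrow> y \<tau> x \<in> S"
    proof (cases "\<tau> \<in> {0..T}")
      case True
      from S[OF True] show ?thesis by eventually_elim simp
    next
      case False
      then show ?thesis by (intro AE_I2) blast
    qed
  qed
  have Sz: "AE z in lborel \<Otimes>\<^sub>M (lborel :: 'a measure). fst z \<in> {0..T} \<longrightarrow> y (fst z) (snd z) \<in> S"
  proof (rule lborel_pair.AE_pair_measure)
    show "AE \<tau> in lborel. AE x in lborel. fst (\<tau>, x) \<in> {0..T} \<longrightarrow> y (fst (\<tau>, x)) (snd (\<tau>, x)) \<in> S"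
      unfolding fst_conv snd_conv by (rule S')
  qed measurable
  \<comment> \<open>The derivative \<open>w\<close> is only square-integrable, so the product is
    dominated by \<open>(a x)\<^sup>2\<close> plus \<open>(w \<tau> x)\<^sup>2\<close>, up to the
    factor \<open>B\<close>; this is why \<open>a\<close> had to be shown square-integrable.\<close>
  have Q: "integrable (lborel \<Otimes>\<^sub>M lborel) (\<lambda>(\<tau>, x). indicator {0<..T} \<tau> * (a x * (H' (y \<tau> x) * w \<tau> x)))"
  proof (rule Bochner_Integration.integrable_bound)
    have "(\<integral>\<^sup>+ z. ennreal (indicator {0<..T} (fst z) * (a (snd z))\<^sup>2) \<partial>(lborel \<Otimes>\<^sub>M lborel))
        = (\<integral>\<^sup>+ \<tau>. \<integral>\<^sup>+ x. ennreal (indicator {0<..T} \<tau> * (a x)\<^sup>2) \<partial>lborel \<partial>lborel)"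
      by (subst lborel.nn_integral_fst[symmetric]) simp_all
    also have "\<dots> = (\<integral>\<^sup>+ \<tau>. ennreal (indicator {0<..T} \<tau>) * (\<integral>\<^sup>+ x. ennreal ((a x)\<^sup>2) \<partial>lborel) \<partial>lborel)"
      by (simp add: ennreal_mult nn_integral_cmult)
    also have "\<dots> = ennreal T * (\<integral>\<^sup>+ x. ennreal ((a x)\<^sup>2) \<partial>lborel)"
      using T_nonneg by (simp add: nn_integral_multc ennreal_indicator)
    also have "\<dots> < \<infinity>" using a2 by (simp add: ennreal_mult_less_top nn_integral_eq_integral)
    finally have "integrable (lborel \<Otimes>\<^sub>M lborel) (\<lambda>z. indicator {0<..T} (fst z) * (a (snd z))\<^sup>2)"
      by (intro integrableI_nonneg) auto
    then show "integrable (lborel \<Otimes>\<^sub>M lborel) (\<lambda>z. B * (indicator {0<..T} (fst z) * (a (snd z))\<^sup>2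
        + indicator {0<..T} (fst z) * (w (fst z) (snd z))\<^sup>2))"
      using w_square_integrable by (simp add: split_beta')
    show "AE z in lborel \<Otimes>\<^sub>M lborel. norm (case z of (\<tau>, x) \<Rightarrow> indicator {0<..T} \<tau> * (a x * (H' (y \<tau> x) * w \<tau> x)))
        \<le> norm (B * (indicator {0<..T} (fst z) * (a (snd z))\<^sup>2
        + indicator {0<..T} (fst z) * (w (fst z) (snd z))\<^sup>2))"
      using Sz
    proof eventually_elim
      case (elim z)
      show ?case
      proof (cases "fst z \<in> {0<..T}")
        case True
        define \<alpha> where "\<alpha> = \<bar>a (snd z)\<bar>"
        define \<omega> where "\<omega> = \<bar>w (fst z) (snd z)\<bar>"
        define h where "h = \<bar>H' (y (fst z) (snd z))\<bar>"
        have h: "h \<le> B" "0 \<le> h" using elim True B(2) by (auto simp: h_def)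
        have "\<alpha> * \<omega> \<le> \<alpha>\<^sup>2 + \<omega>\<^sup>2"
        proof -
          have "0 \<le> \<alpha> * \<omega>" by (simp add: \<alpha>_def \<omega>_def)
          moreover have "2 * (\<alpha> * \<omega>) \<le> \<alpha>\<^sup>2 + \<omega>\<^sup>2" using sum_squares_bound[of \<alpha> \<omega>] by (simp add: mult.assoc)
          ultimately show ?thesis by linarith
        qed

        then have "h * (\<alpha> * \<omega>) \<le> B * (\<alpha>\<^sup>2 + \<omega>\<^sup>2)" using h by (intro mult_mono) (auto simp: \<alpha>_def \<omega>_def)
        then show ?thesis using True h
          by (simp add: split_beta' abs_mult \<alpha>_def \<omega>_def h_def mult_ac)
      qed (simp add: split_beta')
    qed
  qed (simp add: split_beta')
  have Q1: "integrable lborel (\<lambda>\<tau>. \<integral> x. indicator {0<..T} \<tau> * (a x * (H' (y \<tau> x) * w \<tau> x)) \<partial>lborel)"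
    by (rule lborel_pair.integrable_fst[OF Q])
  then show ?int by simp
  have Qst: "integrable (lborel \<Otimes>\<^sub>M lborel) (\<lambda>(\<tau>, x). indicator {s<..t} \<tau> * (a x * (H' (y \<tau> x) * w \<tau> x)))"
    if "0 \<le> s" "t \<le> T" for s t
  proof -
    have "integrable (lborel \<Otimes>\<^sub>M lborel) (\<lambda>z. indicator ({s<..t} \<times> UNIV) z *\<^sub>R
        (case z of (\<tau>, x) \<Rightarrow> indicator {0<..T} \<tau> * (a x * (H' (y \<tau> x) * w \<tau> x))))"
      by (intro integrable_mult_indicator Q) auto
    moreover have "(\<lambda>z. indicator ({s<..t} \<times> UNIV) z *\<^sub>R
        (case z of (\<tau>, x) \<Rightarrow> indicator {0<..T} \<tau> * (a x * (H' (y \<tau> x) * w \<tau> x))))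
      = (\<lambda>(\<tau>, x). indicator {s<..t} \<tau> * (a x * (H' (y \<tau> x) * w \<tau> x)))"
      using that by (auto simp: indicator_def fun_eq_iff)
    ultimately show ?thesis by simp
  qed
  have Wst: "integrable (lborel \<Otimes>\<^sub>M lborel) (\<lambda>(\<tau>, x). indicator {s<..t} \<tau> * (w \<tau> x)\<^sup>2)"
    if "0 \<le> s" "t \<le> T" for s t
  proof -
    have "integrable (lborel \<Otimes>\<^sub>M lborel) (\<lambda>z. indicator ({s<..t} \<times> UNIV) z *\<^sub>R
        (case z of (\<tau>, x) \<Rightarrow> indicator {0<..T} \<tau> * (w \<tau> x)\<^sup>2))"
      by (intro integrable_mult_indicator w_square_integrable) auto
    moreover have "(\<lambda>z. indicator ({s<..t} \<times> UNIV) z *\<^sub>R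
        (case z of (\<tau>, x) \<Rightarrow> indicator {0<..T} \<tau> * (w \<tau> x)\<^sup>2))
      = (\<lambda>(\<tau>, x). indicator {s<..t} \<tau> * (w \<tau> x)\<^sup>2)"
      using that by (auto simp: indicator_def fun_eq_iff)
    ultimately show ?thesis by simp
  qed
  have Hint: "integrable lborel (\<lambda>x. a x * H (y t x))" if "t \<in> {0..T}" for t
  proof (rule Bochner_Integration.integrable_bound[OF integrable_mult_right[OF a(1), of B]])
    show "AE x in lborel. norm (a x * H (y t x)) \<le> norm (B * a x)"
      using S[OF that]
    proof eventually_elim
      case (elim x)
      then have "\<bar>H (y t x)\<bar> \<le> \<bar>B\<bar>" using B(1) by force
      then have "\<bar>H (y t x)\<bar> * \<bar>a x\<bar> \<le> \<bar>B\<bar> * \<bar>a x\<bar>" by (rule mult_right_mono) simp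
      then show ?case by (simp only: real_norm_def abs_mult mult.commute[of "\<bar>a x\<bar>"])
    qed
  qed measurable
  define R where "R s t = (\<integral> z. (case z of (\<tau>, x) \<Rightarrow> indicator {s<..t} \<tau> * (a x * (H' (y \<tau> x) * w \<tau> x))) \<partial>(lborel \<Otimes>\<^sub>M lborel))" for s t
  define V where "V s t = (\<integral> z. (case z of (\<tau>, x) \<Rightarrow> indicator {s<..t} \<tau> * (w \<tau> x)\<^sup>2) \<partial>(lborel \<Otimes>\<^sub>M lborel))" for s t
  define G where "G t = (\<integral> x. a x * H (y t x) \<partial>lborel) - R 0 t" for t
  have R_add: "R 0 t = R 0 s + R s t" if "0 \<le> s" "s \<le> t" "t \<le> T" for s t
  proof -
    have "R 0 s + R s t = (\<integral> z. (case z of (\<tau>, x) \<Rightarrow> indicator {0<..s} \<tau> * (a x * (H' (y \<tau> x) * w \<tau> x)))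
        + (case z of (\<tau>, x) \<Rightarrow> indicator {s<..t} \<tau> * (a x * (H' (y \<tau> x) * w \<tau> x))) \<partial>(lborel \<Otimes>\<^sub>M lborel))"
      unfolding R_def using that by (intro Bochner_Integration.integral_add[symmetric] Qst) auto
    also have "\<dots> = R 0 t"
      unfolding R_def using that by (intro Bochner_Integration.integral_cong) (auto simp: indicator_def)
    finally show ?thesis by simp
  qed
  have V_add: "V 0 t = V 0 s + V s t" if "0 \<le> s" "s \<le> t" "t \<le> T" for s t
  proof -
    have "V 0 s + V s t = (\<integral> z. (case z of (\<tau>, x) \<Rightarrow> indicator {0<..s} \<tau> * (w \<tau> x)\<^sup>2)
        + (case z of (\<tau>, x) \<Rightarrow> indicator {s<..t} \<tau> * (w \<tau> x)\<^sup>2) \<partial>(lborel \<Otimes>\<^sub>M lborel))"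
      unfolding V_def using that by (intro Bochner_Integration.integral_add[symmetric] Wst) auto
    also have "\<dots> = V 0 t"
      unfolding V_def using that by (intro Bochner_Integration.integral_cong) (auto simp: indicator_def)
    finally show ?thesis by simp
  qed
  have "G T = G 0"
  proof (rule constant_if_increments_small[where W="V 0" and C="2 * A * C"])
    fix s t assume st: "0 \<le> s" "s \<le> t" "t \<le> T"
    let ?q = "\<lambda>x. \<integral> \<tau>. indicator {s<..t} \<tau> * (a x * (H' (y \<tau> x) * w \<tau> x)) \<partial>lborel"
    let ?v = "\<lambda>x. \<integral> \<tau>. indicator {s<..t} \<tau> * (w \<tau> x)\<^sup>2 \<partial>lborel"
    have q: "integrable lborel ?q" and Rq: "R s t = (\<integral> x. ?q x \<partial>lborel)"
      using lborel_pair.integrable_snd[OF Qst[of s t]] lborel_pair.integral_snd[OF Qst[of s t]] st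
      by (auto simp: R_def)
    have v: "integrable lborel ?v" and Vv: "V s t = (\<integral> x. ?v x \<partial>lborel)"
      using lborel_pair.integrable_snd[OF Wst[of s t]] lborel_pair.integral_snd[OF Wst[of s t]] st
      by (auto simp: V_def)
    have tT: "s \<in> {0..T}" "t \<in> {0..T}" using st by auto
    have "(AE \<tau> in lborel. AE x in lborel. \<tau> \<in> {0..T} \<longrightarrow> y \<tau> x \<in> S)
        \<longleftrightarrow> (AE x in lborel. AE \<tau> in lborel. \<tau> \<in> {0..T} \<longrightarrow> y \<tau> x \<in> S)"
      by (rule lborel_pair.AE_commute) measurable
    with S' have "AE x in lborel. AE \<tau> in lborel. \<tau> \<in> {0..T} \<longrightarrow> y \<tau> x \<in> S" by blast
    \<comment> \<open>The exceptional set of points depends on \<open>s\<close> and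
      \<open>t\<close>, which is harmless because only the integral over \<open>x\<close> is used
      afterwards.\<close>
    then have key: "AE x in lborel. norm (a x * H (y t x) - a x * H (y s x) - ?q x) \<le> 2 * A * C * (t - s) * ?v x"
      using AE_y_eq_all AE_w_square_integrable y_eq[OF tT(1)] y_eq[OF tT(2)] S[OF tT(1)] S[OF tT(2)]
    proof eventually_elim
      case (elim x)
      note w2 = elim(3) and ys = elim(4)
      have wst: "integrable lborel (\<lambda>\<tau>. indicator {s<..t} \<tau> * (w \<tau> x)\<^sup>2)"
        by (rule restrict_interval[OF w2]) (use st in auto)
      have yt: "y t x = y s x + (\<integral> \<tau>. indicator {s<..t} \<tau> * w \<tau> x \<partial>lborel)"
        by (rule y_increment[OF w2 st elim(4,5)])
      have y\<tau>: "AE \<tau> in lborel. \<tau> \<in> {s<..t} \<longrightarrow> y \<tau> x \<in> S \<and>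
          y \<tau> x = y s x + (\<integral> \<sigma>. indicator {s<..\<tau>} \<sigma> * w \<sigma> x \<partial>lborel)"
        using elim(1,2)
      proof eventually_elim
        case (elim \<tau>)
        show ?case
        proof
          assume \<tau>: "\<tau> \<in> {s<..t}"
          with st have \<tau>T: "\<tau> \<in> {0..T}" by auto
          have "y \<tau> x = y s x + (\<integral> \<sigma>. indicator {s<..\<tau>} \<sigma> * w \<sigma> x \<partial>lborel)"
          proof (rule y_increment[OF w2 st(1)])
            show "s \<le> \<tau>" "\<tau> \<le> T" using \<tau> st by auto
            show "y s x = y0 x + (\<integral> \<tau>. indicator {0..s} \<tau> * w \<tau> x \<partial>lborel)" by (rule ys)
            show "y \<tau> x = y0 x + (\<integral> \<sigma>. indicator {0..\<tau>} \<sigma> * w \<sigma> x \<partial>lborel)"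
              using elim(2) \<tau>T by blast
          qed
          with elim(1) \<tau>T show "y \<tau> x \<in> S \<and> y \<tau> x = y s x + (\<integral> \<sigma>. indicator {s<..\<tau>} \<sigma> * w \<sigma> x \<partial>lborel)"
            by blast
        qed
      qed
      have *: "\<bar>H (y t x) - H (y s x) - (\<integral> \<tau>. indicator {s<..t} \<tau> * (H' (y \<tau> x) * w \<tau> x) \<partial>lborel)\<bar>
          \<le> 2 * C * ((t - s) * ?v x)"
        by (rule chain_rule_increment[OF st(2) _ _ _ wst y\<tau> yt elim(6,7) C H H']; measurable)
      have qa: "?q x = a x * (\<integral> \<tau>. indicator {s<..t} \<tau> * (H' (y \<tau> x) * w \<tau> x) \<partial>lborel)"
        by (subst integral_mult_right_zero[symmetric]) (simp only: mult_ac)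
      have "norm (a x * H (y t x) - a x * H (y s x) - ?q x) = \<bar>a x\<bar> *
          \<bar>H (y t x) - H (y s x) - (\<integral> \<tau>. indicator {s<..t} \<tau> * (H' (y \<tau> x) * w \<tau> x) \<partial>lborel)\<bar>"
        unfolding qa abs_mult[symmetric] real_norm_def by (simp only: right_diff_distrib)
      also have "\<dots> \<le> A * (2 * C * ((t - s) * ?v x))"
        using * a(2) A0 by (intro mult_mono) auto
      also have "\<dots> = 2 * A * C * (t - s) * ?v x" by (simp only: mult_ac)
      finally show ?case .
    qed
    have "G t - G s = (\<integral> x. a x * H (y t x) \<partial>lborel) - (\<integral> x. a x * H (y s x) \<partial>lborel) - R s t"
      using R_add[OF st] by (simp add: G_def)
    also have "\<dots> = (\<integral> x. a x * H (y t x) - a x * H (y s x) - ?q x \<partial>lborel)"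
      using Hint[OF tT(1)] Hint[OF tT(2)] q by (simp add: Rq)
    finally have "\<bar>G t - G s\<bar> = norm (\<integral> x. a x * H (y t x) - a x * H (y s x) - ?q x \<partial>lborel)" by simp
    also have "\<dots> \<le> (\<integral> x. 2 * A * C * (t - s) * ?v x \<partial>lborel)"
      by (rule order_trans[OF integral_norm_bound integral_mono_AE])
        (intro integrable_norm key integrable_mult_right v Bochner_Integration.integrable_diff Hint tT q)+
    also have "\<dots> = 2 * A * C * (t - s) * (V 0 t - V 0 s)"
      using V_add[OF st] by (simp add: Vv)
    finally show "\<bar>G t - G s\<bar> \<le> 2 * A * C * (t - s) * (V 0 t - V 0 s)" .
  qed (use A0 C T_nonneg in auto)
  moreover have "R 0 0 = 0" by (simp add: R_def)
  moreover have "R 0 T = (\<integral> \<tau>. \<integral> x. indicator {0<..T} \<tau> * (a x * (H' (y \<tau> x) * w \<tau> x)) \<partial>lborel \<partial>lborel)"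
    unfolding R_def by (rule lborel_pair.integral_fst[OF Q, symmetric])
  ultimately show ?eq by (simp add: G_def)
qed

end

section \<open>Weak solutions and comparison\<close>

lemma integral_power_Ioc:
  fixes t :: real
  assumes "0 \<le> t"
  shows "integrable lborel (\<lambda>\<tau>. indicator {0<..t} \<tau> * \<tau> ^ n)"
    and "(\<integral> \<tau>. indicator {0<..t} \<tau> * \<tau> ^ n \<partial>lborel) = t ^ Suc n / real (Suc n)"
proof -
  have "has_bochner_integral lborel (\<lambda>x. x ^ n * indicator {0..t} x) (t ^ Suc n / real (Suc n) - 0 ^ Suc n / real (Suc n))"
    by (rule has_bochner_integral_FTC_Icc_real[where F="\<lambda>x. x ^ Suc n / real (Suc n)"])
      (auto intro!: derivative_eq_intros assms simp del: power_Suc)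
  moreover have ae: "AE \<tau> in lborel. \<tau> ^ n * indicator {0..t} \<tau> = indicator {0<..t} \<tau> * \<tau> ^ n"
    using AE_lborel_singleton[of 0] by eventually_elim (auto simp: indicator_def)
  ultimately have "has_bochner_integral lborel (\<lambda>\<tau>. indicator {0<..t} \<tau> * \<tau> ^ n) (t ^ Suc n / real (Suc n))"
    by (subst has_bochner_integral_cong_AE[symmetric, OF _ _ ae]) auto
  then show "integrable lborel (\<lambda>\<tau>. indicator {0<..t} \<tau> * \<tau> ^ n)"
    "(\<integral> \<tau>. indicator {0<..t} \<tau> * \<tau> ^ n \<partial>lborel) = t ^ Suc n / real (Suc n)"
    by (auto simp: has_bochner_integral_iff)
qed

text \<open>Iterating the integral inequality gives the bound
  \<open>B * (L * t) ^ n / fact n\<close>, which tends to 0. The integrand is a separate function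
  \<open>Z\<close>, since \<open>Y\<close> is not assumed measurable and the comparison is known
  only at almost every time.\<close>

lemma gronwall_zero:
  fixes Y Z :: "real \<Rightarrow> real"
  assumes L: "0 \<le> L" and Y0: "\<And>t. t \<in> {0..T} \<Longrightarrow> 0 \<le> Y t" and YB: "\<And>t. t \<in> {0..T} \<Longrightarrow> Y t \<le> B"
    and Z: "\<And>t. t \<in> {0..T} \<Longrightarrow> integrable lborel (\<lambda>\<tau>. indicator {0<..t} \<tau> * Z \<tau>)"
    and YZ: "\<And>t. t \<in> {0..T} \<Longrightarrow> Y t \<le> (\<integral> \<tau>. indicator {0<..t} \<tau> * Z \<tau> \<partial>lborel)"
    and ZY: "AE \<tau> in lborel. \<tau> \<in> {0<..<T} \<longrightarrow> Z \<tau> \<le> L * Y \<tau>"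
    and t: "t \<in> {0..T}"
  shows "Y t = 0"
proof -
  have bound: "Y t \<le> B * (L * t) ^ n / fact n" if "t \<in> {0..T}" for n t
    using that
  proof (induction n arbitrary: t)
    case 0 then show ?case using YB by simp
  next
    case (Suc n)
    note pw = integral_power_Ioc[of t n]
    let ?c = "B * L ^ Suc n / fact n"
    have "Y t \<le> (\<integral> \<tau>. indicator {0<..t} \<tau> * Z \<tau> \<partial>lborel)" by (rule YZ[OF Suc.prems])
    also have "\<dots> \<le> (\<integral> \<tau>. ?c * (indicator {0<..t} \<tau> * \<tau> ^ n) \<partial>lborel)"
    proof (rule integral_mono_AE)
      show "AE \<tau> in lborel. indicator {0<..t} \<tau> * Z \<tau> \<le> ?c * (indicator {0<..t} \<tau> * \<tau> ^ n)"
        using ZY AE_lborel_singleton[of T]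
      proof eventually_elim
        case (elim \<tau>)
        show ?case
        proof (cases "\<tau> \<in> {0<..t}")
          case True
          with elim Suc.prems have "\<tau> \<in> {0<..<T}" by auto
          then have "Z \<tau> \<le> L * Y \<tau>" using elim by blast
          also have "\<dots> \<le> L * (B * (L * \<tau>) ^ n / fact n)"
            using L \<open>\<tau> \<in> {0<..<T}\<close> by (intro mult_left_mono Suc.IH) auto
          also have "\<dots> = ?c * \<tau> ^ n" by (simp add: power_mult_distrib)
          finally show ?thesis using True by simp
        qed simp
      qed
    qed (use Z[OF Suc.prems] pw(1) Suc.prems in \<open>auto intro!: integrable_mult_right simp del: power_Suc\<close>)
    also have "\<dots> = ?c * (t ^ Suc n / real (Suc n))"
      using pw(2) Suc.prems by (subst integral_mult_right_zero) simp
    also have "\<dots> = B * (L * t) ^ Suc n / fact (Suc n)"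
      by (simp add: power_mult_distrib field_simps)
    finally show ?case .
  qed
  have "(\<lambda>n. (L * t) ^ n / fact n) \<longlonglongrightarrow> 0"
    using summable_LIMSEQ_zero[OF summable_exp[of "L * t"]] by (simp add: field_simps)
  then have "(\<lambda>n. B * ((L * t) ^ n / fact n)) \<longlonglongrightarrow> B * 0" by (intro tendsto_intros)
  then have "Y t \<le> B * 0" by (rule LIMSEQ_le_const) (use bound[OF t] in simp)
  then show ?thesis using Y0[OF t] by simp
qed

text \<open>Turns bounds that \<open>u t\<close> satisfies almost everywhere into bounds at every
  point, changing \<open>u t\<close> only on a null set. Lipschitz estimates for test functions can
  then be pointwise.\<close>

definition truncation :: "real \<Rightarrow> real \<Rightarrow> real" where
  "truncation M x = max 0 (min M x)"

lemma truncation_measurable [measurable]: "truncation M \<in> borel_measurable borel"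
  unfolding truncation_def by measurable

lemma truncation_bounds: "0 \<le> truncation M x" "0 \<le> M \<Longrightarrow> truncation M x \<le> M"
  by (auto simp: truncation_def)

lemma truncation_eq: "x \<in> {0..M} \<Longrightarrow> truncation M x = x"
  by (auto simp: truncation_def)

lemma integrable_bounded_support:
  fixes f :: "'a::euclidean_space \<Rightarrow> real"
  assumes D: "bounded D" "D \<in> sets borel" and [measurable]: "f \<in> borel_measurable borel"
    and B: "\<And>x. \<bar>f x\<bar> \<le> B" and supp: "\<And>x. x \<notin> D \<Longrightarrow> f x = 0"
  shows "integrable lborel f"
proof (rule Bochner_Integration.integrable_bound)
  show "integrable lborel (\<lambda>x. B * indicator D x)"
    using D emeasure_bounded_finite[OF D(1)] by (intro integrable_mult_right integrable_real_indicator) auto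
  show "AE x in lborel. norm (f x) \<le> norm (B * indicator D x)"
  proof (rule AE_I2)
    fix x
    show "norm (f x) \<le> norm (B * indicator D x)"
      using B[of x] supp[of x] by (cases "x \<in> D") auto
  qed
qed simp

locale weak_solution_on =
  fixes s p lam q r T :: real and \<Omega> \<Omega>0 :: "'a::euclidean_space set"
    and b u0 :: "'a \<Rightarrow> real" and u :: "real \<Rightarrow> 'a \<Rightarrow> real"
  assumes p: "1 < p" and q: "0 < q" and lam: "0 < lam"
    and \<Omega>: "bounded \<Omega>" "\<Omega> \<in> sets borel"
    and \<Omega>0: "\<Omega>0 \<subseteq> \<Omega>" "\<Omega>0 \<in> sets borel" and b_zero: "\<And>x. x \<in> \<Omega>0 \<Longrightarrow> b x = 0"
    and u0_meas [measurable]: "u0 \<in> borel_measurable borel"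
    and sol: "weak_solution s p \<Omega> b lam q r u0 T u"
begin

lemma T_pos: "0 < T"
  using sol by (simp add: weak_solution_def)

lemma u_meas [measurable]: "t \<in> {0..T} \<Longrightarrow> u t \<in> borel_measurable borel"
  using sol by (simp add: weak_solution_def)

lemma u_bounds:
  obtains Mu where "0 \<le> Mu" "\<And>t. t \<in> {0..T} \<Longrightarrow> AE x in lborel. u t x \<in> {0..Mu}"
proof -
  obtain M where M: "\<And>t. t \<in> {0..T} \<Longrightarrow> AE x in lborel. \<bar>u t x\<bar> \<le> M"
    and nn: "\<And>t. t \<in> {0..T} \<Longrightarrow> AE x in lborel. 0 \<le> u t x"
    using sol unfolding weak_solution_def by blast
  have "AE x in lborel. u t x \<in> {0..max 0 M}" if "t \<in> {0..T}" for t
    using M[OF that] nn[OF that] by eventually_elim auto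
  then show ?thesis by (rule that[rotated]) simp_all
qed

lemma bounded_in_W0:
  assumes [measurable]: "\<phi> \<in> borel_measurable borel" and B: "\<And>x. \<bar>\<phi> x\<bar> \<le> B"
    and supp: "\<And>x. x \<notin> \<Omega>0 \<Longrightarrow> \<phi> x = 0" and gag: "gagliardo s p \<phi> < \<infinity>"
  shows "\<phi> \<in> W0 s p \<Omega>" "Linf \<phi>"
proof -
  have supp': "\<phi> x = 0" if "x \<notin> \<Omega>" for x using supp that \<Omega>0 by blast
  have "integrable lborel (\<lambda>x. \<bar>\<phi> x\<bar> powr p)"
    by (rule integrable_bounded_support[OF \<Omega>, where B="B powr p"])
      (use B supp' p in \<open>auto intro!: powr_mono2\<close>)
  then show "\<phi> \<in> W0 s p \<Omega>" using gag supp' by (auto simp: W0_def)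
  show "Linf \<phi>" using B by (auto simp: Linf_def)
qed

text \<open>A test function vanishing off \<open>\<Omega>0\<close> does not see the absorption, as
  \<open>b\<close> is zero there, so only the reaction remains on the right. A single
  \<open>w\<close> serves all end times \<open>t\<close>, which the Gronwall argument
  requires.\<close>

lemma time_derivative:
  assumes "0 \<le> Mu" and Mu: "\<And>t. t \<in> {0..T} \<Longrightarrow> AE x in lborel. u t x \<in> {0..Mu}"
  obtains w where "\<And>t. t \<in> {0..T} \<Longrightarrow> time_primitive t u w u0"
    and "AE t in lborel. t \<in> {0<..<T} \<longrightarrow> gagliardo s p (\<lambda>x. truncation Mu (u t x)) < \<infinity> \<and>
      (\<forall>\<phi> B. \<phi> \<in> borel_measurable borel \<longrightarrow> (\<forall>x. \<bar>\<phi> x\<bar> \<le> B) \<longrightarrow> (\<forall>x. x \<notin> \<Omega>0 \<longrightarrow> \<phi> x = 0) \<longrightarrow>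
        gagliardo s p \<phi> < \<infinity> \<longrightarrow>
        (\<integral> x. w t x * \<phi> x \<partial>lborel) + frac_form s p (\<lambda>x. truncation Mu (u t x)) \<phi>
          = (\<integral> x. lam * truncation Mu (u t x) powr q * \<phi> x \<partial>lborel))"
proof -
  have y_meas: "(\<lambda>z. u (fst z) (snd z)) \<in> borel_measurable (lborel \<Otimes>\<^sub>M lborel)"
    using sol by (simp add: weak_solution_def)
  obtain K where K: "AE t in lborel. t \<in> {0<..<T} \<longrightarrow> u t \<in> W0 s p \<Omega> \<and> gagliardo s p (u t) \<le> K"
    using sol unfolding weak_solution_def by blast
  obtain w where w_meas: "(\<lambda>z. w (fst z) (snd z)) \<in> borel_measurable (lborel \<Otimes>\<^sub>M lborel)"
    and w2: "(\<integral>\<^sup>+ t. \<integral>\<^sup>+ x. indicator {0<..<T} t * ennreal ((w t x)\<^sup>2) \<partial>lborel \<partial>lborel) < \<infinity>"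
    and y_eq: "\<And>t. t\<in>{0..T} \<Longrightarrow> AE x in lborel.
           u t x = u0 x + (\<integral> \<tau>. indicator {0..t} \<tau> * w \<tau> x \<partial>lborel)"
    and weak: "AE t in lborel. t \<in> {0<..<T} \<longrightarrow>
           (\<forall>\<phi> \<in> W0 s p \<Omega>. Linf \<phi> \<longrightarrow>
              (\<integral> x. w t x * \<phi> x \<partial>lborel) + frac_form s p (u t) \<phi>
              = (\<integral> x. (lam * u t x powr q - b x * u t x powr r) * \<phi> x \<partial>lborel))"
    using sol unfolding weak_solution_def by blast
  have "time_primitive t u w u0" if t: "t \<in> {0..T}" for t
  proof
    have "(\<integral>\<^sup>+ \<tau>. \<integral>\<^sup>+ x. indicator {0<..<t} \<tau> * ennreal ((w \<tau> x)\<^sup>2) \<partial>lborel \<partial>lborel)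
        \<le> (\<integral>\<^sup>+ \<tau>. \<integral>\<^sup>+ x. indicator {0<..<T} \<tau> * ennreal ((w \<tau> x)\<^sup>2) \<partial>lborel \<partial>lborel)"
      using t by (intro nn_integral_mono) (auto simp: indicator_def)
    then show "(\<integral>\<^sup>+ \<tau>. \<integral>\<^sup>+ x. indicator {0<..<t} \<tau> * ennreal ((w \<tau> x)\<^sup>2) \<partial>lborel \<partial>lborel) < \<infinity>"
      using w2 by (rule le_less_trans)
    show "0 \<le> t" using t by simp
    show "AE x in lborel. u t' x = u0 x + (\<integral> \<tau>. indicator {0..t'} \<tau> * w \<tau> x \<partial>lborel)"
      if "t' \<in> {0..t}" for t'
      by (rule y_eq) (use that t in auto)
  qed (fact y_meas w_meas u0_meas)+
  moreover have "AE t in lborel. t \<in> {0<..<T} \<longrightarrow> gagliardo s p (\<lambda>x. truncation Mu (u t x)) < \<infinity> \<and>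
      (\<forall>\<phi> B. \<phi> \<in> borel_measurable borel \<longrightarrow> (\<forall>x. \<bar>\<phi> x\<bar> \<le> B) \<longrightarrow> (\<forall>x. x \<notin> \<Omega>0 \<longrightarrow> \<phi> x = 0) \<longrightarrow>
        gagliardo s p \<phi> < \<infinity> \<longrightarrow>
        (\<integral> x. w t x * \<phi> x \<partial>lborel) + frac_form s p (\<lambda>x. truncation Mu (u t x)) \<phi>
          = (\<integral> x. lam * truncation Mu (u t x) powr q * \<phi> x \<partial>lborel))"
    using K weak
  proof eventually_elim
    case (elim t)
    show ?case
    proof (rule impI)
      assume tT: "t \<in> {0<..<T}"
      then have t: "t \<in> {0..T}" by auto
      note [measurable] = u_meas[OF t]
      have ae: "AE x in lborel. u t x = truncation Mu (u t x)"
        using Mu[OF t] by eventually_elim (simp add: truncation_eq)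
      have "gagliardo s p (u t) < \<infinity>" using elim(1) tT by (simp add: W0_def)
      then have g: "gagliardo s p (\<lambda>x. truncation Mu (u t x)) < \<infinity>"
        by (subst (asm) gagliardo_cong_AE[OF ae])
      have "(\<integral> x. w t x * \<phi> x \<partial>lborel) + frac_form s p (\<lambda>x. truncation Mu (u t x)) \<phi>
          = (\<integral> x. lam * truncation Mu (u t x) powr q * \<phi> x \<partial>lborel)"
        if [measurable]: "\<phi> \<in> borel_measurable borel" and \<phi>: "\<forall>x. \<bar>\<phi> x\<bar> \<le> B" "\<forall>x. x \<notin> \<Omega>0 \<longrightarrow> \<phi> x = 0"
          "gagliardo s p \<phi> < \<infinity>" for \<phi> B
      proof -
        have "\<phi> \<in> W0 s p \<Omega>" "Linf \<phi>" using bounded_in_W0[OF that(1), of B] \<phi> by blast+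
        then have "(\<integral> x. w t x * \<phi> x \<partial>lborel) + frac_form s p (u t) \<phi>
              = (\<integral> x. (lam * u t x powr q - b x * u t x powr r) * \<phi> x \<partial>lborel)"
          using elim(2) tT by blast
        moreover have "(\<lambda>x. (lam * u t x powr q - b x * u t x powr r) * \<phi> x) = (\<lambda>x. lam * u t x powr q * \<phi> x)"
        proof
          fix x
          show "(lam * u t x powr q - b x * u t x powr r) * \<phi> x = lam * u t x powr q * \<phi> x"
            using \<phi>(2) b_zero by (cases "x \<in> \<Omega>0") auto
        qed
        moreover have "(\<integral> x. lam * u t x powr q * \<phi> x \<partial>lborel) = (\<integral> x. lam * truncation Mu (u t x) powr q * \<phi> x \<partial>lborel)"
        proof (rule integral_cong_AE)
          show "AE x in lborel. lam * u t x powr q * \<phi> x = lam * truncation Mu (u t x) powr q * \<phi> x"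
            using ae
          proof eventually_elim
            case (elim x)
            show ?case by (subst elim) (rule refl)
          qed
        qed measurable
        moreover have "frac_form s p (u t) \<phi> = frac_form s p (\<lambda>x. truncation Mu (u t x)) \<phi>"
          by (rule frac_form_cong_AE[OF _ _ _ _ ae]; (measurable | simp))
        ultimately show ?thesis by simp
      qed
      with g show "gagliardo s p (\<lambda>x. truncation Mu (u t x)) < \<infinity> \<and>
      (\<forall>\<phi> B. \<phi> \<in> borel_measurable borel \<longrightarrow> (\<forall>x. \<bar>\<phi> x\<bar> \<le> B) \<longrightarrow> (\<forall>x. x \<notin> \<Omega>0 \<longrightarrow> \<phi> x = 0) \<longrightarrow>
        gagliardo s p \<phi> < \<infinity> \<longrightarrow>
        (\<integral> x. w t x * \<phi> x \<partial>lborel) + frac_form s p (\<lambda>x. truncation Mu (u t x)) \<phi>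
          = (\<integral> x. lam * truncation Mu (u t x) powr q * \<phi> x \<partial>lborel))"
        by blast
    qed
  qed
  ultimately show ?thesis by (rule that)
qed

end

text \<open>The primitive of the reaction \<open>lam * max 0 (y - e) powr q\<close>, which vanishes
  for \<open>y \<le> e\<close>.\<close>

definition shifted_power :: "real \<Rightarrow> real \<Rightarrow> real \<Rightarrow> real \<Rightarrow> real" where
  "shifted_power lam q e y = lam / (q + 1) * max 0 (y - e) powr (q + 1)"

lemma shifted_power_measurable [measurable]: "shifted_power lam q e \<in> borel_measurable borel"
  unfolding shifted_power_def by measurable

text \<open>The shift makes the one-sided Lipschitz bound hold even when \<open>q < 1\<close>.\<close>
lemma shifted_power_diff_le:
  assumes q: "0 < q" and lam: "0 < lam" and e: "0 < e" and m: "0 \<le> m" "m \<le> v" "v \<le> M"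
  shows "shifted_power lam q e v - shifted_power lam q e m - lam * m powr q * (v - m)
    \<le> lam * M powr q / e * (v - m)\<^sup>2"
proof -
  define v' where "v' = max 0 (v - e)"
  define m' where "m' = max 0 (m - e)"
  have v'm': "0 \<le> v'" "0 \<le> m'" "m' \<le> v'" "v' - m' \<le> v - m" using m by (auto simp: v'_def m'_def)
  have "v' powr (q + 1) + (q + 1) * (v' powr q * (m' - v')) \<le> m' powr (q + 1)"
    using abs_powr_gradient[of "q + 1" v' m'] q v'm' by (simp add: jp_nonneg)
  then have "v' powr (q + 1) - m' powr (q + 1) \<le> (q + 1) * (v' powr q * (v' - m'))"
    by (simp add: algebra_simps)
  also have "\<dots> \<le> (q + 1) * (v' powr q * (v - m))"
    using v'm' q by (intro mult_left_mono) auto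
  finally have "lam / (q + 1) * (v' powr (q + 1) - m' powr (q + 1)) \<le> lam / (q + 1) * ((q + 1) * (v' powr q * (v - m)))"
    using q lam by (intro mult_left_mono) auto
  then have 1: "shifted_power lam q e v - shifted_power lam q e m \<le> lam * (v' powr q * (v - m))"
    using q by (simp add: shifted_power_def v'_def m'_def right_diff_distrib)
  \<comment> \<open>The constant comes from a dichotomy: a gap \<open>v - m\<close> of at least
    \<open>e\<close> pays for the crude bound \<open>M powr q\<close>, while a smaller gap means
    \<open>v - e < m\<close>.\<close>
  have "v' powr q \<le> m powr q + M powr q / e * (v - m)"
  proof (cases "e \<le> v - m")
    case True
    have "v' powr q \<le> M powr q" using m e q by (intro powr_mono2) (auto simp: v'_def)
    also have "\<dots> = M powr q / e * e" using e by simp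
    also have "\<dots> \<le> M powr q / e * (v - m)" using True e by (intro mult_left_mono) auto
    finally show ?thesis by (smt (verit) powr_ge_zero)
  next
    case False
    then have "v' powr q \<le> m powr q" using m q by (intro powr_mono2) (auto simp: v'_def)
    moreover have "0 \<le> M powr q / e * (v - m)" using e m by simp
    ultimately show ?thesis by linarith
  qed
  then have "lam * (v' powr q * (v - m)) \<le> lam * ((m powr q + M powr q / e * (v - m)) * (v - m))"
    using lam m by (intro mult_left_mono mult_right_mono) auto
  also have "\<dots> = lam * m powr q * (v - m) + lam * M powr q / e * (v - m)\<^sup>2"
    by (simp add: power2_eq_square distrib_left distrib_right mult_ac)
  finally show ?thesis using 1 by linarith
qed

lemma shifted_power_mono:
  assumes "0 < q" "0 < lam" shows "mono (shifted_power lam q e)"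
  unfolding shifted_power_def using assms by (intro monoI mult_left_mono powr_mono2) auto

lemma shifted_power_bounds:
  assumes "0 < q" "0 < lam" "0 \<le> y" "y \<le> M" "0 < e"
  shows "0 \<le> shifted_power lam q e y" "shifted_power lam q e y \<le> lam / (q + 1) * y powr (q + 1)"
    "shifted_power lam q e y \<le> lam / (q + 1) * M powr (q + 1)"
proof -
  show "0 \<le> shifted_power lam q e y" using assms by (simp add: shifted_power_def)
  show "shifted_power lam q e y \<le> lam / (q + 1) * y powr (q + 1)"
    unfolding shifted_power_def using assms by (intro mult_left_mono powr_mono2) auto
  show "shifted_power lam q e y \<le> lam / (q + 1) * M powr (q + 1)"
    unfolding shifted_power_def using assms by (intro mult_left_mono powr_mono2) auto
qed

lemma time_primitive_diff:
  assumes "time_primitive t u w u0" and [measurable]: "v \<in> borel_measurable borel"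
  shows "time_primitive t (\<lambda>\<tau> x. v x - u \<tau> x) (\<lambda>\<tau> x. - w \<tau> x) (\<lambda>x. v x - u0 x)"
proof -
  interpret time_primitive t u w u0 by fact
  show ?thesis
  proof
    fix \<tau> assume "\<tau> \<in> {0..t}"
    from y_eq[OF this] show "AE x in lborel. v x - u \<tau> x =
        v x - u0 x + (\<integral> \<sigma>. indicator {0..\<tau>} \<sigma> * - w \<sigma> x \<partial>lborel)"
      by eventually_elim simp
  qed (use T_nonneg w_L2 in simp_all)
qed

context weak_solution_on
begin

lemma initial_value: "AE x in lborel. u 0 x = u0 x"
proof -
  obtain Mu where "0 \<le> Mu" "\<And>t. t \<in> {0..T} \<Longrightarrow> AE x in lborel. u t x \<in> {0..Mu}" using u_bounds by blast
  then obtain w where "\<And>t. t \<in> {0..T} \<Longrightarrow> time_primitive t u w u0" using time_derivative by blast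
  then interpret time_primitive 0 u w u0 using T_pos by simp
  have "AE x in lborel. u 0 x = u0 x + (\<integral> \<tau>. indicator {0..0} \<tau> * w \<tau> x \<partial>lborel)"
    by (rule y_eq) simp
  moreover have "(\<integral> \<tau>. indicator {0..0} \<tau> * w \<tau> x \<partial>lborel) = 0" for x
    by (rule integral_eq_zero_AE) (use AE_lborel_singleton[of 0] in \<open>auto elim!: eventually_mono\<close>)
  ultimately show ?thesis by simp
qed

text \<open>Half the squared positive part of \<open>v - u\<close>, integrated over
  \<open>\<Omega>0\<close>, vanishes initially. Its growth rate comes from testing with the positive
  part itself: the form is absorbed by minimality, and the remaining potential and reaction terms
  are quadratic by \<open>shifted_power_diff_le\<close>.\<close>

lemma comparison:
  fixes v :: "'a \<Rightarrow> real"
  assumes [measurable]: "v \<in> borel_measurable borel" and v: "\<And>x. 0 \<le> v x" "\<And>x. v x \<le> M"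
    and supp: "\<And>x. x \<notin> \<Omega>0 \<Longrightarrow> v x = 0" and gag: "gagliardo s p v < \<infinity>"
    and init: "AE x in lborel. v x \<le> u0 x" and e: "0 < e"
    and minimal: "\<And>z. z \<in> borel_measurable borel \<Longrightarrow> (\<And>x. 0 \<le> z x \<and> z x \<le> v x) \<Longrightarrow> gagliardo s p z < \<infinity> \<Longrightarrow>
      gag_energy s p (shifted_power lam q e) v \<le> gag_energy s p (shifted_power lam q e) z"
    and t: "t \<in> {0..T}"
  shows "AE x in lborel. v x \<le> u t x"
proof -
  obtain Mu where Mu: "0 \<le> Mu" "\<And>t. t \<in> {0..T} \<Longrightarrow> AE x in lborel. u t x \<in> {0..Mu}" using u_bounds by blast
  then obtain w where tp: "\<And>t. t \<in> {0..T} \<Longrightarrow> time_primitive t u w u0"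
    and weak: "AE t in lborel. t \<in> {0<..<T} \<longrightarrow> gagliardo s p (\<lambda>x. truncation Mu (u t x)) < \<infinity> \<and>
      (\<forall>\<phi> B. \<phi> \<in> borel_measurable borel \<longrightarrow> (\<forall>x. \<bar>\<phi> x\<bar> \<le> B) \<longrightarrow> (\<forall>x. x \<notin> \<Omega>0 \<longrightarrow> \<phi> x = 0) \<longrightarrow>
        gagliardo s p \<phi> < \<infinity> \<longrightarrow>
        (\<integral> x. w t x * \<phi> x \<partial>lborel) + frac_form s p (\<lambda>x. truncation Mu (u t x)) \<phi>
          = (\<integral> x. lam * truncation Mu (u t x) powr q * \<phi> x \<partial>lborel))"
    using time_derivative[OF Mu] by blast
  have M: "0 \<le> M" using v order_trans by blast
  have bdd0: "bounded \<Omega>0" using \<Omega>(1) \<Omega>0(1) bounded_subset by blast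
  define L where "L = lam * M powr q / e"
  have L: "0 \<le> L" using lam e by (simp add: L_def)
  \<comment> \<open>The derivative of \<open>H\<close> is \<open>max 0\<close>, which is Lipschitz,
    so the chain rule applies with constant 1.\<close>
  define H where "H y = (max 0 y)\<^sup>2 / 2" for y :: real
  define Y where "Y t = (\<integral> x. indicator \<Omega>0 x * H (v x - u t x) \<partial>lborel)" for t
  define Z where "Z t = (\<integral> x. indicator \<Omega>0 x * (max 0 (v x - u t x) * - w t x) \<partial>lborel)" for t
  have H_meas [measurable]: "H \<in> borel_measurable borel" unfolding H_def by measurable
  have [measurable]: "\<Omega>0 \<in> sets borel" by (rule \<Omega>0(2))
  have ind: "integrable lborel (indicator \<Omega>0 :: 'a \<Rightarrow> real)"
    using emeasure_bounded_finite[OF bdd0] by (intro integrable_real_indicator) auto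
  have chain: "integrable lborel (\<lambda>\<tau>. indicator {0<..t} \<tau> * Z \<tau>) \<and>
      Y t - Y 0 = (\<integral> \<tau>. indicator {0<..t} \<tau> * Z \<tau> \<partial>lborel)" if t: "t \<in> {0..T}" for t
  proof -
    interpret time_primitive t "\<lambda>\<tau> x. v x - u \<tau> x" "\<lambda>\<tau> x. - w \<tau> x" "\<lambda>x. v x - u0 x"
      by (rule time_primitive_diff[OF tp[OF t]]) measurable
    have S: "AE x in lborel. v x - u \<tau> x \<in> {- Mu..M}" if "\<tau> \<in> {0..t}" for \<tau>
    proof -
      have "\<tau> \<in> {0..T}" using that t by auto
      from Mu(2)[OF this] show ?thesis
      proof eventually_elim
        case (elim x)
        then show ?case using v[of x] by auto
      qed
    qed
    have q1: "\<bar>H b - H a - max 0 a * (b - a)\<bar> \<le> 1 * (b - a)\<^sup>2" for a b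
    proof -
      consider "0 \<le> a" "0 \<le> b" | "0 \<le> a" "b < 0" | "a < 0" "0 \<le> b" | "a < 0" "b < 0" by linarith
      then show ?thesis
      proof cases
        case 1
        then have "H b - H a - max 0 a * (b - a) = (b - a)\<^sup>2 / 2"
          by (simp add: H_def power2_eq_square field_simps)
        then show ?thesis using zero_le_power2[of "b - a"] unfolding abs_le_iff by linarith
      next
        case 2
        then have "H b - H a - max 0 a * (b - a) = a\<^sup>2 / 2 - a * b"
          by (simp add: H_def power2_eq_square field_simps)
        moreover have "a * b \<le> 0" using 2 by (simp add: mult_nonneg_nonpos)
        moreover have "(b - a)\<^sup>2 = a\<^sup>2 - 2 * (a * b) + b\<^sup>2" by (simp add: power2_eq_square algebra_simps)
        ultimately show ?thesis using zero_le_power2[of a] zero_le_power2[of b] unfolding abs_le_iff by linarith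
      next
        case 3
        then have "H b - H a - max 0 a * (b - a) = b\<^sup>2 / 2" by (simp add: H_def)
        moreover have "a * b \<le> 0" using 3 by (simp add: mult_nonpos_nonneg)
        moreover have "(b - a)\<^sup>2 = a\<^sup>2 - 2 * (a * b) + b\<^sup>2" by (simp add: power2_eq_square algebra_simps)
        ultimately show ?thesis using zero_le_power2[of a] zero_le_power2[of b] unfolding abs_le_iff by linarith
      next
        case 4
        then show ?thesis by (simp add: H_def)
      qed
    qed
    \<comment> \<open>On the range of \<open>v - u\<close> the function \<open>H\<close> is at most
      half of \<open>M\<^sup>2\<close> and its derivative at most \<open>M\<close>; the last bound
      covers both.\<close>
    note wcr = weighted_chain_rule[of H "max 0" "{-Mu..M}" "indicator \<Omega>0" 1 1 "M\<^sup>2 + M"]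
    have HB: "\<bar>H a\<bar> \<le> M\<^sup>2 + M" "\<bar>max 0 a\<bar> \<le> M\<^sup>2 + M" if "a \<in> {-Mu..M}" for a
    proof -
      have "(max 0 a)\<^sup>2 \<le> M\<^sup>2" using that M by (intro power_mono) auto
      then show "\<bar>H a\<bar> \<le> M\<^sup>2 + M" using M zero_le_power2[of "max 0 a"] unfolding H_def by linarith
      show "\<bar>max 0 a\<bar> \<le> M\<^sup>2 + M" using that M by (auto simp: max_def intro: add_increasing)
    qed
    have "integrable lborel (\<lambda>\<tau>. indicator {0<..t} \<tau> *
        (\<integral> x. indicator \<Omega>0 x * (max 0 (v x - u \<tau> x) * - w \<tau> x) \<partial>lborel))"
      by (rule wcr(1)[OF _ _ _ ind _ S _ q1 _ HB]; (measurable | simp add: max_def))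
    moreover have "(\<integral> x. indicator \<Omega>0 x * H (v x - u t x) \<partial>lborel) - (\<integral> x. indicator \<Omega>0 x * H (v x - u 0 x) \<partial>lborel)
      = (\<integral> \<tau>. indicator {0<..t} \<tau> * (\<integral> x. indicator \<Omega>0 x * (max 0 (v x - u \<tau> x) * - w \<tau> x) \<partial>lborel) \<partial>lborel)"
      by (rule wcr(2)[OF _ _ _ ind _ S _ q1 _ HB]; (measurable | simp add: max_def))
    ultimately show ?thesis unfolding Y_def Z_def by blast
  qed
  have Y_int: "integrable lborel (\<lambda>x. indicator \<Omega>0 x * H (v x - u t x))"
    and Y_bd: "Y t \<le> (\<integral> x. M\<^sup>2 * indicator \<Omega>0 x \<partial>lborel)" if t: "t \<in> {0..T}" for t
  proof -
    note [measurable] = u_meas[OF t]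
    have ae: "AE x in lborel. norm (indicator \<Omega>0 x * H (v x - u t x)) \<le> M\<^sup>2 * indicator \<Omega>0 x"
      using Mu(2)[OF t]
    proof eventually_elim
      case (elim x)
      then have "(max 0 (v x - u t x))\<^sup>2 \<le> M\<^sup>2" using v[of x] M by (intro power_mono) auto
      then have "H (v x - u t x) \<le> M\<^sup>2" "0 \<le> H (v x - u t x)"
        using zero_le_power2[of M] zero_le_power2[of "max 0 (v x - u t x)"] unfolding H_def by linarith+
      then show ?case by (simp add: indicator_def)
    qed
    show int: "integrable lborel (\<lambda>x. indicator \<Omega>0 x * H (v x - u t x))"
    proof (rule Bochner_Integration.integrable_bound[OF integrable_mult_right[OF ind, of "M\<^sup>2"]])
      show "AE x in lborel. norm (indicator \<Omega>0 x * H (v x - u t x)) \<le> norm (M\<^sup>2 * indicator \<Omega>0 x)"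
        using ae by eventually_elim simp
    qed measurable
    show "Y t \<le> (\<integral> x. M\<^sup>2 * indicator \<Omega>0 x \<partial>lborel)"
      unfolding Y_def
    proof (rule integral_mono_AE[OF int integrable_mult_right[OF ind]])
      show "AE x in lborel. indicator \<Omega>0 x * H (v x - u t x) \<le> M\<^sup>2 * indicator \<Omega>0 x"
        using ae by eventually_elim simp
    qed
  qed
  have Y_nonneg: "0 \<le> Y t" for t
    unfolding Y_def H_def by (rule Bochner_Integration.integral_nonneg) auto
  have Y0: "Y 0 = 0"
    unfolding Y_def
  proof (rule integral_eq_zero_AE)
    show "AE x in lborel. indicator \<Omega>0 x * H (v x - u 0 x) = 0"
      using initial_value init by eventually_elim (simp add: H_def)
  qed
  have ZY: "AE \<tau> in lborel. \<tau> \<in> {0<..<T} \<longrightarrow> Z \<tau> \<le> (2 * L) * Y \<tau>"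
    using weak
  proof eventually_elim
    case (elim \<tau>)
    show ?case
    proof
      assume \<tau>T: "\<tau> \<in> {0<..<T}"
      then have \<tau>: "\<tau> \<in> {0..T}" by auto
      note [measurable] = u_meas[OF \<tau>]
      define U where "U x = truncation Mu (u \<tau> x)" for x
      define \<phi> where "\<phi> x = max 0 (v x - U x)" for x
      define m where "m x = min (v x) (U x)" for x
      have [measurable]: "U \<in> borel_measurable borel" "\<phi> \<in> borel_measurable borel" "m \<in> borel_measurable borel"
        unfolding U_def \<phi>_def m_def by measurable
      have U: "0 \<le> U x" "U x \<le> Mu" for x using Mu(1) by (auto simp: U_def truncation_bounds)
      have gU: "gagliardo s p U < \<infinity>" using elim \<tau>T by (simp add: U_def[abs_def])
      have fin: "gagliardo s p m < \<infinity>" "gagliardo s p \<phi> < \<infinity>"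
        using gagliardo_min_finite[of U v s p] gU gag p by (auto simp: m_def[abs_def] \<phi>_def[abs_def])
      have \<phi>: "\<bar>\<phi> x\<bar> \<le> M" for x using v[of x] U[of x] M by (auto simp: \<phi>_def)
      have \<phi>0: "\<phi> x = 0" if "x \<notin> \<Omega>0" for x using supp[OF that] U[of x] by (simp add: \<phi>_def)
      have m: "0 \<le> m x" "m x \<le> v x" for x using v[of x] U[of x] by (auto simp: m_def)
      have m0: "m x = 0" if "x \<notin> \<Omega>0" for x using supp[OF that] m[of x] by simp
      let ?F = "shifted_power lam q e"
      have F0: "?F 0 = 0" using e q by (simp add: shifted_power_def)
      have intF: "integrable lborel (\<lambda>x. ?F (z x))"
        if [measurable]: "z \<in> borel_measurable borel" and z: "\<And>x. 0 \<le> z x" "\<And>x. z x \<le> v x" for z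
      proof (rule integrable_bounded_support[OF bdd0 \<Omega>0(2), where B="lam / (q + 1) * M powr (q + 1)"])
        show "\<bar>?F (z x)\<bar> \<le> lam / (q + 1) * M powr (q + 1)" for x
          using shifted_power_bounds(1,3)[OF q lam z(1) order_trans[OF z(2) v(2)] e] by (simp add: abs_of_nonneg)
        show "?F (z x) = 0" if "x \<notin> \<Omega>0" for x
          using z(1)[of x] z(2)[of x] supp[OF that] F0 by simp
      qed measurable
      have intF: "integrable lborel (\<lambda>x. ?F (v x))" "integrable lborel (\<lambda>x. ?F (m x))"
        by (rule intF; use v m in simp)+
      have intU: "integrable lborel (\<lambda>x. lam * U x powr q * \<phi> x)"
      proof (rule integrable_bounded_support[OF bdd0 \<Omega>0(2), where B="lam * Mu powr q * M"])
        show "\<bar>lam * U x powr q * \<phi> x\<bar> \<le> lam * Mu powr q * M" for x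
          unfolding abs_mult using U[of x] \<phi>[of x] lam q by (intro mult_mono) (auto intro!: powr_mono2)
      qed (use \<phi>0 in auto)
      have int\<phi>: "integrable lborel (\<lambda>x. L * (\<phi> x)\<^sup>2)"
      proof (rule integrable_bounded_support[OF bdd0 \<Omega>0(2), where B="L * M\<^sup>2"])
        show "\<bar>L * (\<phi> x)\<^sup>2\<bar> \<le> L * M\<^sup>2" for x
          using \<phi>[of x] L power_mono[OF \<phi>[of x], of 2] by (simp add: mult_left_mono)
      qed (use \<phi>0 in auto)
      have ae: "AE x in lborel. U x = u \<tau> x"
        using Mu(2)[OF \<tau>] by eventually_elim (simp add: U_def truncation_eq)
      have "\<phi> \<in> borel_measurable borel" by measurable
      then have eq: "(\<integral> x. w \<tau> x * \<phi> x \<partial>lborel) + frac_form s p U \<phi> = (\<integral> x. lam * U x powr q * \<phi> x \<partial>lborel)"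
        using elim \<tau>T \<phi> \<phi>0 fin(2) unfolding U_def[symmetric] by blast
      have "Z \<tau> = (\<integral> x. - (w \<tau> x * \<phi> x) \<partial>lborel)"
        unfolding Z_def
      proof (rule integral_cong_AE)
        show "AE x in lborel. indicator \<Omega>0 x * (max 0 (v x - u \<tau> x) * - w \<tau> x) = - (w \<tau> x * \<phi> x)"
          using ae
        proof eventually_elim
          case (elim x)
          show ?case using \<phi>0[of x] elim by (cases "x \<in> \<Omega>0") (auto simp: \<phi>_def)
        qed
        interpret time_primitive \<tau> u w u0 by (rule tp[OF \<tau>])
        show "(\<lambda>x. indicator \<Omega>0 x * (max 0 (v x - u \<tau> x) * - w \<tau> x)) \<in> borel_measurable lborel"
          "(\<lambda>x. - (w \<tau> x * \<phi> x)) \<in> borel_measurable lborel" by measurable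
      qed
      also have "\<dots> = frac_form s p U \<phi> - (\<integral> x. lam * U x powr q * \<phi> x \<partial>lborel)"
        using eq by simp
      \<comment> \<open>The form is at most the difference of the seminorm terms of \<open>v\<close>
        and \<open>m\<close> in the energy. Minimality of \<open>v\<close> against the competitor
        \<open>m\<close> exchanges it for the difference of the potentials.\<close>
      also have "\<dots> \<le> (\<integral> x. ?F (v x) \<partial>lborel) - (\<integral> x. ?F (m x) \<partial>lborel) - (\<integral> x. lam * U x powr q * \<phi> x \<partial>lborel)"
      proof -
        have "p * frac_form s p U \<phi> + enn2real (gagliardo s p m) \<le> enn2real (gagliardo s p v)"
          unfolding \<phi>_def[abs_def] m_def[abs_def] by (rule frac_form_max_diff_le[OF p _ _ gU gag]) measurable
        then have "frac_form s p U \<phi> \<le> enn2real (gagliardo s p v) / p - enn2real (gagliardo s p m) / p"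
          using p by (simp add: field_simps)
        moreover have "gag_energy s p ?F v \<le> gag_energy s p ?F m"
          by (rule minimal) (use m fin in auto)
        ultimately show ?thesis unfolding gag_energy_def by linarith
      qed
      also have "\<dots> = (\<integral> x. ?F (v x) - ?F (m x) - lam * U x powr q * \<phi> x \<partial>lborel)"
        using intF intU by simp
      also have "\<dots> \<le> (\<integral> x. L * (\<phi> x)\<^sup>2 \<partial>lborel)"
      proof (rule integral_mono)
        show "integrable lborel (\<lambda>x. ?F (v x) - ?F (m x) - lam * U x powr q * \<phi> x)"
          using intF intU by simp
        show "?F (v x) - ?F (m x) - lam * U x powr q * \<phi> x \<le> L * (\<phi> x)\<^sup>2" for x
        proof (cases "v x \<le> U x")
          case True
          then have "\<phi> x = 0" "m x = v x" by (auto simp: \<phi>_def m_def)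
          then show ?thesis by simp
        next
          case False
          then have "\<phi> x = v x - U x" "m x = U x" by (auto simp: \<phi>_def m_def)
          then show ?thesis
            using shifted_power_diff_le[OF q lam e, of "U x" "v x" M] False U(1)[of x] v(2)[of x] by (simp add: L_def)
        qed
      qed (rule int\<phi>)
      also have "\<dots> = (\<integral> x. (2 * L) * (indicator \<Omega>0 x * H (v x - u \<tau> x)) \<partial>lborel)"
      proof (rule integral_cong_AE)
        show "AE x in lborel. L * (\<phi> x)\<^sup>2 = 2 * L * (indicator \<Omega>0 x * H (v x - u \<tau> x))"
          using ae
        proof eventually_elim
          case (elim x)
          show ?case using \<phi>0[of x] elim by (cases "x \<in> \<Omega>0") (auto simp: \<phi>_def H_def)
        qed
      qed measurable
      also have "\<dots> = (2 * L) * Y \<tau>" by (simp add: Y_def)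
      finally show "Z \<tau> \<le> (2 * L) * Y \<tau>" .
    qed
  qed
  have "Y t = 0"
  proof (rule gronwall_zero[where Y=Y and Z=Z and T=T and L="2 * L"])
    show "Y t \<le> (\<integral> x. M\<^sup>2 * indicator \<Omega>0 x \<partial>lborel)" if "t \<in> {0..T}" for t by (rule Y_bd[OF that])
    show "Y t \<le> (\<integral> \<tau>. indicator {0<..t} \<tau> * Z \<tau> \<partial>lborel)" if "t \<in> {0..T}" for t
      using chain[OF that] Y0 by simp
    show "integrable lborel (\<lambda>\<tau>. indicator {0<..t} \<tau> * Z \<tau>)" if "t \<in> {0..T}" for t
      using chain[OF that] by blast
  qed (rule Y_nonneg ZY t | use L in simp)+
  then have "AE x in lborel. indicator \<Omega>0 x * H (v x - u t x) = 0"
    unfolding Y_def by (subst (asm) integral_nonneg_eq_0_iff_AE[OF Y_int[OF t]]) (auto simp: H_def)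
  then show ?thesis
    using Mu(2)[OF t]
  proof eventually_elim
    case (elim x)
    then show ?case using supp[of x] by (cases "x \<in> \<Omega>0") (auto simp: H_def max_def split: if_splits)
  qed
qed

end

section \<open>Growth by Picone testing\<close>

text \<open>Picone's inequality only needs the derivative of \<open>slope\<close> to be at least 1. The exponent
  \<open>q / (p - 1)\<close> is the one for which \<open>weight a\<close> decays like \<open>a powr (- q)\<close>: this is slow enough
  for \<open>a powr q * weight a\<close> to be monotone, and integrable at infinity as soon as \<open>q > 1\<close>.\<close>
locale barrier =
  fixes e p q :: real
  assumes e: "0 < e" and p: "1 < p" and q: "p - 1 < q"
begin

text \<open>The second summand keeps \<open>slope\<close> at least \<open>e\<close>, so
  \<open>weight\<close> is bounded even where \<open>u\<close> vanishes. As \<open>e\<close> tends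
  to 0, \<open>weight a\<close> tends to the classical Picone factor \<open>a powr (1 - p)\<close>
  for positive \<open>a\<close>.\<close>

definition slope :: "real \<Rightarrow> real" where
  "slope a = a + e * (1 + a) powr (q / (p - 1))"

definition weight :: "real \<Rightarrow> real" where
  "weight a = slope a powr (1 - p)"

definition primitive :: "real \<Rightarrow> real" where
  "primitive a = integral {0..a} weight"

lemma exponent: "1 < q / (p - 1)"
  using p q by simp

lemma slope_ge: "0 \<le> a \<Longrightarrow> e * (1 + a) powr (q / (p - 1)) \<le> slope a" "0 \<le> a \<Longrightarrow> e \<le> slope a"
proof -
  assume a: "0 \<le> a"
  show 1: "e * (1 + a) powr (q / (p - 1)) \<le> slope a" using a by (simp add: slope_def)
  have "1 powr (q / (p - 1)) \<le> (1 + a) powr (q / (p - 1))"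
    using a exponent by (intro powr_mono2) auto
  then have "e * 1 \<le> e * (1 + a) powr (q / (p - 1))" using e by (intro mult_left_mono) auto
  with 1 show "e \<le> slope a" by simp
qed

lemma slope_pos: "0 \<le> a \<Longrightarrow> 0 < slope a"
  using slope_ge(2) e by fastforce

lemma slope_diff:
  assumes "0 \<le> a" "a \<le> b" shows "b - a \<le> slope b - slope a"
proof -
  have "e * (1 + a) powr (q / (p - 1)) \<le> e * (1 + b) powr (q / (p - 1))"
    using assms e exponent by (intro mult_left_mono powr_mono2) auto
  then show ?thesis by (simp add: slope_def)
qed

lemma weight_nonneg: "0 \<le> weight a"
  by (simp add: weight_def)

lemma weight_le: "0 \<le> a \<Longrightarrow> weight a \<le> e powr (1 - p)"
  unfolding weight_def using slope_ge(2) e p by (intro powr_mono2') auto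

lemma weight_measurable [measurable]: "weight \<in> borel_measurable borel"
  unfolding weight_def slope_def by measurable

lemma weight_derivative:
  assumes "0 \<le> a"
  shows "(weight has_real_derivative
    (1 - p) * slope a powr (1 - p - 1) * (1 + e * (q / (p - 1) * (1 + a) powr (q / (p - 1) - 1)))) (at a)"
proof -
  have "(slope has_real_derivative 1 + e * (q / (p - 1) * (1 + a) powr (q / (p - 1) - 1))) (at a)"
    unfolding slope_def[abs_def] using assms
    by (auto intro!: derivative_eq_intros simp: powr_diff)
  from DERIV_fun_powr[OF this slope_pos[OF assms], of "1 - p"] show ?thesis
    unfolding weight_def[abs_def] by simp
qed

lemma slope_continuous: "continuous_on {0..} slope"
  unfolding slope_def[abs_def] by (intro continuous_intros) auto

lemma weight_continuous: "continuous_on {0..} weight"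
  unfolding weight_def[abs_def] using slope_pos
  by (intro continuous_intros slope_continuous) force

lemma weight_Lipschitz:
  obtains C where "0 \<le> C" "\<And>a b. a \<in> {0..R} \<Longrightarrow> b \<in> {0..R} \<Longrightarrow> \<bar>weight b - weight a\<bar> \<le> C * \<bar>b - a\<bar>"
proof -
  let ?d = "\<lambda>a. (1 - p) * slope a powr (1 - p - 1) * (1 + e * (q / (p - 1) * (1 + a) powr (q / (p - 1) - 1)))"
  have "continuous_on {0..R} slope" by (rule continuous_on_subset[OF slope_continuous]) auto
  then have "continuous_on {0..R} ?d"
    using slope_pos by (intro continuous_intros) force+
  then have "bounded (?d ` {0..R})"
    by (intro compact_imp_bounded compact_continuous_image) auto
  then obtain C where C: "0 < C" "\<And>a. a \<in> {0..R} \<Longrightarrow> \<bar>?d a\<bar> \<le> C"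
    by (auto simp: bounded_pos)
  have "\<bar>weight b - weight a\<bar> \<le> C * \<bar>b - a\<bar>" if "a \<in> {0..R}" "b \<in> {0..R}" for a b
    using field_differentiable_bound[of "{0..R}" weight ?d C b a] C(2) that weight_derivative
    by (auto intro: has_field_derivative_at_within)
  then show ?thesis using C(1) by (intro that[of C]) auto
qed

lemma weight_integrable: "weight integrable_on {0..a}"
  by (intro integrable_continuous_interval continuous_on_subset[OF weight_continuous]) auto

lemma primitive_nonneg: "0 \<le> primitive a"
  unfolding primitive_def by (rule Henstock_Kurzweil_Integration.integral_nonneg[OF weight_integrable weight_nonneg])

lemma primitive_mono: "mono primitive"
proof (rule monoI)
  fix a b :: real assume "a \<le> b"
  then show "primitive a \<le> primitive b"
    unfolding primitive_def by (intro integral_subset_le weight_integrable) (auto simp: weight_nonneg)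
qed

lemma primitive_measurable [measurable]: "primitive \<in> borel_measurable borel"
  by (rule borel_measurable_mono[OF primitive_mono])

lemma primitive_le_linear:
  assumes "0 \<le> a" shows "primitive a \<le> e powr (1 - p) * a"
proof -
  have "primitive a \<le> integral {0..a} (\<lambda>_. e powr (1 - p))"
    unfolding primitive_def using weight_le by (intro integral_le weight_integrable) auto
  then show ?thesis using assms by (simp add: mult.commute)
qed

lemma primitive_bounded:
  assumes a: "0 \<le> a" and q1: "1 < q"
  shows "primitive a \<le> e powr (1 - p) / (q - 1)"
proof -
  \<comment> \<open>An antiderivative of the majorant
    \<open>e powr (1 - p) * (1 + x) powr (- q)\<close>, obtained by dropping the linear summand of
    \<open>slope\<close>. It stays negative, so minus its value at 0 bounds the integral for every
    \<open>a\<close>.\<close>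
  let ?g = "\<lambda>x. - (e powr (1 - p)) / (q - 1) * (1 + x) powr (1 - q)"
  have g_int: "((\<lambda>x. e powr (1 - p) * (1 + x) powr (- q)) has_integral (?g a - ?g 0)) {0..a}"
  proof (rule fundamental_theorem_of_calculus[OF a])
    fix x assume "x \<in> {0..a}"
    then have "((\<lambda>x. (1 + x) powr (1 - q)) has_real_derivative (1 - q) * (1 + x) powr (1 - q - of_nat 1) * 1) (at x)"
      by (intro DERIV_fun_powr) (auto intro!: derivative_eq_intros)
    from DERIV_cmult[OF this, of "- (e powr (1 - p)) / (q - 1)"]
    have "(?g has_real_derivative - (e powr (1 - p)) / (q - 1) * ((1 - q) * (1 + x) powr (- q))) (at x)"
      by simp
    moreover have "- A / (q - 1) * ((1 - q) * B) = A * B" for A B :: real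
      using q1 by (simp add: field_simps)
    ultimately have "(?g has_real_derivative e powr (1 - p) * (1 + x) powr (- q)) (at x)"
      by (rule DERIV_cong)
    then show "(?g has_vector_derivative e powr (1 - p) * (1 + x) powr (- q)) (at x within {0..a})"
      unfolding has_real_derivative_iff_has_vector_derivative[symmetric]
      by (rule has_field_derivative_at_within)
  qed
  have w_int: "(weight has_integral primitive a) {0..a}"
    unfolding primitive_def by (rule integrable_integral[OF weight_integrable])
  have le: "weight x \<le> e powr (1 - p) * (1 + x) powr (- q)" if "x \<in> {0..a}" for x
  proof -
    have x: "0 \<le> x" using that by simp
    have "weight x \<le> (e * (1 + x) powr (q / (p - 1))) powr (1 - p)"
      unfolding weight_def using slope_ge(1)[OF x] x e p by (intro powr_mono2') auto
    also have "\<dots> = e powr (1 - p) * (1 + x) powr (q / (p - 1) * (1 - p))"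
      using e x by (simp add: powr_mult powr_powr)
    also have "q / (p - 1) * (1 - p) = - q" using p by (simp add: field_simps)
    finally show ?thesis .
  qed
  have "primitive a \<le> ?g a - ?g 0" by (rule has_integral_le[OF w_int g_int le])
  moreover have "0 \<le> e powr (1 - p) / (q - 1) * (1 + a) powr (1 - q)" using q1 by simp
  ultimately show ?thesis by simp
qed

text \<open>The mean value bound is applied to \<open>primitive x - weight a * x\<close> on the
  segment between \<open>a\<close> and \<open>b\<close> only; there the derivative is at most
  \<open>C * \<bar>b - a\<bar>\<close>, which produces the square.\<close>

lemma primitive_Taylor:
  assumes C: "\<And>a b. a \<in> {0..R} \<Longrightarrow> b \<in> {0..R} \<Longrightarrow> \<bar>weight b - weight a\<bar> \<le> C * \<bar>b - a\<bar>" "0 \<le> C"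
    and a: "a \<in> {0..R}" and b: "b \<in> {0..R}"
  shows "\<bar>primitive b - primitive a - weight a * (b - a)\<bar> \<le> C * (b - a)\<^sup>2"
proof -
  let ?k = "\<lambda>x. primitive x - weight a * x"
  have sub: "closed_segment a b \<subseteq> {0..R}"
    using a b by (auto simp: closed_segment_eq_real_ivl split: if_splits)
  have "norm (?k b - ?k a) \<le> (C * \<bar>b - a\<bar>) * norm (b - a)"
  proof (rule field_differentiable_bound[of "closed_segment a b"])
    fix x assume x: "x \<in> closed_segment a b"
    have "((\<lambda>x. integral {0..x} weight) has_real_derivative weight x) (at x within {0..R})"
      by (rule integral_has_real_derivative)
        (use x sub in \<open>auto intro: continuous_on_subset[OF weight_continuous]\<close>)
    then have "(primitive has_real_derivative weight x) (at x within closed_segment a b)"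
      unfolding primitive_def[abs_def] by (rule has_field_derivative_subset[OF _ sub])
    then show "(?k has_real_derivative (weight x - weight a)) (at x within closed_segment a b)"
      by (auto intro!: derivative_eq_intros)
    have "\<bar>weight x - weight a\<bar> \<le> C * \<bar>x - a\<bar>" using C(1)[OF a] x sub by blast
    also have "\<bar>x - a\<bar> \<le> \<bar>b - a\<bar>" using x by (auto simp: closed_segment_eq_real_ivl split: if_splits)
    finally show "norm (weight x - weight a) \<le> C * \<bar>b - a\<bar>"
      using C(2) by (simp add: mult_left_mono)
  qed auto
  then show ?thesis by (simp add: power2_eq_square algebra_simps)
qed

text \<open>With \<open>al = q / (p - 1)\<close> the quantity is the power \<open>p - 1\<close> of
  \<open>a powr al / slope a\<close>. The reciprocal of this quotient is
  \<open>a powr (1 - al)\<close> plus \<open>e\<close> times the power \<open>al\<close> of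
  \<open>(1 + a) / a\<close>, and both terms decrease because \<open>1 < al\<close>. In
  \<open>growth\<close> this replaces \<open>u\<close> by the smaller \<open>v\<close> in the source
  term.\<close>

lemma powr_weight_mono:
  assumes a: "0 \<le> a" and ab: "a \<le> b"
  shows "a powr q * weight a \<le> b powr q * weight b"
proof (cases "a = 0")
  case True then show ?thesis by (simp add: weight_nonneg)
next
  case False
  with a ab have a: "0 < a" and b: "0 < b" by auto
  define al where "al = q / (p - 1)"
  have al: "1 < al" using exponent by (simp add: al_def)
  have eq: "x powr q * weight x = (x powr al / slope x) powr (p - 1)" if "0 < x" for x
  proof -
    have "(x powr al / slope x) powr (p - 1) = x powr (al * (p - 1)) / slope x powr (p - 1)"
      using that slope_pos[of x] by (simp add: powr_divide powr_powr)
    also have "al * (p - 1) = q" using p by (simp add: al_def)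
    also have "x powr q / slope x powr (p - 1) = x powr q * weight x"
      using powr_minus_divide[of "slope x" "p - 1"] by (simp add: weight_def)
    finally show ?thesis ..
  qed
  have 1: "a powr al * b \<le> b powr al * a"
  proof -
    have "a powr (al - 1) \<le> b powr (al - 1)" using a ab al by (intro powr_mono2) auto
    then have "a powr (al - 1) * (a * b) \<le> b powr (al - 1) * (a * b)" using a b by (intro mult_right_mono) auto
    moreover have "x powr al = x powr (al - 1) * x" if "0 < x" for x
      using that by (simp add: powr_diff)
    ultimately show ?thesis using a b by (simp add: mult_ac)
  qed
  have "(a * (1 + b)) powr al \<le> (b * (1 + a)) powr al"
    using a b ab al by (intro powr_mono2) (auto simp: algebra_simps)
  then have 2: "e * (a powr al * (1 + b) powr al) \<le> e * (b powr al * (1 + a) powr al)"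
    using a b e by (simp add: powr_mult)
  have "a powr al * slope b \<le> b powr al * slope a"
    using 1 2 by (simp add: slope_def al_def algebra_simps)
  then have "a powr al / slope a \<le> b powr al / slope b"
    using a b slope_pos[of a] slope_pos[of b] by (simp add: divide_simps mult.commute)
  then show ?thesis unfolding eq[OF a] eq[OF b] using p a slope_pos[of a] by (intro powr_mono2) auto
qed

end

lemma powr_Lipschitz:
  fixes a b p M :: real
  assumes p: "1 < p" and "a \<in> {0..M}" "b \<in> {0..M}"
  shows "\<bar>a powr p - b powr p\<bar> \<le> p * M powr (p - 1) * \<bar>a - b\<bar>"
proof -
  have *: "b powr p - a powr p \<le> p * M powr (p - 1) * (b - a)" if "0 \<le> a" "a \<le> b" "b \<le> M" for a b
  proof -
    have "b powr p + p * (b powr (p - 1) * (a - b)) \<le> a powr p"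
      using abs_powr_gradient[OF p, of b a] that by (simp add: jp_nonneg)
    moreover have "b powr (p - 1) * (b - a) \<le> M powr (p - 1) * (b - a)"
      using that p by (intro mult_right_mono powr_mono2) auto
    then have "p * (b powr (p - 1) * (b - a)) \<le> p * (M powr (p - 1) * (b - a))"
      using p by (intro mult_left_mono) auto
    moreover have "p * (b powr (p - 1) * (a - b)) = - (p * (b powr (p - 1) * (b - a)))"
      by (simp add: algebra_simps)
    ultimately show ?thesis by (simp only: mult.assoc)
  qed
  show ?thesis
  proof (cases "a \<le> b")
    case True
    then have "a powr p \<le> b powr p" using assms by (intro powr_mono2) auto
    then show ?thesis using *[of a b] True assms by simp
  next
    case False
    then have "b powr p \<le> a powr p" using assms by (intro powr_mono2) auto
    then show ?thesis using *[of b a] False assms by simp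
  qed
qed

context weak_solution_on
begin

text \<open>The lower bound for the rate does not depend on time, because both estimates end at
  \<open>v\<close>: Picone's inequality for the form, and monotonicity of
  \<open>a powr q * weight a\<close> together with \<open>v \<le> u t\<close> for the
  source.\<close>

lemma growth:
  fixes v :: "'a \<Rightarrow> real"
  assumes barr: "barrier e p q"
    and [measurable]: "v \<in> borel_measurable borel" and v: "\<And>x. 0 \<le> v x" "\<And>x. v x \<le> M"
    and supp: "\<And>x. x \<notin> \<Omega>0 \<Longrightarrow> v x = 0" and gag: "gagliardo s p v < \<infinity>"
    and above: "\<And>t. t \<in> {0..T} \<Longrightarrow> AE x in lborel. v x \<le> u t x"
  shows "T * (lam * (\<integral> x. v x powr q * (v x powr p * barrier.weight e p q (v x)) \<partial>lborel) - enn2real (gagliardo s p v))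
    \<le> (\<integral> x. v x powr p * barrier.primitive e p q (u T x) \<partial>lborel)"
proof -
  interpret B: barrier e p q by fact
  obtain Mu where Mu: "0 \<le> Mu" "\<And>t. t \<in> {0..T} \<Longrightarrow> AE x in lborel. u t x \<in> {0..Mu}"
    using u_bounds by blast
  then obtain w where tp: "\<And>t. t \<in> {0..T} \<Longrightarrow> time_primitive t u w u0"
    and weak: "AE t in lborel. t \<in> {0<..<T} \<longrightarrow> gagliardo s p (\<lambda>x. truncation Mu (u t x)) < \<infinity> \<and>
      (\<forall>\<phi> B. \<phi> \<in> borel_measurable borel \<longrightarrow> (\<forall>x. \<bar>\<phi> x\<bar> \<le> B) \<longrightarrow> (\<forall>x. x \<notin> \<Omega>0 \<longrightarrow> \<phi> x = 0) \<longrightarrow>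
        gagliardo s p \<phi> < \<infinity> \<longrightarrow>
        (\<integral> x. w t x * \<phi> x \<partial>lborel) + frac_form s p (\<lambda>x. truncation Mu (u t x)) \<phi>
          = (\<integral> x. lam * truncation Mu (u t x) powr q * \<phi> x \<partial>lborel))"
    using time_derivative[OF Mu] by blast
  have M: "0 \<le> M" using v order_trans by blast
  have bdd0: "bounded \<Omega>0" using \<Omega>(1) \<Omega>0(1) bounded_subset by blast
  have T: "T \<in> {0..T}" using T_pos by simp
  define K where "K = e powr (1 - p)"
  have K: "0 \<le> K" by (simp add: K_def)
  have weight_bd: "\<bar>B.weight a\<bar> \<le> K" if "0 \<le> a" for a
    using B.weight_nonneg B.weight_le[OF that] by (simp add: K_def)
  obtain C where C: "0 \<le> C" "\<And>a b. a \<in> {0..Mu} \<Longrightarrow> b \<in> {0..Mu} \<Longrightarrow> \<bar>B.weight b - B.weight a\<bar> \<le> C * \<bar>b - a\<bar>"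
    using B.weight_Lipschitz[of Mu] by blast
  have vp: "0 \<le> v x powr p" "v x powr p \<le> M powr p" for x
    using v p by (auto intro!: powr_mono2)
  have a_int: "integrable lborel (\<lambda>x. v x powr p)"
    by (rule integrable_bounded_support[OF bdd0 \<Omega>0(2), where B="M powr p"]) (use vp supp p in auto)
  define c where "c = lam * (\<integral> x. v x powr q * (v x powr p * B.weight (v x)) \<partial>lborel) - enn2real (gagliardo s p v)"
  interpret time_primitive T u w u0 by (rule tp[OF T])
  have B_bd: "\<bar>B.primitive a\<bar> \<le> K * Mu + K" "\<bar>B.weight a\<bar> \<le> K * Mu + K" if a: "a \<in> {0..Mu}" for a
  proof -
    have "B.primitive a \<le> K * a" using B.primitive_le_linear[of a] a by (simp add: K_def)
    also have "\<dots> \<le> K * Mu" using a K by (intro mult_left_mono) auto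
    finally show "\<bar>B.primitive a\<bar> \<le> K * Mu + K" using B.primitive_nonneg[of a] K by simp
    have "0 \<le> K * Mu" using K Mu by simp
    moreover have "\<bar>B.weight a\<bar> \<le> K" using weight_bd a by simp
    ultimately show "\<bar>B.weight a\<bar> \<le> K * Mu + K" by linarith
  qed
  have vp_abs: "\<bar>v x powr p\<bar> \<le> M powr p" for x using vp[of x] by simp
  have Taylor: "\<bar>B.primitive b - B.primitive a - B.weight a * (b - a)\<bar> \<le> C * (b - a)\<^sup>2"
    if "a \<in> {0..Mu}" "b \<in> {0..Mu}" for a b
    by (rule B.primitive_Taylor[OF C(2,1) that])
  have S: "{0..Mu} \<in> sets borel" by simp
  note wcr = weighted_chain_rule[OF B.primitive_measurable B.weight_measurable S a_int vp_abs Mu(2) C(1)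
      Taylor C(2) B_bd]
  define J where "J \<tau> = (\<integral> x. v x powr p * (B.weight (u \<tau> x) * w \<tau> x) \<partial>lborel)" for \<tau>
  have J_int: "integrable lborel (\<lambda>\<tau>. indicator {0<..T} \<tau> * J \<tau>)"
    unfolding J_def by (rule wcr(1))
  have J_eq: "(\<integral> x. v x powr p * B.primitive (u T x) \<partial>lborel) - (\<integral> x. v x powr p * B.primitive (u 0 x) \<partial>lborel)
      = (\<integral> \<tau>. indicator {0<..T} \<tau> * J \<tau> \<partial>lborel)"
    unfolding J_def by (rule wcr(2))
  have J_ge: "AE \<tau> in lborel. \<tau> \<in> {0<..<T} \<longrightarrow> c \<le> J \<tau>"
    using weak
  proof eventually_elim
    case (elim \<tau>)
    show ?case
    proof
      assume \<tau>T: "\<tau> \<in> {0<..<T}"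
      then have \<tau>: "\<tau> \<in> {0..T}" by auto
      note [measurable] = u_meas[OF \<tau>]
      define U where "U x = truncation Mu (u \<tau> x)" for x
      define \<phi> where "\<phi> x = v x powr p * B.weight (U x)" for x
      have [measurable]: "U \<in> borel_measurable borel" unfolding U_def by measurable
      have \<phi>_meas [measurable]: "\<phi> \<in> borel_measurable borel" unfolding \<phi>_def by measurable
      have U: "0 \<le> U x" "U x \<le> Mu" for x using Mu(1) by (auto simp: U_def truncation_bounds)
      have gU: "gagliardo s p U < \<infinity>" using elim \<tau>T by (simp add: U_def[abs_def])
      have \<phi>: "0 \<le> \<phi> x" "\<bar>\<phi> x\<bar> \<le> M powr p * K" for x
        using vp[of x] weight_bd[OF U(1)[of x]] B.weight_nonneg[of "U x"]
        by (auto simp: \<phi>_def abs_mult intro!: mult_mono)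
      have \<phi>0: "\<phi> x = 0" if "x \<notin> \<Omega>0" for x using supp[OF that] p by (simp add: \<phi>_def)
      have g\<phi>: "gagliardo s p \<phi> < \<infinity>"
      \<comment> \<open>Product rule for Lipschitz constants: \<open>K\<close> bounds the weight and
        \<open>p * M powr (p - 1)\<close> is the constant of \<open>v powr p\<close>, while
        \<open>M powr p\<close> bounds that power and \<open>C\<close> is the constant of the
        weight. The sum serves for both increments.\<close>
      proof (rule gagliardo_finite_Lipschitz[OF _ _ gag gU, where C="K * (p * M powr (p - 1)) + M powr p * C"])
        fix x y
        have 1: "\<bar>v x powr p - v y powr p\<bar> \<le> p * M powr (p - 1) * \<bar>v x - v y\<bar>"
          using v by (intro powr_Lipschitz p) auto
        have 2: "\<bar>B.weight (U x) - B.weight (U y)\<bar> \<le> C * \<bar>U x - U y\<bar>"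
          using U by (intro C(2)) auto
        have "\<phi> x - \<phi> y = (v x powr p - v y powr p) * B.weight (U x) + v y powr p * (B.weight (U x) - B.weight (U y))"
          by (simp add: \<phi>_def algebra_simps)
        then have "\<bar>\<phi> x - \<phi> y\<bar> \<le> \<bar>v x powr p - v y powr p\<bar> * \<bar>B.weight (U x)\<bar>
            + \<bar>v y powr p\<bar> * \<bar>B.weight (U x) - B.weight (U y)\<bar>"
          by (metis abs_mult abs_triangle_ineq)
        also have "\<dots> \<le> (p * M powr (p - 1) * \<bar>v x - v y\<bar>) * K + M powr p * (C * \<bar>U x - U y\<bar>)"
          using 1 2 weight_bd[OF U(1)[of x]] vp_abs[of y] C(1) p by (intro add_mono mult_mono) auto
        also have "\<dots> = (K * (p * M powr (p - 1))) * \<bar>v x - v y\<bar> + (M powr p * C) * \<bar>U x - U y\<bar>"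
          by (simp add: mult_ac)
        also have "\<dots> \<le> (K * (p * M powr (p - 1)) + M powr p * C) * \<bar>v x - v y\<bar>
            + (K * (p * M powr (p - 1)) + M powr p * C) * \<bar>U x - U y\<bar>"
          using K C(1) p by (intro add_mono mult_right_mono) auto
        finally show "\<bar>\<phi> x - \<phi> y\<bar> \<le> (K * (p * M powr (p - 1)) + M powr p * C) * (\<bar>v x - v y\<bar> + \<bar>U x - U y\<bar>)"
          by (simp add: distrib_left)
      qed (use p K C(1) in auto)
      have ae: "AE x in lborel. U x = u \<tau> x"
        using Mu(2)[OF \<tau>] by eventually_elim (simp add: U_def truncation_eq)
      have eq: "(\<integral> x. w \<tau> x * \<phi> x \<partial>lborel) + frac_form s p U \<phi> = (\<integral> x. lam * U x powr q * \<phi> x \<partial>lborel)"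
        using elim \<tau>T \<phi>_meas \<phi>(2) \<phi>0 g\<phi> unfolding U_def[symmetric] by blast
      have "frac_form s p U (\<lambda>x. v x powr p * B.slope (U x) powr (1 - p)) \<le> enn2real (gagliardo s p v)"
        by (rule frac_form_picone[OF p _ gag U(1) v(1) B.slope_pos B.slope_diff]) measurable
      then have picone: "frac_form s p U \<phi> \<le> enn2real (gagliardo s p v)"
        by (simp add: \<phi>_def[abs_def] B.weight_def)
      have intU: "integrable lborel (\<lambda>x. lam * U x powr q * \<phi> x)"
      proof (rule integrable_bounded_support[OF bdd0 \<Omega>0(2), where B="lam * Mu powr q * (M powr p * K)"])
        show "\<bar>lam * U x powr q * \<phi> x\<bar> \<le> lam * Mu powr q * (M powr p * K)" for x
          unfolding abs_mult[of "lam * U x powr q"] using U[of x] \<phi>(2)[of x] lam q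
          by (intro mult_mono) (auto intro!: powr_mono2)
      qed (use \<phi>0 in auto)
      have intv: "integrable lborel (\<lambda>x. v x powr q * (v x powr p * B.weight (v x)))"
      proof (rule integrable_bounded_support[OF bdd0 \<Omega>0(2), where B="M powr q * (M powr p * K)"])
        show "\<bar>v x powr q * (v x powr p * B.weight (v x))\<bar> \<le> M powr q * (M powr p * K)" for x
          unfolding abs_mult using v[of x] vp_abs[of x] weight_bd[OF v(1)[of x]] q K
          by (intro mult_mono) (auto intro!: powr_mono2 mult_nonneg_nonneg)
      qed (use supp p in auto)
      have "lam * (\<integral> x. v x powr q * (v x powr p * B.weight (v x)) \<partial>lborel)
          = (\<integral> x. lam * (v x powr q * (v x powr p * B.weight (v x))) \<partial>lborel)" by simp
      also have "\<dots> \<le> (\<integral> x. lam * U x powr q * \<phi> x \<partial>lborel)"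
      proof (rule integral_mono_AE[OF integrable_mult_right[OF intv] intU])
        show "AE x in lborel. lam * (v x powr q * (v x powr p * B.weight (v x))) \<le> lam * U x powr q * \<phi> x"
          using ae above[OF \<tau>]
        proof eventually_elim
          case (elim x)
          have "v x powr q * B.weight (v x) \<le> U x powr q * B.weight (U x)"
            by (rule B.powr_weight_mono[OF v(1)]) (use elim in simp)
          then have "lam * v x powr p * (v x powr q * B.weight (v x)) \<le> lam * v x powr p * (U x powr q * B.weight (U x))"
            using lam by (intro mult_left_mono) auto
          then show ?case by (simp add: \<phi>_def mult_ac)
        qed
      qed
      also have "\<dots> = J \<tau> + frac_form s p U \<phi>"
      proof -
        have "(\<integral> x. w \<tau> x * \<phi> x \<partial>lborel) = J \<tau>"
          unfolding J_def
        proof (rule integral_cong_AE)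
          show "AE x in lborel. w \<tau> x * \<phi> x = v x powr p * (B.weight (u \<tau> x) * w \<tau> x)"
            using ae by eventually_elim (simp add: \<phi>_def mult_ac)
        qed measurable
        then show ?thesis using eq by simp
      qed
      finally show "c \<le> J \<tau>" using picone by (simp add: c_def)
    qed
  qed
  have one: "integrable lborel (indicator {0<..T} :: real \<Rightarrow> real)"
    using T_pos by (intro integrable_real_indicator) auto
  have "T * c = (\<integral> \<tau>. c * indicator {0<..T} \<tau> \<partial>lborel)" using T_pos by simp
  also have "\<dots> \<le> (\<integral> \<tau>. indicator {0<..T} \<tau> * J \<tau> \<partial>lborel)"
  proof (rule integral_mono_AE[OF integrable_mult_right[OF one] J_int])
    show "AE \<tau> in lborel. c * indicator {0<..T} \<tau> \<le> indicator {0<..T} \<tau> * J \<tau>"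
      using J_ge AE_lborel_singleton[of T] by eventually_elim (auto simp: indicator_def)
  qed
  also have "\<dots> \<le> (\<integral> x. v x powr p * B.primitive (u T x) \<partial>lborel)"
  proof -
    have "0 \<le> (\<integral> x. v x powr p * B.primitive (u 0 x) \<partial>lborel)"
      by (rule Bochner_Integration.integral_nonneg) (simp add: B.primitive_nonneg)
    with J_eq show ?thesis by linarith
  qed
  finally show ?thesis by (simp add: c_def)
qed

end

text \<open>Two small parameters are chosen in succession. The shift \<open>\<epsilon>\<close> keeps
  the energy of the obstacle negative and determines the minimiser \<open>v\<close>; the barrier
  parameter \<open>e\<close> is then adapted to this \<open>v\<close>. Both choices rest on
  dominated convergence and a strict inequality in the limit.\<close>

lemma growth_certificate:
  fixes \<Omega> \<Omega>0 :: "'a::euclidean_space set" and u0 :: "'a \<Rightarrow> real"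
  assumes p: "1 < p" and q: "p - 1 < q" and lam: "0 < lam"
    and D: "bounded \<Omega>0" "\<Omega>0 \<in> sets borel"
    and u0: "u0 \<in> Hset s p lam q \<Omega> \<Omega>0" "Linf u0"
  obtains v :: "'a \<Rightarrow> real" and M \<epsilon> e where "v \<in> borel_measurable borel" "\<And>x. 0 \<le> v x" "\<And>x. v x \<le> M"
    "\<And>x. x \<notin> \<Omega>0 \<Longrightarrow> v x = 0" "gagliardo s p v < \<infinity>" "AE x in lborel. v x \<le> u0 x" "0 < \<epsilon>"
    "\<And>z. z \<in> borel_measurable borel \<Longrightarrow> (\<And>x. 0 \<le> z x \<and> z x \<le> v x) \<Longrightarrow> gagliardo s p z < \<infinity> \<Longrightarrow>
      gag_energy s p (shifted_power lam q \<epsilon>) v \<le> gag_energy s p (shifted_power lam q \<epsilon>) z"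
    "barrier e p q"
    "0 < lam * (\<integral> x. v x powr q * (v x powr p * barrier.weight e p q (v x)) \<partial>lborel) - enn2real (gagliardo s p v)"
proof -
  obtain v' where v': "v' \<in> W0 s p \<Omega>0" "AE x in lborel. 0 \<le> v' x \<and> v' x \<le> u0 x" "energy s p lam q \<Omega>0 v' < 0"
    using u0(1) by (auto simp: Hset_def)
  obtain M0 where M0: "AE x in lborel. \<bar>u0 x\<bar> \<le> M0" using u0(2) by (auto simp: Linf_def)
  define M where "M = max 0 M0"
  have [measurable]: "v' \<in> borel_measurable borel" using v'(1) by (simp add: W0_def)
  note [measurable] = D(2)
  \<comment> \<open>Agrees with \<open>v'\<close> almost everywhere, but has its bounds and its
    support at every point, as the obstacle problem requires.\<close>
  define v0 where "v0 x = indicator \<Omega>0 x * truncation M (v' x)" for x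
  have v0_meas [measurable]: "v0 \<in> borel_measurable borel" unfolding v0_def by measurable
  have v0_bd: "0 \<le> v0 x" "v0 x \<le> M" for x
    using truncation_bounds[of M "v' x"] by (auto simp: v0_def M_def indicator_def)
  have v0_supp: "v0 x = 0" if "x \<notin> \<Omega>0" for x using that by (simp add: v0_def)
  have v'_supp: "AE x in lborel. x \<notin> \<Omega>0 \<longrightarrow> v' x = 0" using v'(1) by (simp add: W0_def)
  have ae: "AE x in lborel. v' x = v0 x"
    using v'(2) v'_supp M0
  proof eventually_elim
    case (elim x)
    then have "v' x \<in> {0..M}" by (auto simp: M_def)
    then show ?case using elim by (cases "x \<in> \<Omega>0") (auto simp: v0_def truncation_eq)
  qed
  have v0_u0: "AE x in lborel. v0 x \<le> u0 x"
    using ae v'(2) by eventually_elim auto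
  have gag': "gagliardo s p v' = gagliardo s p v0" by (rule gagliardo_cong_AE[OF ae])
  have v0_gag: "gagliardo s p v0 < \<infinity>" using v'(1) unfolding gag'[symmetric] by (simp add: W0_def)
  have pw_int: "integrable lborel (\<lambda>x. z x powr (q + 1))"
    if [measurable]: "z \<in> borel_measurable borel" and z: "\<And>x. 0 \<le> z x" "\<And>x. z x \<le> v0 x" for z
  proof (rule integrable_bounded_support[OF D, where B="M powr (q + 1)"])
    show "\<bar>z x powr (q + 1)\<bar> \<le> M powr (q + 1)" for x
      using z(1)[of x] order_trans[OF z(2) v0_bd(2), of x] p q by (auto intro!: powr_mono2)
    show "z x powr (q + 1) = 0" if "x \<notin> \<Omega>0" for x
      using z(1)[of x] z(2)[of x] v0_supp[OF that] by simp
  qed measurable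
  have "(\<integral> x. indicator \<Omega>0 x * \<bar>v' x\<bar> powr (q + 1) \<partial>lborel) = (\<integral> x. v0 x powr (q + 1) \<partial>lborel)"
  proof (rule integral_cong_AE)
    show "AE x in lborel. indicator \<Omega>0 x * \<bar>v' x\<bar> powr (q + 1) = v0 x powr (q + 1)"
      using ae
    proof eventually_elim
      case (elim x)
      show ?case unfolding elim using v0_bd[of x] v0_supp[of x] by (cases "x \<in> \<Omega>0") auto
    qed
  qed measurable
  then have E0: "enn2real (gagliardo s p v0) / p - lam / (q + 1) * (\<integral> x. v0 x powr (q + 1) \<partial>lborel) < 0"
    using v'(3) by (simp add: energy_def gag')
  have q0: "0 < q" using p q by simp
  \<comment> \<open>One null sequence serves twice: index \<open>n\<close> gives the shift of the
    potential, a later index \<open>k\<close> the parameter of the barrier.\<close>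
  define \<epsilon> where "\<epsilon> n = inverse (real (Suc n))" for n
  have \<epsilon>: "0 < \<epsilon> n" for n by (simp add: \<epsilon>_def)
  have \<epsilon>_lim: "\<epsilon> \<longlonglongrightarrow> 0" unfolding \<epsilon>_def by (rule LIMSEQ_inverse_real_of_nat)
  have "(\<lambda>n. \<integral> x. shifted_power lam q (\<epsilon> n) (v0 x) \<partial>lborel) \<longlonglongrightarrow> (\<integral> x. lam / (q + 1) * v0 x powr (q + 1) \<partial>lborel)"
  proof (rule integral_dominated_convergence[where w="\<lambda>x. lam / (q + 1) * v0 x powr (q + 1)"])
    show "AE x in lborel. (\<lambda>n. shifted_power lam q (\<epsilon> n) (v0 x)) \<longlonglongrightarrow> lam / (q + 1) * v0 x powr (q + 1)"
    proof (rule AE_I2)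
      fix x
      have "(\<lambda>n. max 0 (v0 x - \<epsilon> n)) \<longlonglongrightarrow> max 0 (v0 x - 0)"
        by (intro tendsto_intros \<epsilon>_lim)
      then have "(\<lambda>n. max 0 (v0 x - \<epsilon> n)) \<longlonglongrightarrow> v0 x" using v0_bd(1)[of x] by simp
      then show "(\<lambda>n. shifted_power lam q (\<epsilon> n) (v0 x)) \<longlonglongrightarrow> lam / (q + 1) * v0 x powr (q + 1)"
        unfolding shifted_power_def using q0 by (intro tendsto_mult tendsto_const tendsto_powr2) auto
    qed
    show "AE x in lborel. norm (shifted_power lam q (\<epsilon> n) (v0 x)) \<le> lam / (q + 1) * v0 x powr (q + 1)" for n
      using shifted_power_bounds(1,2)[OF q0 lam v0_bd \<epsilon>] by (intro AE_I2) simp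
    show "integrable lborel (\<lambda>x. lam / (q + 1) * v0 x powr (q + 1))"
      by (intro integrable_mult_right pw_int v0_bd) auto
  qed measurable
  then have "(\<lambda>n. gag_energy s p (shifted_power lam q (\<epsilon> n)) v0)
      \<longlonglongrightarrow> enn2real (gagliardo s p v0) / p - (\<integral> x. lam / (q + 1) * v0 x powr (q + 1) \<partial>lborel)"
    unfolding gag_energy_def by (intro tendsto_intros)
  moreover have "enn2real (gagliardo s p v0) / p - (\<integral> x. lam / (q + 1) * v0 x powr (q + 1) \<partial>lborel) < 0"
    using E0 by (subst integral_mult_right_zero)
  ultimately have "eventually (\<lambda>n. gag_energy s p (shifted_power lam q (\<epsilon> n)) v0 < 0) sequentially"
    by (rule order_tendstoD(2))
  then obtain n where neg: "gag_energy s p (shifted_power lam q (\<epsilon> n)) v0 < 0"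
    by (auto simp: eventually_sequentially)
  let ?F = "shifted_power lam q (\<epsilon> n)"
  interpret obstacle s p ?F v0
  proof
    show "continuous_on UNIV ?F"
      unfolding shifted_power_def[abs_def] using q0 by (intro continuous_intros continuous_on_powr') auto
    show "0 \<le> ?F y" for y using lam q0 by (simp add: shifted_power_def)
    show "integrable lborel (\<lambda>x. ?F (v0 x))"
    proof (rule integrable_bounded_support[OF D, where B="lam / (q + 1) * M powr (q + 1)"])
      show "\<bar>?F (v0 x)\<bar> \<le> lam / (q + 1) * M powr (q + 1)" for x
        using shifted_power_bounds(1,3)[OF q0 lam v0_bd \<epsilon>, of n x] by simp
      show "?F (v0 x) = 0" if "x \<notin> \<Omega>0" for x
        using v0_supp[OF that] \<epsilon>[of n] q0 by (simp add: shifted_power_def)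
    qed measurable
  qed (use p v0_bd v0_gag shifted_power_mono[OF q0 lam] in auto)
  obtain v where v: "v \<in> gag_admissible s p v0" "\<And>z. z \<in> gag_admissible s p v0 \<Longrightarrow> gag_energy s p ?F v \<le> gag_energy s p ?F z"
    using energy_minimizer by blast
  have v_meas [measurable]: "v \<in> borel_measurable borel" and v_bd: "\<And>x. 0 \<le> v x" "\<And>x. v x \<le> v0 x"
    and v_gag: "gagliardo s p v < \<infinity>" using v(1) by (auto simp: gag_admissible_def)
  have v_M: "v x \<le> M" for x using v_bd(2) v0_bd(2) order_trans by blast
  have v_supp: "v x = 0" if "x \<notin> \<Omega>0" for x using v_bd[of x] v0_supp[OF that] by simp
  have "enn2real (gagliardo s p v) / p < (\<integral> x. ?F (v x) \<partial>lborel)"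
    using v(2)[OF v0_admissible] neg unfolding gag_energy_def by linarith
  also have "\<dots> \<le> (\<integral> x. lam / (q + 1) * v x powr (q + 1) \<partial>lborel)"
  proof (rule integral_mono)
    show "integrable lborel (\<lambda>x. ?F (v x))" by (rule F_integrable) (use v_bd in auto)
    show "integrable lborel (\<lambda>x. lam / (q + 1) * v x powr (q + 1))"
      by (intro integrable_mult_right pw_int v_bd) auto
    show "?F (v x) \<le> lam / (q + 1) * v x powr (q + 1)" for x
      by (rule shifted_power_bounds(2)[OF q0 lam v_bd(1) v_M \<epsilon>])
  qed
  finally have "enn2real (gagliardo s p v) / p < lam / (q + 1) * (\<integral> x. v x powr (q + 1) \<partial>lborel)" by simp
  then have "enn2real (gagliardo s p v) < p / (q + 1) * (lam * (\<integral> x. v x powr (q + 1) \<partial>lborel))"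
    using p by (simp add: field_simps)
  \<comment> \<open>Here superhomogeneity \<open>p - 1 < q\<close> enters, as
    \<open>p / (q + 1) \<le> 1\<close>.\<close>
  also have "\<dots> \<le> 1 * (lam * (\<integral> x. v x powr (q + 1) \<partial>lborel))"
    using p q lam by (intro mult_right_mono mult_nonneg_nonneg Bochner_Integration.integral_nonneg) auto
  finally have pos: "0 < lam * (\<integral> x. v x powr (q + 1) \<partial>lborel) - enn2real (gagliardo s p v)" by simp
  have barr: "barrier (\<epsilon> n) p q" for n using \<epsilon> p q by unfold_locales auto
  let ?w = "\<lambda>n x. v x powr q * (v x powr p * barrier.weight (\<epsilon> n) p q (v x))"
  \<comment> \<open>Since \<open>slope y\<close> is at least \<open>y\<close>, the weighted
    integrands are dominated by their limit, uniformly in the parameter.\<close>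
  have w_le: "0 \<le> ?w n x" "?w n x \<le> v x powr (q + 1)" for n x
  proof -
    interpret B: barrier "\<epsilon> n" p q by (rule barr)
    show "0 \<le> ?w n x" using B.weight_nonneg by simp
    show "?w n x \<le> v x powr (q + 1)"
    proof (cases "v x = 0")
      case False
      then have vx: "0 < v x" using v_bd(1)[of x] by simp
      have "v x \<le> B.slope (v x)" using \<epsilon>[of n] vx by (simp add: B.slope_def)
      then have "B.weight (v x) \<le> v x powr (1 - p)"
        unfolding B.weight_def using vx p by (intro powr_mono2') auto
      then have "?w n x \<le> v x powr q * (v x powr p * v x powr (1 - p))"
        by (intro mult_left_mono) auto
      also have "\<dots> = v x powr (q + 1)" using vx by (simp add: powr_add powr_diff)
      finally show ?thesis .
    qed simp
  qed
  have "(\<lambda>n. \<integral> x. ?w n x \<partial>lborel) \<longlonglongrightarrow> (\<integral> x. v x powr (q + 1) \<partial>lborel)"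
  proof (rule integral_dominated_convergence[where w="\<lambda>x. v x powr (q + 1)"])
    show "integrable lborel (\<lambda>x. v x powr (q + 1))" by (intro pw_int v_bd) auto
    show "(\<lambda>x. ?w n x) \<in> borel_measurable lborel" for n
    proof -
      interpret B: barrier "\<epsilon> n" p q by (rule barr)
      show ?thesis by measurable
    qed
    show "AE x in lborel. norm (?w n x) \<le> v x powr (q + 1)" for n
      using w_le by (intro AE_I2) (simp only: real_norm_def abs_of_nonneg)
    show "AE x in lborel. (\<lambda>n. ?w n x) \<longlonglongrightarrow> v x powr (q + 1)"
    proof (rule AE_I2)
      fix x
      show "(\<lambda>n. ?w n x) \<longlonglongrightarrow> v x powr (q + 1)"
      proof (cases "v x = 0")
        case False
        then have vx: "0 < v x" using v_bd(1)[of x] by simp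
        have "(\<lambda>n. v x + \<epsilon> n * (1 + v x) powr (q / (p - 1))) \<longlonglongrightarrow> v x + 0 * (1 + v x) powr (q / (p - 1))"
          by (intro tendsto_intros \<epsilon>_lim)
        then have "(\<lambda>n. (v x + \<epsilon> n * (1 + v x) powr (q / (p - 1))) powr (1 - p)) \<longlonglongrightarrow> v x powr (1 - p)"
          using vx by (intro tendsto_powr tendsto_const) auto
        then have "(\<lambda>n. ?w n x) \<longlonglongrightarrow> v x powr q * (v x powr p * v x powr (1 - p))"
          unfolding barrier.weight_def[OF barr] barrier.slope_def[OF barr] by (intro tendsto_mult_left)
        also have "v x powr q * (v x powr p * v x powr (1 - p)) = v x powr (q + 1)"
          using vx by (simp add: powr_add powr_diff)
        finally show ?thesis .
      qed simp
    qed
  qed measurable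
  then have "(\<lambda>n. lam * (\<integral> x. ?w n x \<partial>lborel) - enn2real (gagliardo s p v))
      \<longlonglongrightarrow> lam * (\<integral> x. v x powr (q + 1) \<partial>lborel) - enn2real (gagliardo s p v)"
    by (intro tendsto_intros)
  from order_tendstoD(1)[OF this pos] obtain k where
    "0 < lam * (\<integral> x. ?w k x \<partial>lborel) - enn2real (gagliardo s p v)"
    by (auto simp: eventually_sequentially)
  moreover have "gag_energy s p ?F v \<le> gag_energy s p ?F z"
    if "z \<in> borel_measurable borel" "\<And>x. 0 \<le> z x \<and> z x \<le> v x" "gagliardo s p z < \<infinity>" for z
    using that v_bd(2) order_trans by (intro v(2)) (simp add: gag_admissible_def, blast)
  moreover have "AE x in lborel. v x \<le> u0 x"
    using v0_u0
  proof eventually_elim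
    case (elim x) then show ?case using v_bd(2)[of x] by simp
  qed
  ultimately show ?thesis
    using v_meas v_bd(1) v_M v_supp v_gag \<epsilon> barr by (intro that[of v M "\<epsilon> n" "\<epsilon> k"]) auto
qed

section \<open>Conclusion in the three regimes of the exponent\<close>

lemma integral_le_dominated:
  fixes f g :: "'a \<Rightarrow> real"
  assumes "integrable M g" and "f \<in> borel_measurable M" and "AE x in M. 0 \<le> f x \<and> f x \<le> g x"
  shows "(\<integral> x. f x \<partial>M) \<le> (\<integral> x. g x \<partial>M)"
proof (rule integral_mono_AE[OF _ assms(1)])
  show "integrable M f"
  proof (rule Bochner_Integration.integrable_bound[OF assms(1,2)])
    show "AE x in M. norm (f x) \<le> norm (g x)" using assms(3) by eventually_elim simp
  qed
  show "AE x in M. f x \<le> g x" using assms(3) by eventually_elim simp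
qed

theorem theorem1p8:
  fixes \<Omega> \<Omega>0 :: "'a::euclidean_space set"
    and b u0 :: "'a \<Rightarrow> real"
    and s p q r lam :: real
  assumes dim: "DIM('a) \<ge> 2"
    and dom: "regular_domain \<Omega>"
    and s: "0 < s" "s < 1"
    and p: "1 < p"
    and r: "r > p - 1"
    and b_meas: "b \<in> borel_measurable lborel"
    and b_bdd: "\<exists>M. AE x in lborel. x \<in> \<Omega> \<longrightarrow> \<bar>b x\<bar> \<le> M"
    and b_nonneg: "\<forall>x\<in>\<Omega>. 0 \<le> b x"
    and b_nz: "emeasure lborel {x \<in> \<Omega>. b x \<noteq> 0} > 0"
    and b_zero: "{x \<in> \<Omega>. b x = 0} = closure \<Omega>0"
    and O0: "\<Omega>0 \<subseteq> \<Omega>" "C11_open \<Omega>0" "emeasure lborel \<Omega>0 > 0"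
    and lam: "lam > 0"
    and q: "q > p - 1"
    and u0_H: "u0 \<in> Hset s p lam q \<Omega> \<Omega>0"
    and u0_Linf: "Linf u0"
    and u0_nonneg: "AE x in lborel. 0 \<le> u0 x"
  shows "(q > 1 \<longrightarrow> Tmax s p \<Omega> b lam q r u0 < \<infinity>)
       \<and> (q = 1 \<longrightarrow> (\<forall>u. thm14_global s p \<Omega> b lam q r u0 u \<longrightarrow>
            filterlim (\<lambda>t. sqrt (\<integral> x. indicator \<Omega>0 x * (u t x)\<^sup>2 \<partial>lborel)) at_top at_top))
       \<and> (q < 1 \<longrightarrow> (\<forall>u. thm14_global s p \<Omega> b lam q r u0 u \<longrightarrow>
            (SUP t\<in>{0<..}. esssup (restrict_space lborel \<Omega>0) (\<lambda>x. ereal \<bar>u t x\<bar>)) = \<infinity>))"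
proof -
  have \<Omega>: "bounded \<Omega>" "\<Omega> \<in> sets borel" using dom by (auto simp: regular_domain_def C11_open_def)
  have D: "bounded \<Omega>0" "\<Omega>0 \<in> sets borel"
    using \<Omega>(1) O0(1,2) bounded_subset by (auto simp: C11_open_def)
  note [measurable] = D(2)
  have b0: "b x = 0" if "x \<in> \<Omega>0" for x
    using that closure_subset[of \<Omega>0] b_zero by blast
  have q0: "0 < q" using p q by simp
  obtain v M \<epsilon> e where v_meas [measurable]: "v \<in> borel_measurable borel" and v: "\<And>x. 0 \<le> v x" "\<And>x. v x \<le> M"
    and supp: "\<And>x. x \<notin> \<Omega>0 \<Longrightarrow> v x = 0" and gag: "gagliardo s p v < \<infinity>"
    and init: "AE x in lborel. v x \<le> u0 x" and \<epsilon>: "0 < \<epsilon>"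
    and minimal: "\<And>z. z \<in> borel_measurable borel \<Longrightarrow> (\<And>x. 0 \<le> z x \<and> z x \<le> v x) \<Longrightarrow> gagliardo s p z < \<infinity> \<Longrightarrow>
      gag_energy s p (shifted_power lam q \<epsilon>) v \<le> gag_energy s p (shifted_power lam q \<epsilon>) z"
    and barr: "barrier e p q"
    and pos: "0 < lam * (\<integral> x. v x powr q * (v x powr p * barrier.weight e p q (v x)) \<partial>lborel) - enn2real (gagliardo s p v)"
    using growth_certificate[OF p q lam D u0_H u0_Linf] by blast
  interpret B: barrier e p q by (rule barr)
  define c where "c = lam * (\<integral> x. v x powr q * (v x powr p * B.weight (v x)) \<partial>lborel) - enn2real (gagliardo s p v)"
  have c: "0 < c" using pos by (simp add: c_def)
  have vp_supp: "v x powr p = 0" if "x \<notin> \<Omega>0" for x using supp[OF that] by simp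
  have vp_le: "v x powr p \<le> M powr p" for x using v p by (intro powr_mono2) auto
  have vp_int: "integrable lborel (\<lambda>x. v x powr p)"
    by (rule integrable_bounded_support[OF D, where B="M powr p"]) (use vp_le vp_supp in auto)
  define A where "A = (\<integral> x. v x powr p \<partial>lborel)"
  have A: "0 \<le> A" unfolding A_def by (rule Bochner_Integration.integral_nonneg) simp
  have sol: "weak_solution_on s p lam q r T \<Omega> \<Omega>0 b u0 u"
    if "weak_solution s p \<Omega> b lam q r u0 T u" for T u
    using that p q0 lam \<Omega> O0(1) D(2) b0 u0_Linf by unfold_locales (auto simp: Linf_def)
  have growth_bound: "T * c \<le> (\<integral> x. v x powr p * B.primitive (u T x) \<partial>lborel)"
    if "weak_solution s p \<Omega> b lam q r u0 T u" for T u
  proof -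
    interpret weak_solution_on s p lam q r T \<Omega> \<Omega>0 b u0 u by (rule sol[OF that])
    have above: "AE x in lborel. v x \<le> u t x" if "t \<in> {0..T}" for t
      by (rule comparison[OF v_meas v supp gag init \<epsilon> minimal that])
    show ?thesis unfolding c_def by (rule growth[OF barr v_meas v supp gag above])
  qed
  define K where "K = e powr (1 - p)"
  have K: "0 < K" using B.e by (simp add: K_def)
  \<comment> \<open>The linear bound on \<open>primitive\<close> turns the growth estimate into one
    for the integral of \<open>v powr p * u T\<close>, from which both norms in question are read
    off.\<close>
  have linear_growth: "T * c \<le> K * (\<integral> x. v x powr p * u T x \<partial>lborel)"
    and u_T: "u T \<in> borel_measurable borel" "AE x in lborel. 0 \<le> u T x" "integrable lborel (\<lambda>x. (u T x)\<^sup>2 * indicator \<Omega>0 x)"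
      "integrable lborel (\<lambda>x. v x powr p * u T x)"
    if ws: "weak_solution s p \<Omega> b lam q r u0 T u" for T u
  proof -
    interpret weak_solution_on s p lam q r T \<Omega> \<Omega>0 b u0 u by (rule sol[OF ws])
    have T: "T \<in> {0..T}" using T_pos by simp
    show u_meas' [measurable]: "u T \<in> borel_measurable borel" by (rule u_meas[OF T])
    obtain Mu where Mu: "0 \<le> Mu" "AE x in lborel. u T x \<in> {0..Mu}" using u_bounds T by blast
    show "AE x in lborel. 0 \<le> u T x" using Mu(2) by eventually_elim simp
    show int: "integrable lborel (\<lambda>x. v x powr p * u T x)"
    proof (rule Bochner_Integration.integrable_bound[OF integrable_mult_right[OF vp_int, of Mu]])
      show "AE x in lborel. norm (v x powr p * u T x) \<le> norm (Mu * v x powr p)"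
        using Mu(2)
      proof eventually_elim
        case (elim x)
        then have "v x powr p * u T x \<le> v x powr p * Mu" by (intro mult_left_mono) auto
        then show ?case using elim Mu(1) by (simp add: mult.commute)
      qed
    qed measurable
    have "integrable lborel (\<lambda>x. Mu\<^sup>2 * indicator \<Omega>0 x)"
      using emeasure_bounded_finite[OF D(1)] by (intro integrable_mult_right integrable_real_indicator) auto
    then show "integrable lborel (\<lambda>x. (u T x)\<^sup>2 * indicator \<Omega>0 x)"
    proof (rule Bochner_Integration.integrable_bound)
      show "AE x in lborel. norm ((u T x)\<^sup>2 * indicator \<Omega>0 x) \<le> norm (Mu\<^sup>2 * indicator \<Omega>0 x :: real)"
        using Mu(2)
      proof eventually_elim
        case (elim x)
        then have "(u T x)\<^sup>2 \<le> Mu\<^sup>2" by (intro power_mono) auto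
        then show ?case by (simp add: indicator_def)
      qed
    qed measurable
    have "T * c \<le> (\<integral> x. v x powr p * B.primitive (u T x) \<partial>lborel)" by (rule growth_bound[OF ws])
    also have "\<dots> \<le> (\<integral> x. K * (v x powr p * u T x) \<partial>lborel)"
    proof (rule integral_le_dominated[OF integrable_mult_right[OF int]])
      show "AE x in lborel. 0 \<le> v x powr p * B.primitive (u T x) \<and> v x powr p * B.primitive (u T x) \<le> K * (v x powr p * u T x)"
        using Mu(2)
      proof eventually_elim
        case (elim x)
        then have "v x powr p * B.primitive (u T x) \<le> v x powr p * (K * u T x)"
          using B.primitive_le_linear[of "u T x"] by (intro mult_left_mono) (auto simp: K_def)
        then show ?case using B.primitive_nonneg by (simp add: mult_ac)
      qed
    qed measurable
    finally show "T * c \<le> K * (\<integral> x. v x powr p * u T x \<partial>lborel)" by simp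
  qed
  have i: "Tmax s p \<Omega> b lam q r u0 < \<infinity>" if q1: "q > 1"
  proof -
    \<comment> \<open>The bound involves neither \<open>T\<close> nor \<open>u\<close>, so it limits
      every existence time at once.\<close>
    have "T \<le> K / (q - 1) * A / c" if ws: "weak_solution s p \<Omega> b lam q r u0 T u" for T u
    proof -
      note [measurable] = u_T(1)[OF ws]
      have "T * c \<le> (\<integral> x. v x powr p * B.primitive (u T x) \<partial>lborel)" by (rule growth_bound[OF ws])
      also have "\<dots> \<le> (\<integral> x. K / (q - 1) * v x powr p \<partial>lborel)"
      proof (rule integral_le_dominated[OF integrable_mult_right[OF vp_int]])
        show "AE x in lborel. 0 \<le> v x powr p * B.primitive (u T x) \<and> v x powr p * B.primitive (u T x) \<le> K / (q - 1) * v x powr p"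
          using u_T(2)[OF ws]
        proof eventually_elim
          case (elim x)
          have "v x powr p * B.primitive (u T x) \<le> v x powr p * (K / (q - 1))"
            using B.primitive_bounded[OF elim q1] by (intro mult_left_mono) (auto simp: K_def)
          then show ?case using B.primitive_nonneg by (simp add: mult.commute)
        qed
      qed measurable
      also have "\<dots> = K / (q - 1) * A" unfolding A_def by (rule integral_mult_right_zero)
      finally show ?thesis by (simp only: pos_le_divide_eq[OF c])
    qed
    then have "Tmax s p \<Omega> b lam q r u0 \<le> ereal (K / (q - 1) * A / c)"
      unfolding Tmax_def thm14_solution_def by (intro Sup_least) auto
    then show ?thesis by (rule le_less_trans) simp
  qed
  have ws: "weak_solution s p \<Omega> b lam q r u0 t u" if "thm14_global s p \<Omega> b lam q r u0 u" "0 < t" for t u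
    using that by (simp add: thm14_global_def thm14_solution_def)
  have ii: "filterlim (\<lambda>t. sqrt (\<integral> x. indicator \<Omega>0 x * (u t x)\<^sup>2 \<partial>lborel)) at_top at_top"
    if glob: "thm14_global s p \<Omega> b lam q r u0 u" for u
  proof -
    define A2 where "A2 = (\<integral> x. (v x powr p)\<^sup>2 \<partial>lborel)"
    have A2_int: "integrable lborel (\<lambda>x. (v x powr p)\<^sup>2)"
    proof (rule integrable_bounded_support[OF D, where B="(M powr p)\<^sup>2"])
      show "\<bar>(v x powr p)\<^sup>2\<bar> \<le> (M powr p)\<^sup>2" for x
        using power_mono[OF vp_le, of x 2] by simp
    qed (use vp_supp in auto)
    \<comment> \<open>The elementary bound of a product of nonnegative numbers by the sum of their
      squares suffices in place of Cauchy-Schwarz: the squared norm grows at least linearly. The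
      support of \<open>v\<close> confines the integral to \<open>\<Omega>0\<close>.\<close>
    have lower: "t * c / K - A2 \<le> (\<integral> x. indicator \<Omega>0 x * (u t x)\<^sup>2 \<partial>lborel)" if t: "0 < t" for t
    proof -
      note w = ws[OF glob t]
      note [measurable] = u_T(1)[OF w]
      have "(\<integral> x. v x powr p * u t x \<partial>lborel) \<le> (\<integral> x. (v x powr p)\<^sup>2 + (u t x)\<^sup>2 * indicator \<Omega>0 x \<partial>lborel)"
      proof (rule integral_le_dominated)
        show "AE x in lborel. 0 \<le> v x powr p * u t x \<and> v x powr p * u t x \<le> (v x powr p)\<^sup>2 + (u t x)\<^sup>2 * indicator \<Omega>0 x"
          using u_T(2)[OF w]
        proof eventually_elim
          case (elim x)
          have nn: "0 \<le> v x powr p * u t x" using elim by simp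
          have "2 * (v x powr p * u t x) \<le> (v x powr p)\<^sup>2 + (u t x)\<^sup>2"
            using sum_squares_bound[of "v x powr p" "u t x"] by (simp add: mult.assoc)
          with nn have "v x powr p * u t x \<le> (v x powr p)\<^sup>2 + (u t x)\<^sup>2" by linarith
          with nn vp_supp[of x] show ?case by (cases "x \<in> \<Omega>0") auto
        qed
      qed (use A2_int u_T(3)[OF w] in auto)
      also have "\<dots> = A2 + (\<integral> x. indicator \<Omega>0 x * (u t x)\<^sup>2 \<partial>lborel)"
        using A2_int u_T(3)[OF w] by (simp add: A2_def mult.commute)
      finally have "K * (\<integral> x. v x powr p * u t x \<partial>lborel) \<le> K * (A2 + (\<integral> x. indicator \<Omega>0 x * (u t x)\<^sup>2 \<partial>lborel))"
        using K by (intro mult_left_mono) auto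
      with linear_growth[OF w] have "t * c \<le> K * (A2 + (\<integral> x. indicator \<Omega>0 x * (u t x)\<^sup>2 \<partial>lborel))" by linarith
      then have "t * c / K \<le> A2 + (\<integral> x. indicator \<Omega>0 x * (u t x)\<^sup>2 \<partial>lborel)"
        using K by (simp add: pos_divide_le_eq mult.commute)
      then show ?thesis by simp
    qed
    show ?thesis
      unfolding filterlim_at_top
    proof
      fix Z :: real
      show "eventually (\<lambda>t. Z \<le> sqrt (\<integral> x. indicator \<Omega>0 x * (u t x)\<^sup>2 \<partial>lborel)) at_top"
        using eventually_ge_at_top[of "(Z\<^sup>2 + A2) * K / c"] eventually_gt_at_top[of 0]
      proof eventually_elim
        case (elim t)
        then have "Z\<^sup>2 \<le> t * c / K - A2" using c K by (simp add: field_simps)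
        also have "\<dots> \<le> (\<integral> x. indicator \<Omega>0 x * (u t x)\<^sup>2 \<partial>lborel)" by (rule lower[OF elim(2)])
        finally show ?case by (rule real_le_rsqrt)
      qed
    qed
  qed
  have iii: "(SUP t\<in>{0<..}. esssup (restrict_space lborel \<Omega>0) (\<lambda>x. ereal \<bar>u t x\<bar>)) = \<infinity>"
    if glob: "thm14_global s p \<Omega> b lam q r u0 u" for u
  proof (rule ccontr)
    let ?S = "SUP t\<in>{0<..}. esssup (restrict_space lborel \<Omega>0) (\<lambda>x. ereal \<bar>u t x\<bar>)"
    assume "?S \<noteq> \<infinity>"
    \<comment> \<open>An upper bound is enough here; it also covers the formal value
      \<open>-\<infinity>\<close> of the supremum.\<close>
    then obtain R where R: "?S \<le> ereal R" by (cases ?S) auto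
    have bound: "t * c \<le> K * (R * A)" if t: "0 < t" for t
    proof -
      note w = ws[OF glob t]
      note [measurable] = u_T(1)[OF w]
      have "AE x in restrict_space lborel \<Omega>0. ereal \<bar>u t x\<bar> \<le> esssup (restrict_space lborel \<Omega>0) (\<lambda>x. ereal \<bar>u t x\<bar>)"
        by (rule esssup_AE)
      then have "AE x in restrict_space lborel \<Omega>0. ereal \<bar>u t x\<bar> \<le> ereal R"
      proof eventually_elim
        case (elim x)
        also have "esssup (restrict_space lborel \<Omega>0) (\<lambda>x. ereal \<bar>u t x\<bar>) \<le> ereal R"
          using t by (intro order_trans[OF SUP_upper R]) auto
        finally show ?case .
      qed
      then have uR: "AE x in lborel. x \<in> \<Omega>0 \<longrightarrow> \<bar>u t x\<bar> \<le> R"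
        by (subst (asm) AE_restrict_space_iff) auto
      have "(\<integral> x. v x powr p * u t x \<partial>lborel) \<le> (\<integral> x. R * v x powr p \<partial>lborel)"
      proof (rule integral_le_dominated[OF integrable_mult_right[OF vp_int]])
        show "AE x in lborel. 0 \<le> v x powr p * u t x \<and> v x powr p * u t x \<le> R * v x powr p"
          using uR u_T(2)[OF w]
        proof eventually_elim
          case (elim x)
          show ?case
          proof (cases "x \<in> \<Omega>0")
            case True
            then have "v x powr p * u t x \<le> v x powr p * R" using elim by (intro mult_left_mono) auto
            then show ?thesis using elim by (simp add: mult.commute)
          qed (simp add: vp_supp)
        qed
      qed measurable
      then have "K * (\<integral> x. v x powr p * u t x \<partial>lborel) \<le> K * (R * A)"
        using K by (intro mult_left_mono) (auto simp: A_def)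
      with linear_growth[OF w] show ?thesis by linarith
    qed
    \<comment> \<open>A time at which the linear lower bound exceeds the fixed upper bound by
      \<open>c\<close>.\<close>
    define t where "t = \<bar>K * (R * A)\<bar> / c + 1"
    have "0 < t" using c by (simp add: t_def add_nonneg_pos)
    have "t * c = \<bar>K * (R * A)\<bar> + c" using c by (simp add: t_def field_simps)
    with bound[OF \<open>0 < t\<close>] c show False by linarith
  qed
  show ?thesis using i ii iii by blast
qed

end
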